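(* Let $X$ be a closed dilation surface with at least one horizon saddle connection $L$. Then the directions of hyperbolic closed geodesics of $X$ form a dense subset of $\mathbb{S}^{1}$.
   Context: A closed dilation surface is a compact connected topological surface $X$ without boundary, with a finite set $\Sigma \subset X$ of singularities and an atlas of charts on $X \setminus \Sigma$ with values in $\mathbb{C}$ whose transition maps are of the form $z \mapsto az+b$ with $a \in \mathbb{R}_{>0}$, $b \in \mathbb{C}$, and such that near each singularity the structure is obtained from a flat cone of angle $2\pi i$ ($i\geq 1$ an integer) by cutting along a ray from the apex and identifying the two sides of the cut by a homothety of some ratio $\rho>0$. (Marked points, i.e. $i=1$, $\rho=1$, are allowed in $\Sigma$.) Directions (elements of $\mathbb{S}^1$) are globally defined on $X$. A trajectory is a path in $X\setminus\Sigma$ which in charts is a straight line travelled in a given direction. A saddle connection is a geodesic segment (locally straight in charts) in $X \setminus \Sigma$ with both endpoints singularities. A horizon saddle connection is a saddle connection $L$ for which there exists a number $k$ such that no trajectory of $X$ crosses $L$ more than $k$ times; by convention, a closed geodesic crossing $L$ is considered to cross it infinitely many times. A closed geodesic is hyperbolic if the linear part of its holonomy (its dilation ratio) is different from $1$; it is then oriented so that its holonomy is contracting, so its direction is a well-defined element of $\mathbb{S}^1$. *)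

theory Defs
  imports "HOL-Analysis.Analysis"
begin

text \<open>
  A dilation surface consists of a topological space, a set of singularities, and an atlas of
  complex charts \<open>(U, f)\<close> on the complement of the singularities.
\<close>

record 'a dilation_surface =
  top_space :: "'a topology"
  sings :: "'a set"
  atlas :: "('a set \<times> ('a \<Rightarrow> complex)) set"

definition regular_part :: "('a, 'b) dilation_surface_scheme \<Rightarrow> 'a set" where
  "regular_part X = topspace (top_space X) - sings X"

definition topological_surface :: "'a topology \<Rightarrow> bool" where
  "topological_surface T \<longleftrightarrow>
     Hausdorff_space T \<and> second_countable T \<and>
     (\<forall>p \<in> topspace T. \<exists>U V. openin T U \<and> p \<in> U \<and> open (V :: complex set) \<and>
        subtopology T U homeomorphic_space top_of_set V)"

text \<open>\<open>dilation_germ T p f a g\<close>: near \<open>p\<close>, \<open>f = a g + b\<close> with \<open>a > 0\<close> and some complex \<open>b\<close>.\<close>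

definition dilation_germ ::
    "'a topology \<Rightarrow> 'a \<Rightarrow> ('a \<Rightarrow> complex) \<Rightarrow> real \<Rightarrow> ('a \<Rightarrow> complex) \<Rightarrow> bool" where
  "dilation_germ T p f a g \<longleftrightarrow>
     a > 0 \<and> (\<exists>b. \<forall>\<^sub>F q in nhdsin T p. f q = of_real a * g q + b)"

text \<open>
  As usual for geometric structures, transition maps are required to be of the form
  \<open>z \<mapsto> a z + b\<close> locally, i.e. \<open>a\<close> and \<open>b\<close> may differ between components of an overlap.
\<close>

definition dilation_atlas :: "('a, 'b) dilation_surface_scheme \<Rightarrow> bool" where
  "dilation_atlas X \<longleftrightarrow>
     (\<Union>(U, f) \<in> atlas X. U) = regular_part X \<and>
     (\<forall>(U, f) \<in> atlas X. openin (top_space X) U \<and> open (f ` U) \<and>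
        homeomorphic_map (subtopology (top_space X) U) (top_of_set (f ` U)) f) \<and>
     (\<forall>(U, f) \<in> atlas X. \<forall>(V, g) \<in> atlas X. \<forall>p \<in> U \<inter> V.
        \<exists>a. dilation_germ (top_space X) p f a g)"

text \<open>
  Polar coordinates \<open>(r, \<theta>)\<close> on the flat cone of angle \<open>2\<pi>k\<close> cut along a ray. The relation
  \<open>cone_glue k \<rho>\<close> collapses \<open>r = 0\<close> to the apex and identifies the two sides \<open>\<theta> = 0\<close> and
  \<open>\<theta> = 2\<pi>k\<close> of the cut by the homothety of ratio \<open>\<rho>\<close>. Since homotheties commute with rotations,
  the result does not depend on the direction of the cut.
\<close>

definition cut_cone :: "nat \<Rightarrow> (real \<times> real) set" where
  "cut_cone k = {(r, \<theta>). 0 \<le> r \<and> 0 \<le> \<theta> \<and> \<theta> \<le> 2 * pi * real k}"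

definition cone_glue :: "nat \<Rightarrow> real \<Rightarrow> real \<times> real \<Rightarrow> real \<times> real \<Rightarrow> bool" where
  "cone_glue k \<rho> x y \<longleftrightarrow>
     x = y \<or> (fst x = 0 \<and> fst y = 0) \<or>
     (snd x = 0 \<and> snd y = 2 * pi * real k \<and> fst y = \<rho> * fst x) \<or>
     (snd y = 0 \<and> snd x = 2 * pi * real k \<and> fst x = \<rho> * fst y)"

text \<open>
  The map \<open>q\<close> identifies a neighbourhood of the apex of the glued cone, that is, a saturated
  relatively open set \<open>W\<close> of the cut cone modulo \<open>cone_glue\<close>, with a neighbourhood \<open>U\<close> of \<open>s\<close>.
  The flat coordinate of the cone is \<open>r cis \<theta>\<close>; at a point on the cut the last clause applies
  on both of its sides.
\<close>

definition cone_singularity :: "('a, 'b) dilation_surface_scheme \<Rightarrow> 'a \<Rightarrow> bool" where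
  "cone_singularity X s \<longleftrightarrow>
     (\<exists>k \<rho> W U q. 1 \<le> k \<and> 0 < \<rho> \<and>
        openin (top_of_set (cut_cone k)) W \<and> (0, 0) \<in> W \<and>
        (\<forall>x \<in> W. \<forall>y \<in> cut_cone k. cone_glue k \<rho> x y \<longrightarrow> y \<in> W) \<and>
        openin (top_space X) U \<and> U \<inter> sings X = {s} \<and>
        quotient_map (top_of_set W) (subtopology (top_space X) U) q \<and>
        (\<forall>x \<in> W. \<forall>y \<in> W. q x = q y \<longleftrightarrow> cone_glue k \<rho> x y) \<and>
        q (0, 0) = s \<and>
        (\<forall>x \<in> W. fst x > 0 \<longrightarrow> (\<forall>(V, f) \<in> atlas X. q x \<in> V \<longrightarrow>
           (\<exists>a b. (a :: real) > 0 \<and> (\<forall>\<^sub>F y in nhdsin (top_of_set W) x.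
              f (q y) = of_real a * (of_real (fst y) * cis (snd y)) + b)))))"

definition closed_dilation_surface :: "('a, 'b) dilation_surface_scheme \<Rightarrow> bool" where
  "closed_dilation_surface X \<longleftrightarrow>
     topological_surface (top_space X) \<and>
     compact_space (top_space X) \<and> connected_space (top_space X) \<and>
     finite (sings X) \<and> sings X \<subseteq> topspace (top_space X) \<and>
     dilation_atlas X \<and> (\<forall>s \<in> sings X. cone_singularity X s)"

text \<open>
  A path defined on an interval \<open>I\<close> which moves strictly forward along straight lines of
  direction \<open>u\<close> in charts; the parametrization is otherwise arbitrary. A closed geodesic followed
  repeatedly is a trajectory with \<open>I = UNIV\<close>.
\<close>

definition trajectory ::
    "('a, 'b) dilation_surface_scheme \<Rightarrow> real set \<Rightarrow> (real \<Rightarrow> 'a) \<Rightarrow> complex \<Rightarrow> bool" where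
  "trajectory X I \<gamma> u \<longleftrightarrow>
     is_interval I \<and> u \<in> sphere 0 1 \<and>
     continuous_map (top_of_set I) (subtopology (top_space X) (regular_part X)) \<gamma> \<and>
     (\<forall>t \<in> I. \<forall>(U, f) \<in> atlas X. \<gamma> t \<in> U \<longrightarrow>
        (\<exists>\<epsilon>>0. \<forall>s \<in> I \<inter> ball t \<epsilon>. \<forall>s' \<in> I \<inter> ball t \<epsilon>. s < s' \<longrightarrow>
           (\<exists>c. (c :: real) > 0 \<and> f (\<gamma> s') - f (\<gamma> s) = of_real c * u)))"

definition saddle_connection ::
    "('a, 'b) dilation_surface_scheme \<Rightarrow> (real \<Rightarrow> 'a) \<Rightarrow> complex \<Rightarrow> bool" where
  "saddle_connection X L u \<longleftrightarrow>
     continuous_map (top_of_set {0..1}) (top_space X) L \<and>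
     L 0 \<in> sings X \<and> L 1 \<in> sings X \<and> trajectory X {0<..<1} L u"

definition closed_geodesic ::
    "('a, 'b) dilation_surface_scheme \<Rightarrow> (real \<Rightarrow> 'a) \<Rightarrow> complex \<Rightarrow> bool" where
  "closed_geodesic X \<gamma> u \<longleftrightarrow> trajectory X {0..1} \<gamma> u \<and> \<gamma> 0 = \<gamma> 1"

text \<open>
  Crossings are transverse: a trajectory of direction \<open>u\<close> or \<open>-u\<close> meeting the interior of a saddle
  connection of direction \<open>u\<close> runs along it and does not cross it. A crossing takes place at a
  time at which the trajectory passes from one side to the other, hence at an interior time.
\<close>

definition crossing_times ::
    "(real \<Rightarrow> 'a) \<Rightarrow> complex \<Rightarrow> real set \<Rightarrow> (real \<Rightarrow> 'a) \<Rightarrow> complex \<Rightarrow> real set" where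
  "crossing_times L u I \<gamma> v =
     (if v = u \<or> v = - u then {} else {t \<in> interior I. \<gamma> t \<in> L ` {0<..<1}})"

definition closed_geodesic_crosses ::
    "(real \<Rightarrow> 'a) \<Rightarrow> complex \<Rightarrow> (real \<Rightarrow> 'a) \<Rightarrow> complex \<Rightarrow> bool" where
  "closed_geodesic_crosses L u \<gamma> v \<longleftrightarrow>
     v \<noteq> u \<and> v \<noteq> - u \<and> \<gamma> ` {0..1} \<inter> L ` {0<..<1} \<noteq> {}"

text \<open>
  The last clause is the convention that a closed geodesic crossing \<open>L\<close> crosses it infinitely often.
\<close>

definition horizon_saddle_connection ::
    "('a, 'b) dilation_surface_scheme \<Rightarrow> (real \<Rightarrow> 'a) \<Rightarrow> bool" where
  "horizon_saddle_connection X L \<longleftrightarrow>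
     (\<exists>u. saddle_connection X L u \<and>
        (\<exists>k::nat. \<forall>I \<gamma> v. trajectory X I \<gamma> v \<longrightarrow>
           finite (crossing_times L u I \<gamma> v) \<and> card (crossing_times L u I \<gamma> v) \<le> k) \<and>
        (\<forall>\<gamma> v. closed_geodesic X \<gamma> v \<longrightarrow> \<not> closed_geodesic_crosses L u \<gamma> v))"

definition local_coordinate ::
    "('a, 'b) dilation_surface_scheme \<Rightarrow> 'a \<Rightarrow> ('a \<Rightarrow> complex) \<Rightarrow> bool" where
  "local_coordinate X p \<psi> \<longleftrightarrow>
     (\<exists>(U, f) \<in> atlas X. p \<in> U \<and> (\<exists>a. dilation_germ (top_space X) p \<psi> a f))"

text \<open>Continuation of a germ of coordinate along a path in the regular part.\<close>

definition coordinate_continuation ::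
    "('a, 'b) dilation_surface_scheme \<Rightarrow> (real \<Rightarrow> 'a) \<Rightarrow> (real \<Rightarrow> 'a \<Rightarrow> complex) \<Rightarrow> bool" where
  "coordinate_continuation X \<gamma> \<psi> \<longleftrightarrow>
     (\<forall>t \<in> {0..1}. local_coordinate X (\<gamma> t) (\<psi> t)) \<and>
     (\<forall>t \<in> {0..1}. \<forall>\<^sub>F s in at t within {0..1}.
        \<forall>\<^sub>F p in nhdsin (top_space X) (\<gamma> s). \<psi> s p = \<psi> t p)"

text \<open>
  \<open>dilation_ratio X \<gamma> a\<close>: the holonomy of the loop \<open>\<gamma>\<close> has linear part \<open>a\<close>. With \<open>dev\<close> the developing
  map, the holonomy \<open>h\<close> satisfies \<open>dev (\<gamma> \<cdot> x) = h (dev x)\<close>, so continuing a coordinate along \<open>\<gamma>\<close>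
  turns \<open>\<psi> 0\<close> into \<open>h \<circ> \<psi> 0\<close>. For instance, on the quotient of the punctured plane by
  \<open>z \<mapsto> 2 z\<close>, the closed geodesic running from \<open>2\<close> to \<open>1\<close> has ratio \<open>1/2\<close>. Reversing a loop inverts
  its ratio, so the opposite convention replaces the set of directions below by its antipode.
\<close>

definition dilation_ratio ::
    "('a, 'b) dilation_surface_scheme \<Rightarrow> (real \<Rightarrow> 'a) \<Rightarrow> real \<Rightarrow> bool" where
  "dilation_ratio X \<gamma> a \<longleftrightarrow>
     (\<exists>\<psi>. coordinate_continuation X \<gamma> \<psi> \<and> dilation_germ (top_space X) (\<gamma> 0) (\<psi> 1) a (\<psi> 0))"

definition hyperbolic :: "('a, 'b) dilation_surface_scheme \<Rightarrow> (real \<Rightarrow> 'a) \<Rightarrow> bool" where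
  "hyperbolic X \<gamma> \<longleftrightarrow> (\<exists>a. dilation_ratio X \<gamma> a \<and> a \<noteq> 1)"

definition contracting :: "('a, 'b) dilation_surface_scheme \<Rightarrow> (real \<Rightarrow> 'a) \<Rightarrow> bool" where
  "contracting X \<gamma> \<longleftrightarrow> (\<exists>a. dilation_ratio X \<gamma> a \<and> a < 1)"

definition hyperbolic_directions :: "('a, 'b) dilation_surface_scheme \<Rightarrow> complex set" where
  "hyperbolic_directions X =
     {u. \<exists>\<gamma>. closed_geodesic X \<gamma> u \<and> hyperbolic X \<gamma> \<and> contracting X \<gamma>}"

end

theory Submission
  imports Defs
begin

text \<open>
  Fix a direction \<open>v\<close> transverse to \<open>L\<close>. Only boundedly many trajectories of direction \<open>v\<close> from \<open>L\<close>
  run into a singularity: such a trajectory ends along one of finitely many rays into a cone point,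
  and two of them ending along the same ray share their past, in which \<open>L\<close> is crossed at most \<open>k\<close>
  times. These singular trajectories persist when \<open>v\<close> varies, so near a direction where their
  number is maximal some point \<open>p\<close> of \<open>L\<close> has none at all.

  The rays from \<open>p\<close> in an open set of directions are then infinite in the developing plane.
  Otherwise take a first point \<open>z\<close> not reached by the developing map. The ray towards \<open>z\<close>
  accumulates at a regular point, and discs around points of this ray, of radius proportional to
  the distance from \<open>z\<close>, have images that overlap; flowing backwards from a common image point
  crosses \<open>L\<close> more than \<open>k\<close> times.

  Hence a whole sector is developed into \<open>X\<close>. Along its central ray the size of the charts in the
  plane grows without bound, by the same crossing argument, but at most linearly in the distance
  from \<open>p\<close>. So two points \<open>x\<close>, \<open>y\<close> of the sector, with \<open>y\<close> much further out, have the same image,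
  and the segment from \<open>y\<close> to \<open>x\<close> is a contracting closed geodesic of direction close to \<open>-v\<close>.
\<close>

section \<open>Developing maps\<close>

text \<open>A single good ray is not enough. The first unreached point \<open>z\<close> near a ray
  usually lies on a neighbouring ray, and that ray must not end at a singularity either; the final
  sector needs a whole interval of directions as well. For a fixed point of \<open>L\<close> nothing
  obvious keeps the singular directions from being dense. Counting singular rays over a segment of
  \<open>L\<close> and maximising the count is what produces an open set of directions for one
  point. The crossing argument has to survive rays that pass through the same points of
  \<open>X\<close> again. It therefore counts times, measured in a fixed chart at a common image
  point: \<open>k + 1\<close> preimages of that point in disjoint discs of the plane give
  \<open>k + 1\<close> backward rays, all of them pieces of one longest trajectory. If two of them
  met \<open>L\<close> after the same time, injectivity of the base disc would make the two
  preimages equal. Sizes are read off from the coefficient \<open>a\<close> in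
  \<open>f (E w) = a w + b\<close>: a chart disc of radius \<open>c\<close> has radius
  \<open>c / a\<close> in the plane.\<close>

definition dev_at :: "('a, 'b) dilation_surface_scheme \<Rightarrow> complex set \<Rightarrow> (complex \<Rightarrow> 'a) \<Rightarrow> complex \<Rightarrow>
    'a set \<Rightarrow> ('a \<Rightarrow> complex) \<Rightarrow> real \<Rightarrow> complex \<Rightarrow> bool" where
  "dev_at X S E z U f a b \<longleftrightarrow> (U, f) \<in> atlas X \<and> a > 0 \<and>
     (\<exists>d>0. \<forall>w \<in> S \<inter> ball z d. E w \<in> U \<and> f (E w) = of_real a * w + b)"

text \<open>The map goes from the plane to \<open>X\<close>, so it is a local inverse of the usual
  developing map. The set \<open>S\<close> need not be open: segments and rays occur as well as
  discs and sectors, and on a segment the map is constrained only along it.\<close>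

definition developing :: "('a, 'b) dilation_surface_scheme \<Rightarrow> complex set \<Rightarrow> (complex \<Rightarrow> 'a) \<Rightarrow> bool" where
  "developing X S E \<longleftrightarrow> (\<forall>z\<in>S. \<exists>U f a b. dev_at X S E z U f a b)"

section \<open>Charts and their affine transitions\<close>

locale dilation_surf =
  fixes X :: "'a dilation_surface"
  assumes closed: "closed_dilation_surface X"
begin

abbreviation "TX \<equiv> top_space X"

lemma Hausdorff: "Hausdorff_space TX"
  and compact: "compact_space TX"
  and finite_sings: "finite (sings X)"
  and sings_subset: "sings X \<subseteq> topspace TX"
  and atlas: "dilation_atlas X"
  and cone: "s \<in> sings X \<Longrightarrow> cone_singularity X s"
  using closed by (auto simp: closed_dilation_surface_def topological_surface_def)

lemma chart_open: "(U, f) \<in> atlas X \<Longrightarrow> openin TX U"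
  and chart_image_open: "(U, f) \<in> atlas X \<Longrightarrow> open (f ` U)"
  and chart_homeo: "(U, f) \<in> atlas X \<Longrightarrow>
    homeomorphic_map (subtopology TX U) (top_of_set (f ` U)) f"
  and chart_regular: "(U, f) \<in> atlas X \<Longrightarrow> U \<subseteq> regular_part X"
  and chart_transition: "(U, f) \<in> atlas X \<Longrightarrow> (V, g) \<in> atlas X \<Longrightarrow> p \<in> U \<inter> V \<Longrightarrow>
    \<exists>a. dilation_germ TX p f a g"
  using atlas unfolding dilation_atlas_def by blast+

lemma chart_exists: "p \<in> regular_part X \<Longrightarrow> \<exists>U f. (U, f) \<in> atlas X \<and> p \<in> U"
  using atlas unfolding dilation_atlas_def by blast

lemma chart_subset: "(U, f) \<in> atlas X \<Longrightarrow> U \<subseteq> topspace TX"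
  using chart_open openin_subset by blast

lemma chart_inj: "(U, f) \<in> atlas X \<Longrightarrow> inj_on f U"
  using chart_homeo[of U f] chart_subset[of U f]
  by (auto simp: homeomorphic_map_def inj_on_def)

lemma chart_preimage:
  assumes "(U, f) \<in> atlas X" "open G"
  shows "openin TX {x \<in> U. f x \<in> G}"
proof -
  have "continuous_map (subtopology TX U) (top_of_set (f ` U)) f"
    using chart_homeo[OF assms(1)] homeomorphic_imp_continuous_map by blast
  then have "continuous_map (subtopology TX U) euclidean f"
    using continuous_map_in_subtopology by blast
  then have "openin (subtopology TX U) {x \<in> topspace (subtopology TX U). f x \<in> G}"
    using assms(2) openin_continuous_map_preimage by (metis open_openin)
  then show ?thesis
    using chart_open[OF assms(1)] chart_subset[OF assms(1)]
    by (simp add: openin_open_subtopology Int_absorb1)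
qed

lemma chart_image:
  assumes "(U, f) \<in> atlas X" "openin TX W"
  shows "open (f ` (U \<inter> W))"
proof -
  have "openin (subtopology TX U) (U \<inter> W)"
    using assms(2) openin_subtopology by (metis inf_commute)
  then have "openin (top_of_set (f ` U)) (f ` (U \<inter> W))"
    using homeomorphic_imp_open_map[OF chart_homeo[OF assms(1)]] by (simp add: open_map_def)
  then show ?thesis
    using chart_image_open[OF assms(1)] openin_open_trans by blast
qed

lemma chart_change:
  assumes "(U, f) \<in> atlas X" "(V, g) \<in> atlas X" "p \<in> U" "p \<in> V"
  obtains a b W where "a > 0" "openin TX W" "p \<in> W" "W \<subseteq> U" "W \<subseteq> V"
    "\<And>x. x \<in> W \<Longrightarrow> f x = of_real a * g x + b"
proof -
  obtain a b where a: "a > 0" and ev: "\<forall>\<^sub>F q in nhdsin TX p. f q = of_real a * g q + b"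
    using chart_transition[OF assms(1,2), of p] assms(3,4) unfolding dilation_germ_def by auto
  have "p \<in> topspace TX" using chart_subset[OF assms(1)] assms(3) by auto
  with ev obtain W where "openin TX W" "p \<in> W" "\<forall>x\<in>W. f x = of_real a * g x + b"
    by (auto simp: eventually_nhdsin)
  then show ?thesis
    using that[of a "W \<inter> U \<inter> V" b] a chart_open[OF assms(1)] chart_open[OF assms(2)] assms(3,4)
    by auto
qed

section \<open>Locality, continuity and uniqueness of developing maps\<close>

lemma dev_at_mono: "dev_at X S E z U f a b \<Longrightarrow> S' \<subseteq> S \<Longrightarrow> dev_at X S' E z U f a b"
  unfolding dev_at_def by (meson IntD1 IntD2 IntI subsetD)

lemma developing_mono: "developing X S E \<Longrightarrow> S' \<subseteq> S \<Longrightarrow> developing X S' E"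
  unfolding developing_def using dev_at_mono by (meson subsetD)

lemma dev_at_value:
  "dev_at X S E z U f a b \<Longrightarrow> z \<in> S \<Longrightarrow> E z \<in> U \<and> f (E z) = of_real a * z + b"
  unfolding dev_at_def by force

lemma dev_at_cong:
  assumes "dev_at X S E z U f a b" "r > 0" "\<And>w. w \<in> S' \<inter> ball z r \<Longrightarrow> w \<in> S \<and> E' w = E w"
  shows "dev_at X S' E' z U f a b"
proof -
  obtain d where "d > 0" and d: "\<forall>w \<in> S \<inter> ball z d. E w \<in> U \<and> f (E w) = of_real a * w + b"
    and rest: "(U, f) \<in> atlas X" "a > 0"
    using assms(1) unfolding dev_at_def by auto
  have "\<forall>w \<in> S' \<inter> ball z (min d r). E' w \<in> U \<and> f (E' w) = of_real a * w + b"
    using d assms(3) by auto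
  then show ?thesis
    unfolding dev_at_def using rest \<open>d > 0\<close> assms(2)
    by (intro conjI exI[of _ "min d r"]) auto
qed

text \<open>The gluing principle: a map pieced together from developing maps is developing as soon
  as near each point it coincides with one of the pieces.\<close>

lemma developing_local:
  assumes "\<And>z. z \<in> S \<Longrightarrow> \<exists>r S' E'. r > 0 \<and> developing X S' E' \<and> z \<in> S' \<and>
      (\<forall>w \<in> S \<inter> ball z r. w \<in> S' \<and> E w = E' w)"
  shows "developing X S E"
  unfolding developing_def
proof
  fix z assume "z \<in> S"
  then obtain r S' E' where *: "r > 0" "developing X S' E'" "z \<in> S'"
      "\<forall>w \<in> S \<inter> ball z r. w \<in> S' \<and> E w = E' w"
    using assms by blast
  then obtain U f a b where "dev_at X S' E' z U f a b"
    unfolding developing_def by blast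
  then show "\<exists>U f a b. dev_at X S E z U f a b"
    using dev_at_cong[of S' E' z U f a b r S E] * by blast
qed

lemma developing_regular: "developing X S E \<Longrightarrow> z \<in> S \<Longrightarrow> E z \<in> regular_part X"
  unfolding developing_def using dev_at_value chart_regular
  by (metis dev_at_def subsetD)

lemma regular_topspace: "p \<in> regular_part X \<Longrightarrow> p \<in> topspace TX"
  by (simp add: regular_part_def)

text \<open>No continuity is built into \<open>dev_at\<close>. It comes from the chart being a
  homeomorphism: the image of \<open>U \<inter> W\<close> under \<open>f\<close> is open, and
  \<open>f\<close> is injective on \<open>U\<close>.\<close>

lemma dev_at_continuous:
  assumes "dev_at X S E z U f a b" "z \<in> S" "openin TX W" "E z \<in> W"
  shows "\<exists>d>0. \<forall>w \<in> S \<inter> ball z d. E w \<in> W"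
proof -
  obtain d where "d > 0" and d: "\<And>w. w \<in> S \<inter> ball z d \<Longrightarrow> E w \<in> U \<and> f (E w) = of_real a * w + b"
    and at: "(U, f) \<in> atlas X" "a > 0"
    using assms(1) unfolding dev_at_def by auto
  have Ez: "E z \<in> U" "f (E z) = of_real a * z + b" using dev_at_value[OF assms(1,2)] by auto
  have op: "open (f ` (U \<inter> W))" by (rule chart_image[OF at(1) assms(3)])
  have "of_real a * z + b \<in> f ` (U \<inter> W)" using Ez assms(4) by (metis IntI imageI)
  with op obtain e where "e > 0" and e: "ball (of_real a * z + b) e \<subseteq> f ` (U \<inter> W)"
    using open_contains_ball by blast
  have "E w \<in> W" if w: "w \<in> S \<inter> ball z (min d (e / a))" for w
  proof -
    have "dist (of_real a * z + b) (of_real a * w + b) = a * dist z w"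
      using at(2) by (simp add: dist_norm flip: right_diff_distrib) (simp add: norm_mult)
    also have "\<dots> < e" using w at(2) by (auto simp: field_simps)
    finally have "f (E w) \<in> f ` (U \<inter> W)" using e d w by auto
    moreover have "E w \<in> U" using d w by auto
    ultimately show ?thesis using chart_inj[OF at(1)] by (auto simp: inj_on_def)
  qed
  then show ?thesis using \<open>d > 0\<close> \<open>e > 0\<close> at(2)
    by (intro exI[of _ "min d (e / a)"]) auto
qed

lemma developing_continuous:
  assumes "developing X S E" "z \<in> S" "openin TX W" "E z \<in> W"
  shows "\<exists>d>0. \<forall>w \<in> S \<inter> ball z d. E w \<in> W"
  using assms dev_at_continuous unfolding developing_def by blast

text \<open>Transitions are affine with positive ratio near each point, so the chart in
  \<open>dev_at\<close> may be prescribed. This is what makes scales at different points of the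
  plane comparable: points with nearby images are all measured in one chart.\<close>

lemma developing_chart:
  assumes dev: "developing X S E" and z: "z \<in> S" and at: "(V, g) \<in> atlas X" and Ez: "E z \<in> V"
  obtains a b where "dev_at X S E z V g a b"
proof -
  obtain U f a b where D: "dev_at X S E z U f a b" using dev z unfolding developing_def by blast
  then have U: "(U, f) \<in> atlas X" "a > 0" by (auto simp: dev_at_def)
  obtain d where "d > 0" and d: "\<And>w. w \<in> S \<inter> ball z d \<Longrightarrow> E w \<in> U \<and> f (E w) = of_real a * w + b"
    using D unfolding dev_at_def by auto
  obtain a' b' W where W: "a' > 0" "openin TX W" "E z \<in> W" "W \<subseteq> V" "W \<subseteq> U"
    "\<And>x. x \<in> W \<Longrightarrow> g x = of_real a' * f x + b'"
    using chart_change[OF at U(1) Ez conjunct1[OF dev_at_value[OF D z]]] by metis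
  obtain d' where "d' > 0" and d': "\<And>w. w \<in> S \<inter> ball z d' \<Longrightarrow> E w \<in> W"
    using developing_continuous[OF dev z W(2,3)] by auto
  have "\<forall>w \<in> S \<inter> ball z (min d d'). E w \<in> V \<and> g (E w) = of_real (a' * a) * w + (of_real a' * b + b')"
  proof
    fix w assume "w \<in> S \<inter> ball z (min d d')"
    then have "E w \<in> W" "f (E w) = of_real a * w + b" using d d' by auto
    then show "E w \<in> V \<and> g (E w) = of_real (a' * a) * w + (of_real a' * b + b')"
      using W by (auto simp: algebra_simps)
  qed
  then have "dev_at X S E z V g (a' * a) (of_real a' * b + b')"
    unfolding dev_at_def using at \<open>d > 0\<close> \<open>d' > 0\<close> W(1) U(2)
    by (intro conjI exI[of _ "min d d'"]) auto
  then show ?thesis using that by blast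
qed

text \<open>The analogue of the identity theorem for analytic continuation. The set of agreement is
  open and closed in \<open>S\<close>, because two affine maps that agree at a point either coincide
  or differ at every other point.\<close>

lemma developing_unique:
  assumes conn: "connected S" and E: "developing X S E" and E': "developing X S E'"
    and z0: "z0 \<in> S" and r: "r > 0" and eq: "\<And>w. w \<in> S \<inter> ball z0 r \<Longrightarrow> E w = E' w"
    and z: "z \<in> S"
  shows "E z = E' z"
proof -
  \<comment> \<open>Agreement on a neighbourhood, not at a point: maps of different scale may still
    agree at an isolated point.\<close>
  define A where "A = {z \<in> S. \<exists>d>0. \<forall>w \<in> S \<inter> ball z d. E w = E' w}"
  have "openin (top_of_set S) A"
    unfolding openin_euclidean_subtopology_iff
  proof (intro conjI ballI)
    show "A \<subseteq> S" by (auto simp: A_def)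
    fix x assume "x \<in> A"
    then obtain d where d: "d > 0" "\<And>w. w \<in> S \<inter> ball x d \<Longrightarrow> E w = E' w" by (auto simp: A_def)
    have "y \<in> A" if "y \<in> S" "dist y x < d / 2" for y
      unfolding A_def
    proof (intro CollectI conjI exI[of _ "d / 2"] ballI)
      fix w assume "w \<in> S \<inter> ball y (d / 2)"
      then have "w \<in> S \<inter> ball x d" using that dist_triangle[of x w y] by (auto simp: dist_commute)
      then show "E w = E' w" by (rule d(2))
    qed (use that d in auto)
    then show "\<exists>e>0. \<forall>x'\<in>S. dist x' x < e \<longrightarrow> x' \<in> A" using d by (intro exI[of _ "d / 2"]) auto
  qed
  moreover have "openin (top_of_set S) (S - A)"
    unfolding openin_euclidean_subtopology_iff
  proof (intro conjI ballI)
    fix x assume x: "x \<in> S - A"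
    show "\<exists>e>0. \<forall>x'\<in>S. dist x' x < e \<longrightarrow> x' \<in> S - A"
    proof (cases "E x = E' x")
      case False
      have "E x \<in> topspace TX" "E' x \<in> topspace TX"
        using x E E' developing_regular regular_topspace by blast+
      then obtain W W' where W: "openin TX W" "openin TX W'" "E x \<in> W" "E' x \<in> W'" "disjnt W W'"
        using Hausdorff False unfolding Hausdorff_space_def by blast
      obtain d where d: "d > 0" "\<And>w. w \<in> S \<inter> ball x d \<Longrightarrow> E w \<in> W"
        using developing_continuous[OF E _ W(1,3)] x by blast
      obtain d' where d': "d' > 0" "\<And>w. w \<in> S \<inter> ball x d' \<Longrightarrow> E' w \<in> W'"
        using developing_continuous[OF E' _ W(2,4)] x by blast
      have "y \<in> S - A" if "y \<in> S" "dist y x < min d d'" for y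
      proof -
        have "E y \<in> W" "E' y \<in> W'" using that d d' by (auto simp: dist_commute)
        then have "E y \<noteq> E' y" using W(5) by (auto simp: disjnt_iff)
        then show ?thesis using that by (auto simp: A_def)
      qed
      then show ?thesis using d(1) d'(1) by (intro exI[of _ "min d d'"]) auto
    next
      case True
      obtain U f a b where D: "dev_at X S E x U f a b" using E x unfolding developing_def by blast
      then have at: "(U, f) \<in> atlas X" by (auto simp: dev_at_def)
      have Ex: "E x \<in> U" "f (E x) = of_real a * x + b" using dev_at_value[OF D] x by auto
      obtain a' b' where D': "dev_at X S E' x U f a' b'"
        using developing_chart[OF E' _ at] x Ex True by (metis DiffD1)
      obtain d where d: "d > 0" "\<And>w. w \<in> S \<inter> ball x d \<Longrightarrow> E w \<in> U \<and> f (E w) = of_real a * w + b"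
        using D unfolding dev_at_def by auto
      obtain d' where d': "d' > 0" "\<And>w. w \<in> S \<inter> ball x d' \<Longrightarrow> E' w \<in> U \<and> f (E' w) = of_real a' * w + b'"
        using D' unfolding dev_at_def by auto
      have val: "of_real a * x + b = of_real a' * x + b'"
        using dev_at_value[OF D'] Ex True x by auto
      \<comment> \<open>Equal slopes and a common value at \<open>x\<close> would give equal
        \<open>b\<close>, hence agreement near \<open>x\<close>, and \<open>x\<close> would lie in
        \<open>A\<close>. With different slopes the maps differ at all nearby points other than
        \<open>x\<close>.\<close>
      have "a \<noteq> a'"
      proof
        assume aa: "a = a'"
        then have bb: "b = b'" using val by simp
        have "E w = E' w" if "w \<in> S \<inter> ball x (min d d')" for w
        proof -
          have "E w \<in> U" "E' w \<in> U" "f (E w) = f (E' w)" using that d d' aa bb by auto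
          then show ?thesis using chart_inj[OF at] by (auto simp: inj_on_def)
        qed
        then have "x \<in> A" unfolding A_def using x d(1) d'(1)
          by (intro CollectI conjI exI[of _ "min d d'"]) auto
        then show False using x by auto
      qed
      have "y \<in> S - A" if "y \<in> S" "dist y x < min d d'" for y
      proof (cases "y = x")
        case False
        have "f (E y) = of_real a * y + b" "f (E' y) = of_real a' * y + b'"
          using that d d' by (auto simp: dist_commute)
        moreover have "of_real a * y + b \<noteq> of_real a' * y + b'"
        proof
          assume eq: "of_real a * y + b = of_real a' * y + b'"
          have "(of_real a - of_real a') * (y - x) =
              (of_real a * y + b - (of_real a' * y + b')) - (of_real a * x + b - (of_real a' * x + b'))"
            by (simp add: algebra_simps)
          then have "(of_real a - of_real a') * (y - x) = 0" using val eq by simp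
          then show False using \<open>a \<noteq> a'\<close> False by simp
        qed
        ultimately have "E y \<noteq> E' y" by auto
        then show ?thesis using that by (auto simp: A_def)
      qed (use x in auto)
      then show ?thesis using d(1) d'(1) by (intro exI[of _ "min d d'"]) auto
    qed
  qed auto
  then have "closedin (top_of_set S) A"
    by (metis (no_types, lifting) A_def closedin_def mem_Collect_eq subsetI topspace_euclidean_subtopology)
  ultimately have "A = {} \<or> A = S" using conn unfolding connected_clopen by blast
  moreover have "z0 \<in> A" unfolding A_def using z0 r eq by auto
  ultimately have "z \<in> A" using z by auto
  then show ?thesis unfolding A_def by force
qed

lemma dev_at_affine:
  assumes "dev_at X S E (of_real c * z + d) U f a b" "c > 0"
  shows "dev_at X {w. of_real c * w + d \<in> S} (\<lambda>w. E (of_real c * w + d)) z U f (a * c) (of_real a * d + b)"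
proof -
  obtain e where "e > 0" and e: "\<And>w. w \<in> S \<inter> ball (of_real c * z + d) e \<Longrightarrow> E w \<in> U \<and> f (E w) = of_real a * w + b"
    and at: "(U, f) \<in> atlas X" "a > 0"
    using assms(1) unfolding dev_at_def by auto
  have "\<forall>w\<in>{w. of_real c * w + d \<in> S} \<inter> ball z (e / c). E (of_real c * w + d) \<in> U \<and>
     f (E (of_real c * w + d)) = of_real (a * c) * w + (of_real a * d + b)"
  proof
    fix w assume w: "w \<in> {w. of_real c * w + d \<in> S} \<inter> ball z (e / c)"
    have "dist (of_real c * z + d) (of_real c * w + d) = c * dist z w"
      using assms(2) by (simp add: dist_norm flip: right_diff_distrib) (simp add: norm_mult)
    also have "\<dots> < e" using w assms(2) by (auto simp: field_simps)
    finally have "of_real c * w + d \<in> S \<inter> ball (of_real c * z + d) e" using w by auto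
    then show "E (of_real c * w + d) \<in> U \<and>
     f (E (of_real c * w + d)) = of_real (a * c) * w + (of_real a * d + b)"
      using e by (auto simp: algebra_simps)
  qed
  then show ?thesis unfolding dev_at_def using at assms(2) \<open>e > 0\<close>
    by (intro conjI exI[of _ "e / c"]) auto
qed

text \<open>The substitutions \<open>c w + d\<close> with \<open>c > 0\<close> preserve directions.
  They serve to move the origin along a ray and to match the scales of two maps.\<close>

lemma developing_affine:
  assumes "developing X S E" "c > 0"
  shows "developing X {w. of_real c * w + d \<in> S} (\<lambda>w. E (of_real c * w + d))"
  unfolding developing_def
proof
  fix z assume "z \<in> {w. of_real c * w + d \<in> S}"
  then obtain U f a b where "dev_at X S E (of_real c * z + d) U f a b"
    using assms(1) unfolding developing_def by blast
  from dev_at_affine[OF this assms(2)]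
  show "\<exists>U f a b. dev_at X {w. of_real c * w + d \<in> S} (\<lambda>w. E (of_real c * w + d)) z U f a b"
    by blast
qed

lemma chart_inverse:
  assumes "(U, f) \<in> atlas X" "a > 0" "(\<lambda>w. of_real a * w + b) ` S \<subseteq> f ` U"
  shows "developing X S (\<lambda>w. inv_into U f (of_real a * w + b))"
    and "z \<in> S \<Longrightarrow> dev_at X S (\<lambda>w. inv_into U f (of_real a * w + b)) z U f a b"
proof -
  have *: "dev_at X S (\<lambda>w. inv_into U f (of_real a * w + b)) z U f a b" if "z \<in> S" for z
    unfolding dev_at_def using assms
    by (intro conjI exI[of _ 1]) (auto simp: image_subset_iff inv_into_into f_inv_into_f)
  show "z \<in> S \<Longrightarrow> dev_at X S (\<lambda>w. inv_into U f (of_real a * w + b)) z U f a b" by (rule *)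
  show "developing X S (\<lambda>w. inv_into U f (of_real a * w + b))"
    unfolding developing_def using * by blast
qed

text \<open>The bridge from the plane to the bound on crossings. The speed \<open>c\<close> is free
  so that a segment can be run through in unit time, as a closed geodesic requires.\<close>

lemma developing_trajectory:
  assumes dev: "developing X S E" and I: "is_interval I" and v: "norm v = 1"
    and c: "c > 0" and S: "\<And>t. t \<in> I \<Longrightarrow> y + of_real (c * t) * v \<in> S"
  shows "trajectory X I (\<lambda>t. E (y + of_real (c * t) * v)) v"
  unfolding trajectory_def
proof (intro conjI ballI)
  let ?p = "\<lambda>t. y + of_real (c * t) * v"
  have dist_p: "dist (?p t) (?p t') = c * dist t t'" for t t'
  proof -
    have "?p t - ?p t' = of_real (c * (t - t')) * v" by (simp add: algebra_simps)
    then show ?thesis using v c by (simp only: dist_norm norm_mult norm_of_real abs_mult) simp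
  qed
  have near: "?p t' \<in> S \<inter> ball (?p t) d" if "t' \<in> I" "dist t' t < d / c" for t t' d
  proof -
    have "dist (?p t) (?p t') < d"
      unfolding dist_p using that(2) c by (simp add: field_simps dist_commute)
    then show ?thesis using S[OF that(1)] by simp
  qed
  show "v \<in> sphere 0 1" using v by simp
  show "is_interval I" by fact
  show "continuous_map (top_of_set I) (subtopology TX (regular_part X)) (\<lambda>t. E (?p t))"
  proof -
    have "continuous_map (top_of_set I) TX (\<lambda>t. E (?p t))"
      unfolding continuous_map_def
    proof (intro conjI allI impI)
      show "(\<lambda>t. E (?p t)) \<in> topspace (top_of_set I) \<rightarrow> topspace TX"
        using S dev developing_regular regular_topspace by fastforce
      fix W assume W: "openin TX W"
      show "openin (top_of_set I) {x \<in> topspace (top_of_set I). E (?p x) \<in> W}"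
        unfolding openin_euclidean_subtopology_iff
      proof (intro conjI ballI)
        fix t assume t: "t \<in> {x \<in> topspace (top_of_set I). E (?p x) \<in> W}"
        then obtain d where d: "d > 0" "\<And>w. w \<in> S \<inter> ball (?p t) d \<Longrightarrow> E w \<in> W"
          using developing_continuous[OF dev _ W, of "?p t"] S by auto
        show "\<exists>e>0. \<forall>x'\<in>I. dist x' t < e \<longrightarrow> x' \<in> {x \<in> topspace (top_of_set I). E (?p x) \<in> W}"
          using d c near by (intro exI[of _ "d / c"]) auto
      qed auto
    qed
    moreover have "(\<lambda>t. E (?p t)) ` topspace (top_of_set I) \<subseteq> regular_part X"
      using S dev developing_regular by auto
    ultimately show ?thesis by (auto simp: continuous_map_in_subtopology)
  qed
  fix t Uf assume t: "t \<in> I" and Uf: "Uf \<in> atlas X"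
  obtain U f where [simp]: "Uf = (U, f)" by (cases Uf)
  show "case Uf of (U, f) \<Rightarrow> E (?p t) \<in> U \<longrightarrow> (\<exists>\<epsilon>>0. \<forall>s\<in>I \<inter> ball t \<epsilon>. \<forall>s'\<in>I \<inter> ball t \<epsilon>.
      s < s' \<longrightarrow> (\<exists>c>0. f (E (?p s')) - f (E (?p s)) = complex_of_real c * v))"
  proof (simp only: \<open>Uf = (U, f)\<close> prod.case, intro impI)
    assume "E (?p t) \<in> U"
    then obtain a b where "dev_at X S E (?p t) U f a b"
      using developing_chart[OF dev S[OF t], of U f] Uf by auto
    then obtain d where d: "d > 0" "a > 0" "\<And>w. w \<in> S \<inter> ball (?p t) d \<Longrightarrow> f (E w) = of_real a * w + b"
      unfolding dev_at_def by auto
    have *: "f (E (?p s)) = of_real a * ?p s + b" if "s \<in> I \<inter> ball t (d / c)" for s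
      using that by (intro d(3) near) (auto simp: dist_commute)
    have "\<exists>k>0. f (E (?p s')) - f (E (?p s)) = complex_of_real k * v"
      if "s \<in> I \<inter> ball t (d / c)" "s' \<in> I \<inter> ball t (d / c)" "s < s'" for s s'
    proof (intro exI[of _ "a * c * (s' - s)"] conjI)
      show "f (E (?p s')) - f (E (?p s)) = complex_of_real (a * c * (s' - s)) * v"
        unfolding *[OF that(1)] *[OF that(2)] by (simp add: algebra_simps)
    qed (use that c d(2) in auto)
    then show "\<exists>\<epsilon>>0. \<forall>s\<in>I \<inter> ball t \<epsilon>. \<forall>s'\<in>I \<inter> ball t \<epsilon>.
      s < s' \<longrightarrow> (\<exists>c>0. f (E (?p s')) - f (E (?p s)) = complex_of_real c * v)"
      using d(1) c by (intro exI[of _ "d / c"]) auto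
  qed
qed

end

text \<open>A metric neighbourhood of constant width is the Minkowski sum of \<open>K\<close> with a
  ball, hence convex when \<open>K\<close> is.\<close>

lemma convex_neighbourhood:
  fixes K :: "'a::euclidean_space set"
  assumes "compact K" "convex K" "open G" "K \<subseteq> G"
  obtains S where "open S" "convex S" "K \<subseteq> S" "S \<subseteq> G"
proof -
  obtain e where e: "e > 0" "(\<Union>x\<in>K. ball x e) \<subseteq> G"
    using compact_subset_open_imp_ball_epsilon_subset[OF assms(1,3,4)] by auto
  have "(\<Union>x\<in>K. ball x e) = (\<Union>x\<in>K. \<Union>y\<in>ball 0 e. {x + y})"
  proof (intro equalityI subsetI)
    fix w assume "w \<in> (\<Union>x\<in>K. ball x e)"
    then obtain x where "x \<in> K" "dist x w < e" by auto
    then show "w \<in> (\<Union>x\<in>K. \<Union>y\<in>ball 0 e. {x + y})"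
      by (intro UN_I[of x] UN_I[of "w - x"]) (auto simp: dist_norm norm_minus_commute)
  next
    fix w assume "w \<in> (\<Union>x\<in>K. \<Union>y\<in>ball 0 e. {x + y})"
    then obtain x y where "x \<in> K" "y \<in> ball 0 e" "w = x + y" by auto
    then show "w \<in> (\<Union>x\<in>K. ball x e)"
      by (intro UN_I[of x]) (auto simp: dist_norm)
  qed
  then have "convex (\<Union>x\<in>K. ball x e)"
    using convex_sums[OF assms(2) convex_ball[of 0 e]] by simp
  then show ?thesis using that[of "\<Union>x\<in>K. ball x e"] e by force
qed

context dilation_surf
begin

text \<open>\<open>dev_at\<close> speaks only of some small disc about \<open>z\<close>. By
  uniqueness \<open>E\<close> equals the inverse chart on every disc in \<open>S\<close> whose
  affine image stays inside the image of the chart.\<close>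

lemma chart_ball:
  assumes dev: "developing X S E" and at: "dev_at X S E z U f a b"
    and S: "ball z \<rho> \<subseteq> S" and U: "ball (of_real a * z + b) (a * \<rho>) \<subseteq> f ` U" and y: "y \<in> ball z \<rho>"
  shows "E y = inv_into U f (of_real a * y + b)" and "E y \<in> U" and "f (E y) = of_real a * y + b"
    and "dev_at X S E y U f a b"
proof -
  have a: "(U, f) \<in> atlas X" "a > 0" using at by (auto simp: dev_at_def)
  have sub: "(\<lambda>w. of_real a * w + b) ` ball z \<rho> \<subseteq> f ` U"
  proof (intro subset_trans[OF _ U] image_subsetI)
    fix w assume "w \<in> ball z \<rho>"
    have "dist (of_real a * z + b) (of_real a * w + b) = norm (of_real a * (z - w))"
      by (simp add: dist_norm algebra_simps)
    also have "\<dots> = a * dist z w" using a by (simp add: dist_norm norm_mult)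
    finally show "of_real a * w + b \<in> ball (of_real a * z + b) (a * \<rho>)"
      using \<open>w \<in> ball z \<rho>\<close> a by simp
  qed
  note inv = chart_inverse[OF a sub]
  have z: "z \<in> ball z \<rho>" using y by (metis centre_in_ball dist_not_less_zero mem_ball order_le_less_trans zero_le_dist)
  obtain d where d: "d > 0" "\<And>w. w \<in> S \<inter> ball z d \<Longrightarrow> E w \<in> U \<and> f (E w) = of_real a * w + b"
    using at unfolding dev_at_def by auto
  have eq: "E w = inv_into U f (of_real a * w + b)" if "w \<in> ball z \<rho>" for w
  proof (rule developing_unique[OF connected_ball developing_mono[OF dev S] inv(1) z d(1) _ that])
    fix w assume "w \<in> ball z \<rho> \<inter> ball z d"
    then have "E w \<in> U" "f (E w) = of_real a * w + b" using d S by auto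
    then show "E w = inv_into U f (of_real a * w + b)"
      using chart_inj[OF a(1)] by (metis inv_into_f_f)
  qed
  have val: "E w \<in> U \<and> f (E w) = of_real a * w + b" if "w \<in> ball z \<rho>" for w
  proof -
    have "of_real a * w + b \<in> f ` U" using sub that by blast
    then show ?thesis using eq[OF that] by (metis inv_into_into f_inv_into_f)
  qed
  show "E y = inv_into U f (of_real a * y + b)" "E y \<in> U" "f (E y) = of_real a * y + b"
    using eq val y by blast+
  have "\<exists>d>0. ball y d \<subseteq> ball z \<rho>" using y openE[OF open_ball y] by metis
  then show "dev_at X S E y U f a b"
    unfolding dev_at_def using a val by blast
qed

lemma dev_at_coefficients:
  assumes "of_real a * z + b = of_real a' * z + b'" "of_real a * w + b = of_real a' * w + (b'::complex)" "z \<noteq> w"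
  shows "a = a'" "b = b'"
proof -
  have "(of_real a - of_real a') * (w - z) =
      (of_real a * w + b - (of_real a' * w + b')) - (of_real a * z + b - (of_real a' * z + b'))"
    by (simp add: algebra_simps)
  then have "of_real a - (of_real a' :: complex) = 0" using assms by simp
  then show "a = a'" by simp
  with assms(1) show "b = b'" by simp
qed

end

section \<open>Maximal star-shaped domains\<close>

text \<open>The pieces absorbed by \<open>max_D\<close> are convex sets containing 0: two of them
  meet in a convex, hence connected set, so their maps agree there and no monodromy can arise. Their
  union \<open>D\<close> is star-shaped, but in general not convex.\<close>

locale star_domain = dilation_surf X for X :: "'a dilation_surface" +
  fixes \<delta> :: real and E0 :: "complex \<Rightarrow> 'a" and D :: "complex set" and E :: "complex \<Rightarrow> 'a"
  assumes \<delta>: "\<delta> > 0" and open_D: "open D" and ball_D: "ball 0 \<delta> \<subseteq> D"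
    and star_D: "z \<in> D \<Longrightarrow> closed_segment 0 z \<subseteq> D"
    and dev_D: "developing X D E" and E_eq: "w \<in> ball 0 \<delta> \<Longrightarrow> E w = E0 w"
    and max_D: "open S \<Longrightarrow> convex S \<Longrightarrow> 0 \<in> S \<Longrightarrow> developing X S E' \<Longrightarrow>
      d > 0 \<Longrightarrow> (\<And>w. w \<in> S \<inter> ball 0 d \<Longrightarrow> E' w = E0 w) \<Longrightarrow> S \<subseteq> D"

context dilation_surf
begin

lemma maximal_domain:
  assumes "\<delta> > 0" "developing X (ball 0 \<delta>) E0"
  obtains D E where "star_domain X \<delta> E0 D E"
proof -
  define P where "P S E' \<longleftrightarrow> open S \<and> convex S \<and> 0 \<in> S \<and> developing X S E' \<and>
    (\<exists>d>0. \<forall>w\<in>S \<inter> ball 0 d. E' w = E0 w)" for S E'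
  have P_unique: "E1 z = E2 z" if P: "P S1 E1" "P S2 E2" "z \<in> S1" "z \<in> S2" for S1 E1 S2 E2 z
  proof -
    obtain d1 d2 where d: "d1 > 0" "d2 > 0" "\<forall>w\<in>S1 \<inter> ball 0 d1. E1 w = E0 w" "\<forall>w\<in>S2 \<inter> ball 0 d2. E2 w = E0 w"
      using P unfolding P_def by blast
    show ?thesis
    proof (rule developing_unique[of "S1 \<inter> S2" _ _ 0 "min d1 d2"])
      show "connected (S1 \<inter> S2)" using P by (auto simp: P_def intro!: convex_connected convex_Int)
      show "developing X (S1 \<inter> S2) E1" "developing X (S1 \<inter> S2) E2"
        using P by (auto simp: P_def intro: developing_mono)
    qed (use P d in \<open>auto simp: P_def\<close>)
  qed
  define D where "D = \<Union>{S. \<exists>E'. P S E'}"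
  \<comment> \<open>By \<open>P_unique\<close> the chosen value does not depend on the piece
    \<open>S\<close>.\<close>
  define E where "E z = (SOME y. \<exists>S E'. P S E' \<and> z \<in> S \<and> y = E' z)" for z
  have E: "E z = E' z" if "P S E'" "z \<in> S" for S E' z
  proof -
    have "\<exists>y S E'. P S E' \<and> z \<in> S \<and> y = E' z" using that by blast
    then have "\<exists>S E'. P S E' \<and> z \<in> S \<and> E z = E' z" unfolding E_def by (rule someI_ex)
    then show ?thesis using P_unique that by metis
  qed
  have P0: "P (ball 0 \<delta>) E0" unfolding P_def using assms by (auto intro!: exI[of _ 1])
  have "star_domain X \<delta> E0 D E"
  proof (unfold_locales)
    show "\<delta> > 0" by fact
    show "open D" unfolding D_def by (auto simp: P_def)
    show "ball 0 \<delta> \<subseteq> D" using P0 unfolding D_def by blast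
    show "closed_segment 0 z \<subseteq> D" if zD: "z \<in> D" for z
    proof -
      obtain S E' where "P S E'" "z \<in> S" using zD unfolding D_def by blast
      then have "closed_segment 0 z \<subseteq> S" unfolding P_def by (intro closed_segment_subset) blast+
      then show ?thesis using \<open>P S E'\<close> unfolding D_def by blast
    qed
    show "developing X D E"
    proof (rule developing_local)
      fix z assume "z \<in> D"
      then obtain S E' where S: "P S E'" "z \<in> S" unfolding D_def by blast
      then obtain r where "r > 0" "ball z r \<subseteq> S" using openE unfolding P_def by metis
      then show "\<exists>r S' E'. 0 < r \<and> developing X S' E' \<and> z \<in> S' \<and> (\<forall>w\<in>D \<inter> ball z r. w \<in> S' \<and> E w = E' w)"
      proof (intro exI[of _ r] exI[of _ S] exI[of _ E'] conjI ballI)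
        show "developing X S E'" using S by (simp add: P_def)
        fix w assume "w \<in> D \<inter> ball z r"
        then show "w \<in> S" using \<open>ball z r \<subseteq> S\<close> by blast
        then show "E w = E' w" using E S by blast
      qed (use S \<open>r > 0\<close> in auto)
    qed
    show "E w = E0 w" if "w \<in> ball 0 \<delta>" for w using E P0 that by blast
    show "S \<subseteq> D" if "open S" "convex S" "0 \<in> S" "developing X S E'" "d > 0"
      "\<And>w. w \<in> S \<inter> ball 0 d \<Longrightarrow> E' w = E0 w" for S E' d
    proof -
      have "P S E'" unfolding P_def using that by blast
      then show ?thesis unfolding D_def by blast
    qed
  qed
  then show ?thesis using that by blast
qed

end

context star_domain
begin

text \<open>Glue \<open>E\<close> on a convex neighbourhood \<open>N\<close> of the segment from 0
  to \<open>z\<close> with the inverse chart on a disc \<open>B\<close> about \<open>z\<close>; they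
  agree on the convex set \<open>N \<inter> B\<close>. Because \<open>z\<close> lies between 0 and
  \<open>y\<close>, the union contains the segment from 0 to \<open>y\<close>, and a convex
  neighbourhood of that segment is absorbed by \<open>max_D\<close>.\<close>

lemma extend:
  assumes z: "z \<in> D" and at: "dev_at X D E z U f a b"
    and U: "ball (of_real a * z + b) r \<subseteq> f ` U" and y: "dist y z < r / a" and zy: "z \<in> closed_segment 0 y"
  shows "y \<in> D"
proof -
  have a: "(U, f) \<in> atlas X" "a > 0" using at by (auto simp: dev_at_def)
  obtain N where N: "open N" "convex N" "closed_segment 0 z \<subseteq> N" "N \<subseteq> D"
    using convex_neighbourhood[OF compact_segment convex_closed_segment open_D star_D[OF z]] by blast
  define B where "B = ball z (r / a)"
  have zB: "z \<in> B" using y unfolding B_def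
    by (metis centre_in_ball dist_not_less_zero not_le order_le_less_trans zero_le_dist)
  have sub: "(\<lambda>w. of_real a * w + b) ` B \<subseteq> f ` U"
  proof (intro subset_trans[OF _ U] image_subsetI)
    fix w assume "w \<in> B"
    have "dist (of_real a * z + b) (of_real a * w + b) = norm (of_real a * (z - w))"
      by (simp add: dist_norm algebra_simps)
    also have "\<dots> = a * dist z w" using a by (simp add: dist_norm norm_mult)
    finally show "of_real a * w + b \<in> ball (of_real a * z + b) r"
      using \<open>w \<in> B\<close> a by (simp add: B_def field_simps)
  qed
  define h where "h w = inv_into U f (of_real a * w + b)" for w
  have h: "developing X B h" unfolding h_def by (rule chart_inverse(1)[OF a sub])
  obtain d where d: "d > 0" "\<And>w. w \<in> D \<inter> ball z d \<Longrightarrow> E w \<in> U \<and> f (E w) = of_real a * w + b"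
    using at unfolding dev_at_def by auto
  have eq: "E w = h w" if "w \<in> N \<inter> B" for w
  proof (rule developing_unique[of "N \<inter> B" E h z d w])
    show "connected (N \<inter> B)" using N by (auto simp: B_def intro!: convex_connected convex_Int)
    show "developing X (N \<inter> B) E" "developing X (N \<inter> B) h"
      using N(4) by (auto intro: developing_mono[OF dev_D] developing_mono[OF h])
    fix w assume "w \<in> N \<inter> B \<inter> ball z d"
    then have "E w \<in> U" "f (E w) = of_real a * w + b" using d N by auto
    then show "E w = h w" unfolding h_def using chart_inj[OF a(1)] by (metis inv_into_f_f)
  qed (use that d N zB in auto)
  define G where "G w = (if w \<in> N then E w else h w)" for w
  have "developing X (N \<union> B) G"
  proof (rule developing_local)
    fix x assume "x \<in> N \<union> B"
    then consider "x \<in> N" | "x \<in> B" by blast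
    then show "\<exists>r S' E'. 0 < r \<and> developing X S' E' \<and> x \<in> S' \<and> (\<forall>w\<in>(N \<union> B) \<inter> ball x r. w \<in> S' \<and> G w = E' w)"
    proof cases
      case 1
      then obtain r where "r > 0" "ball x r \<subseteq> N" using openE N(1) by metis
      then show ?thesis using 1 N developing_mono[OF dev_D, of N]
        by (intro exI[of _ r] exI[of _ N] exI[of _ E]) (auto simp: G_def)
    next
      case 2
      then obtain r where "r > 0" "ball x r \<subseteq> B" using openE unfolding B_def by (metis open_ball)
      then show ?thesis using 2 h eq
        by (intro exI[of _ r] exI[of _ B] exI[of _ h]) (auto simp: G_def)
    qed
  qed
  moreover have "closed_segment 0 y \<subseteq> N \<union> B"
  proof -
    have "closed_segment z y \<subseteq> B"
      unfolding B_def using y zB by (intro closed_segment_subset) (auto simp: B_def dist_commute)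
    then show ?thesis using N(3) Un_closed_segment[OF zy] by blast
  qed
  moreover have "open (N \<union> B)" using N by (auto simp: B_def)
  ultimately obtain S where S: "open S" "convex S" "closed_segment 0 y \<subseteq> S" "S \<subseteq> N \<union> B"
    using convex_neighbourhood[OF compact_segment convex_closed_segment] by metis
  have "0 \<in> N" using N(3) by auto
  then obtain e where e: "e > 0" "ball 0 e \<subseteq> N" using openE N(1) by metis
  have "S \<subseteq> D"
  proof (rule max_D[OF S(1,2) _ developing_mono[OF \<open>developing X (N \<union> B) G\<close> S(4)]])
    show "0 < min e \<delta>" using e \<delta> by simp
    show "0 \<in> S" using S(3) by auto
    show "G w = E0 w" if "w \<in> S \<inter> ball 0 (min e \<delta>)" for w
      using that e E_eq by (auto simp: G_def)
  qed
  then show ?thesis using S(3) by auto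
qed

text \<open>A map on a bare segment has no thickness, so \<open>max_D\<close> does not apply to it
  directly. At the first point of the segment outside \<open>D\<close> the chart of \<open>g\<close>
  is also a chart of \<open>E\<close> at slightly earlier points, and \<open>extend\<close> then
  reaches the supposedly missing point.\<close>

lemma extend_along:
  assumes g: "developing X (closed_segment 0 z1) g"
    and d: "d > 0" "\<And>w. w \<in> closed_segment 0 z1 \<inter> ball 0 d \<Longrightarrow> g w = E0 w"
  shows "z1 \<in> D" and "w \<in> closed_segment 0 z1 \<Longrightarrow> E w = g w"
proof -
  have E_g: "E w = g w" if "closed_segment 0 y \<subseteq> D" "closed_segment 0 y \<subseteq> closed_segment 0 z1"
    "w \<in> closed_segment 0 y" for y w
  proof (rule developing_unique[of "closed_segment 0 y" E g 0 "min d \<delta>" w])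
    show "developing X (closed_segment 0 y) E" "developing X (closed_segment 0 y) g"
      using that developing_mono[OF dev_D] developing_mono[OF g] by auto
    show "E w = g w" if "w \<in> closed_segment 0 y \<inter> ball 0 (min d \<delta>)" for w
      using d E_eq[of w] that \<open>closed_segment 0 y \<subseteq> closed_segment 0 z1\<close> by auto
  qed (use that d \<delta> in auto)
  have seg: "closed_segment 0 (of_real t * z1) \<subseteq> closed_segment 0 z1" if "0 \<le> t" "t \<le> 1" for t
    using that by (intro closed_segment_subset) (auto simp: in_segment scaleR_conv_of_real)
  show "z1 \<in> D"
  proof (rule ccontr)
    assume "z1 \<notin> D"
    define K where "K = {0..1} \<inter> (\<lambda>t. of_real t * z1) -` (- D)"
    have "closed K" unfolding K_def
      by (intro closed_Int closed_vimage continuous_intros) (use open_D in \<open>auto simp: closed_def\<close>)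
    then have "compact K" unfolding K_def by (metis K_def Int_absorb1 compact_Int_closed compact_Icc inf_le1)
    moreover have "1 \<in> K" using \<open>z1 \<notin> D\<close> by (auto simp: K_def)
    ultimately obtain t where t: "t \<in> K" "\<And>s. s \<in> K \<Longrightarrow> t \<le> s"
      using compact_attains_inf[of K] by auto
    have t01: "0 \<le> t" "t \<le> 1" "of_real t * z1 \<notin> D" using t(1) by (auto simp: K_def)
    have "0 \<in> D" using ball_D \<delta> by (meson centre_in_ball subsetD)
    then have "t \<noteq> 0" using t01(3) by auto
    then have tpos: "t > 0" using t01 by simp
    have below: "of_real s * z1 \<in> D" if "0 \<le> s" "s < t" for s
      using t(2)[of s] that t01 by (auto simp: K_def)
    have z1: "z1 \<noteq> 0" using \<open>z1 \<notin> D\<close> \<open>0 \<in> D\<close> by auto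
    have tz: "of_real t * z1 \<in> closed_segment 0 z1" using t01 by (auto simp: in_segment scaleR_conv_of_real)
    obtain U f a b where at: "dev_at X (closed_segment 0 z1) g (of_real t * z1) U f a b"
      using g tz unfolding developing_def by blast
    then obtain e where e: "e > 0" "\<And>w. w \<in> closed_segment 0 z1 \<inter> ball (of_real t * z1) e \<Longrightarrow>
        g w \<in> U \<and> f (g w) = of_real a * w + b" and a: "(U, f) \<in> atlas X" "a > 0"
      unfolding dev_at_def by auto
    have "of_real a * (of_real t * z1) + b \<in> f ` U" using dev_at_value[OF at tz] by (metis imageI)
    then obtain r where r: "r > 0" "ball (of_real a * (of_real t * z1) + b) r \<subseteq> f ` U"
      using chart_image_open[OF a(1)] openE by metis
    \<comment> \<open>The step back from \<open>t z1\<close>: short enough to stay on the segment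
      and where \<open>f\<close> composed with \<open>g\<close> is affine, and less than half the
      chart radius. The chart disc of radius \<open>r / 2\<close> around the earlier point then
      still covers \<open>t z1\<close>.\<close>
    define m where "m = min (t / 2) (min (e / norm z1) (r / (2 * a) / norm z1) / 2)"
    have m: "m > 0" "m < t" "m * norm z1 < e" "m * norm z1 < r / (2 * a)"
    proof -
      show "m > 0" using tpos e(1) r(1) a z1 by (auto simp: m_def)
      have "m \<le> t / 2" unfolding m_def by (rule min.cobounded1)
      then show "m < t" using tpos by simp
      have "m < e / norm z1" "m < r / (2 * a) / norm z1"
      proof -
        have "m \<le> min (e / norm z1) (r / (2 * a) / norm z1) / 2" unfolding m_def by (rule min.cobounded2)
        moreover have "e / norm z1 > 0" "r / (2 * a) / norm z1 > 0" using e(1) r(1) a z1 by auto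
        moreover have "m < A \<and> m < B" if "m \<le> min A B / 2" "A > 0" "B > 0" for A B :: real
          using that by (auto simp: min_def split: if_splits)
        ultimately have "m < e / norm z1 \<and> m < r / (2 * a) / norm z1" by blast
        then show "m < e / norm z1" "m < r / (2 * a) / norm z1" by auto
      qed
      then show "m * norm z1 < e" "m * norm z1 < r / (2 * a)"
        using z1 by (metis pos_less_divide_eq zero_less_norm_iff)+
    qed
    define z where "z = of_real (t - m) * z1"
    have zD: "z \<in> D" using below[of "t - m"] m by (auto simp: z_def)
    have dist_m: "dist (of_real t * z1) (of_real s * z1) = \<bar>t - s\<bar> * norm z1" for s
    proof -
      have "of_real t * z1 - of_real s * z1 = of_real (t - s) * z1" by (simp add: algebra_simps)
      then show ?thesis by (simp only: dist_norm norm_mult norm_of_real)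
    qed
    have g_near: "E (of_real s * z1) \<in> U \<and> f (E (of_real s * z1)) = of_real a * (of_real s * z1) + b"
      if "t - m \<le> s" "s < t" for s
    proof -
      have s: "0 \<le> s" "s \<le> 1" using that m t01 by auto
      have "E (of_real s * z1) = g (of_real s * z1)"
        by (rule E_g[OF star_D[OF below[OF s(1) that(2)]] seg[OF s]]) auto
      moreover have "of_real s * z1 \<in> closed_segment 0 z1"
        using s by (auto simp: in_segment scaleR_conv_of_real)
      moreover have "\<bar>t - s\<bar> * norm z1 \<le> m * norm z1" using that by (intro mult_right_mono) auto
      then have "of_real s * z1 \<in> ball (of_real t * z1) e" using m by (simp add: dist_m)
      ultimately show ?thesis using e(2) by auto
    qed
    have Ez: "E z \<in> U" "f (E z) = of_real a * z + b" using g_near[of "t - m"] m by (auto simp: z_def)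
    obtain a' b' where D': "dev_at X D E z U f a' b'" using developing_chart[OF dev_D zD a(1) Ez(1)] by blast
    then obtain d' where d': "d' > 0" "\<And>w. w \<in> D \<inter> ball z d' \<Longrightarrow> f (E w) = of_real a' * w + b'"
      unfolding dev_at_def by auto
    \<comment> \<open>A second point \<open>w\<close> slightly further along the segment: the affine
      forms of \<open>E\<close> and \<open>g\<close> agree at both \<open>z\<close> and
      \<open>w\<close>, hence are the same.\<close>
    define h where "h = min (m / 2) (d' / norm z1 / 2)"
    have h: "h > 0" "h < m" "h * norm z1 < d'"
    proof -
      show "h > 0" using m d' z1 by (auto simp: h_def)
      have "h \<le> m / 2" unfolding h_def by (rule min.cobounded1)
      then show "h < m" using m by simp
      have "h \<le> d' / norm z1 / 2" unfolding h_def by (rule min.cobounded2)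
      moreover have "d' / norm z1 > 0" using d' z1 by auto
      moreover have "h < A" if "h \<le> A / 2" "A > 0" for A :: real using that by simp
      ultimately have "h < d' / norm z1" by blast
      then show "h * norm z1 < d'" using z1 by (metis pos_less_divide_eq zero_less_norm_iff)
    qed
    define w where "w = of_real (t - m + h) * z1"
    have wz: "w - z = of_real h * z1" by (simp add: w_def z_def algebra_simps)
    have "dist z w = h * norm z1" using wz h by (simp add: dist_norm norm_minus_commute norm_mult)
    then have "w \<in> D \<inter> ball z d'" using below[of "t - m + h"] h m by (auto simp: w_def)
    then have "f (E w) = of_real a' * w + b'" by (rule d')
    moreover have "f (E w) = of_real a * w + b" using g_near[of "t - m + h"] h m by (auto simp: w_def)
    moreover have "z \<noteq> w" using wz h z1 by auto
    moreover have "of_real a * z + b = of_real a' * z + b'" using dev_at_value[OF D' zD] Ez by simp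
    ultimately have ab: "a = a'" "b = b'"
      using dev_at_coefficients[of a z b a' b' w] by auto
    have "of_real t * z1 \<in> D"
    proof (rule extend[OF zD, of U f a b "r / 2"])
      show "dev_at X D E z U f a b" using D' ab by simp
      have "dist (of_real a * (of_real t * z1) + b) (of_real a * z + b) = norm (of_real a * (of_real m * z1))"
        by (simp add: dist_norm z_def algebra_simps)
      also have "\<dots> = a * (m * norm z1)" using a m by (simp add: norm_mult)
      also have "\<dots> < a * (r / (2 * a))" using a m by (intro mult_strict_left_mono) auto
      also have "\<dots> = r / 2" using a by simp
      finally show "ball (of_real a * z + b) (r / 2) \<subseteq> f ` U"
        using r(2) dist_triangle_half_r
        by (smt (verit, best) dist_commute mem_ball subset_iff dist_triangle field_sum_of_halves)
      show "dist (of_real t * z1) z < r / 2 / a"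
        using m a by (simp add: z_def dist_m del: of_real_diff)
      have "of_real (t - m) * z1 = ((t - m) / t) *\<^sub>R (of_real t * z1)" using tpos by (simp add: scaleR_conv_of_real)
      moreover have "0 \<le> (t - m) / t" "(t - m) / t \<le> 1" using m tpos by auto
      ultimately show "z \<in> closed_segment 0 (of_real t * z1)" unfolding z_def in_segment by (metis add_0 scaleR_zero_right)
    qed
    then show False using t01 by simp
  qed
  then show "w \<in> closed_segment 0 z1 \<Longrightarrow> E w = g w" using E_g[of z1] star_D by auto
qed

end

section \<open>Backward rays from a common point\<close>

context dilation_surf
begin

text \<open>Rescaling by \<open>1 / a1\<close> and \<open>1 / a2\<close> gives both maps slope 1 in
  the chart \<open>f\<close> and the same value at 0, so uniqueness applies. Thus \<open>t\<close>
  is length measured in \<open>f\<close>, and \<open>- t / a1\<close>, \<open>- t / a2\<close> are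
  the corresponding parameters in the two planes.\<close>

lemma backward_unique:
  assumes v: "norm v = 1"
    and g1: "developing X ((\<lambda>t. of_real t * v) ` {-\<sigma>1..0}) g1"
      "dev_at X ((\<lambda>t. of_real t * v) ` {-\<sigma>1..0}) g1 0 U f a1 b"
    and g2: "developing X ((\<lambda>t. of_real t * v) ` {-\<sigma>2..0}) g2"
      "dev_at X ((\<lambda>t. of_real t * v) ` {-\<sigma>2..0}) g2 0 U f a2 b"
    and t: "0 \<le> t" "t \<le> a1 * \<sigma>1" "t \<le> a2 * \<sigma>2"
  shows "g1 (of_real (- t / a1) * v) = g2 (of_real (- t / a2) * v)"
proof -
  define S where "S = (\<lambda>s. of_real s * v) ` {- t..0}"
  have *: "developing X S (\<lambda>w. g (of_real (1 / a) * w + 0))"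
    "\<exists>d>0. \<forall>w\<in>S \<inter> ball 0 d. g (of_real (1 / a) * w + 0) \<in> U \<and> f (g (of_real (1 / a) * w + 0)) = w + b"
    if g: "developing X ((\<lambda>t. of_real t * v) ` {-\<sigma>..0}) g"
      "dev_at X ((\<lambda>t. of_real t * v) ` {-\<sigma>..0}) g 0 U f a b" and t: "t \<le> a * \<sigma>" for g \<sigma> a
  proof -
    have a: "a > 0" using g(2) by (simp add: dev_at_def)
    have sub: "S \<subseteq> {w. of_real (1 / a) * w + 0 \<in> (\<lambda>t. of_real t * v) ` {-\<sigma>..0}}"
    proof
      fix w assume "w \<in> S"
      then obtain s where "s \<in> {- t..0}" "w = of_real s * v" unfolding S_def by blast
      then have s: "w = of_real s * v" "- t \<le> s" "s \<le> 0" by auto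
      have "- (a * \<sigma>) \<le> s" using s t by linarith
      then have "s / a \<in> {-\<sigma>..0}" using s a by (auto simp: field_simps)
      then show "w \<in> {w. of_real (1 / a) * w + 0 \<in> (\<lambda>t. of_real t * v) ` {-\<sigma>..0}}"
        using s(1) by (auto intro!: image_eqI[of _ _ "s / a"])
    qed
    show "developing X S (\<lambda>w. g (of_real (1 / a) * w + 0))"
      by (rule developing_mono[OF developing_affine[OF g(1)] sub]) (use a in auto)
    have "dev_at X ((\<lambda>t. of_real t * v) ` {-\<sigma>..0}) g (of_real (1 / a) * 0 + 0) U f a b" using g(2) by simp
    from dev_at_mono[OF dev_at_affine[OF this] sub] a
    show "\<exists>d>0. \<forall>w\<in>S \<inter> ball 0 d. g (of_real (1 / a) * w + 0) \<in> U \<and> f (g (of_real (1 / a) * w + 0)) = w + b"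
      unfolding dev_at_def by auto
  qed
  obtain d1 where d1: "d1 > 0" "\<And>w. w \<in> S \<inter> ball 0 d1 \<Longrightarrow>
      g1 (of_real (1 / a1) * w + 0) \<in> U \<and> f (g1 (of_real (1 / a1) * w + 0)) = w + b"
    using *(2)[OF g1 t(2)] by blast
  obtain d2 where d2: "d2 > 0" "\<And>w. w \<in> S \<inter> ball 0 d2 \<Longrightarrow>
      g2 (of_real (1 / a2) * w + 0) \<in> U \<and> f (g2 (of_real (1 / a2) * w + 0)) = w + b"
    using *(2)[OF g2 t(3)] by blast
  have at: "(U, f) \<in> atlas X" using g1 by (simp add: dev_at_def)
  have "g1 (of_real (1 / a1) * (of_real (- t) * v) + 0) = g2 (of_real (1 / a2) * (of_real (- t) * v) + 0)"
  proof (rule developing_unique[OF _ *(1)[OF g1 t(2)] *(1)[OF g2 t(3)], of 0 "min d1 d2"])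
    show "connected S" unfolding S_def
      by (intro connected_continuous_image continuous_intros) auto
    show "0 \<in> S" unfolding S_def using t by (intro image_eqI[of _ _ 0]) auto
    show "min d1 d2 > 0" using d1 d2 by simp
    show "of_real (- t) * v \<in> S" unfolding S_def using t by (intro image_eqI[of _ _ "- t"]) auto
    fix w assume "w \<in> S \<inter> ball 0 (min d1 d2)"
    then have "w \<in> S \<inter> ball 0 d1" "w \<in> S \<inter> ball 0 d2" by auto
    from d1(2)[OF this(1)] d2(2)[OF this(2)]
    show "g1 (of_real (1 / a1) * w + 0) = g2 (of_real (1 / a2) * w + 0)"
      using chart_inj[OF at] by (auto simp: inj_on_def)
  qed
  then show ?thesis by simp
qed

text \<open>Measured in chart length, backward rays of one direction from one point are nested, so
  all the hits occur on the longest of them, which is a single trajectory. Lengths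
  \<open>a i * l i\<close> are counted rather than points of \<open>B\<close>, since the trajectory
  may return to the same point. The strict inequalities on \<open>l i\<close> make each hit an
  interior time, as a crossing must be.\<close>

lemma bounded_returns:
  assumes v: "norm v = 1"
    and bound: "\<And>I \<gamma>. trajectory X I \<gamma> v \<Longrightarrow>
      finite {t \<in> interior I. \<gamma> t \<in> B} \<and> card {t \<in> interior I. \<gamma> t \<in> B} \<le> k"
    and F: "finite F"
    and g: "\<And>i. i \<in> F \<Longrightarrow> developing X ((\<lambda>t. of_real t * v) ` {-\<sigma> i..0}) (g i)"
      "\<And>i. i \<in> F \<Longrightarrow> dev_at X ((\<lambda>t. of_real t * v) ` {-\<sigma> i..0}) (g i) 0 U f (a i) b"
    and l: "\<And>i. i \<in> F \<Longrightarrow> 0 < l i" "\<And>i. i \<in> F \<Longrightarrow> l i < \<sigma> i"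
    and hit: "\<And>i. i \<in> F \<Longrightarrow> g i (of_real (- l i) * v) \<in> B"
  shows "card ((\<lambda>i. a i * l i) ` F) \<le> k"
proof (cases "F = {}")
  case False
  define A where "A = (\<lambda>i. a i * \<sigma> i) ` F"
  have A: "finite A" "A \<noteq> {}" using F False by (auto simp: A_def)
  have apos: "a i > 0" if "i \<in> F" for i using g(2)[OF that] by (simp add: dev_at_def)
  obtain j where j: "j \<in> F" "a j * \<sigma> j = Max A" using Max_in[OF A] by (auto simp: A_def)
  have max: "a i * \<sigma> i \<le> a j * \<sigma> j" if "i \<in> F" for i
    unfolding j(2) by (rule Max_ge[OF A(1)]) (use that in \<open>auto simp: A_def\<close>)
  have "trajectory X {-\<sigma> j..0} (\<lambda>t. g j (0 + of_real (1 * t) * v)) v"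
    by (rule developing_trajectory[OF g(1)[OF j(1)] _ v]) (auto simp: is_interval_cc)
  from bound[OF this] have fin: "finite {t \<in> interior {-\<sigma> j..0}. g j (of_real t * v) \<in> B}"
    "card {t \<in> interior {-\<sigma> j..0}. g j (of_real t * v) \<in> B} \<le> k" by auto
  have sub: "(\<lambda>x. - x / a j) ` (\<lambda>i. a i * l i) ` F \<subseteq> {t \<in> interior {-\<sigma> j..0}. g j (of_real t * v) \<in> B}"
  proof safe
    fix i assume i: "i \<in> F"
    have less: "a i * l i < a i * \<sigma> i" using apos[OF i] l(2)[OF i] by simp
    have pos: "a i * l i > 0" using apos[OF i] l(1)[OF i] by simp
    have "a i * l i < a j * \<sigma> j" using less max[OF i] by linarith
    then show "- (a i * l i) / a j \<in> interior {-\<sigma> j..0}"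
      using pos apos[OF j(1)] by (auto simp: interior_atLeastAtMost_real field_simps)
    have "g i (of_real (- (a i * l i) / a i) * v) = g j (of_real (- (a i * l i) / a j) * v)"
      by (rule backward_unique[OF v g(1)[OF i] g(2)[OF i] g(1)[OF j(1)] g(2)[OF j(1)]])
        (use pos less max[OF i] in linarith)+
    then show "g j (of_real (- (a i * l i) / a j) * v) \<in> B" using hit[OF i] apos[OF i] by simp
  qed
  have "inj_on (\<lambda>x. - x / a j) ((\<lambda>i. a i * l i) ` F)" using apos[OF j(1)] by (auto simp: inj_on_def)
  then have "card ((\<lambda>i. a i * l i) ` F) = card ((\<lambda>x. - x / a j) ` (\<lambda>i. a i * l i) ` F)"
    by (simp only: card_image)
  also have "\<dots> \<le> card {t \<in> interior {-\<sigma> j..0}. g j (of_real t * v) \<in> B}" by (rule card_mono[OF fin(1) sub])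
  finally show ?thesis using fin(2) by simp
qed simp

end

section \<open>Bounded crossings\<close>

text \<open>All that is kept of the saddle connection: a disc around one of its points, embedded in
  \<open>X\<close>, whose diameter of direction \<open>u\<close> runs inside \<open>B\<close>, and
  the bound \<open>k\<close>. Injectivity of \<open>E0\<close> turns equal points of
  \<open>X\<close> near the base into equal points of the plane.\<close>

locale crossing = dilation_surf X for X :: "'a dilation_surface" +
  fixes B :: "'a set" and u :: complex and k :: nat and \<delta> :: real and E0 :: "complex \<Rightarrow> 'a"
  assumes norm_u: "norm u = 1" and \<delta>_pos: "\<delta> > 0" and base_dev: "developing X (ball 0 \<delta>) E0"
    and base_inj: "inj_on E0 (ball 0 \<delta>)"
    and base_cross: "\<bar>\<tau>\<bar> < \<delta> \<Longrightarrow> E0 (of_real \<tau> * u) \<in> B"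
    and crossings: "v \<noteq> u \<Longrightarrow> v \<noteq> - u \<Longrightarrow> trajectory X I \<gamma> v \<Longrightarrow>
      finite {t \<in> interior I. \<gamma> t \<in> B} \<and> card {t \<in> interior I. \<gamma> t \<in> B} \<le> k"

locale crossing_domain = crossing X B u k \<delta> E0 + star_domain X \<delta> E0 D E
  for X :: "'a dilation_surface" and B u k \<delta> E0 D E
begin

text \<open>Each of the \<open>k + 1\<close> discs contains a point \<open>y i\<close> with the same
  image. The backward ray from \<open>y i\<close> stays in the tube of radius \<open>c / a i\<close>
  until it enters the base disc, where it meets the diameter in \<open>B\<close>. By
  \<open>bounded_returns\<close> two of these rays reach \<open>B\<close> after equal chart lengths;
  they then continue together past \<open>B\<close>, which forces \<open>y i = y j\<close> although
  the discs are disjoint. The constant \<open>C\<close> bounds oblique coordinates with axes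
  \<open>u\<close> and \<open>v\<close>.\<close>

lemma too_many_visits:
  assumes v: "norm v = 1" "v \<noteq> u" "v \<noteq> - u"
    and C: "\<And>d. \<exists>\<tau> \<sigma>. d = of_real \<tau> * u + of_real \<sigma> * v \<and> \<bar>\<tau>\<bar> \<le> C * norm d \<and> \<bar>\<sigma>\<bar> \<le> C * norm d"
      "C > 0"
    and at: "\<And>i. i \<le> k \<Longrightarrow> dev_at X D E (of_real (t i) * v) U f (a i) (b i)"
    and D: "\<And>i s. i \<le> k \<Longrightarrow> 0 \<le> s \<Longrightarrow> s \<le> t i \<Longrightarrow> ball (of_real s * v) (c / a i) \<subseteq> D"
    and c: "c > 0" and rho: "\<And>i. i \<le> k \<Longrightarrow> C * (c / a i) < \<delta> / 4" "\<And>i. i \<le> k \<Longrightarrow> C * (c / a i) < t i"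
    and near: "\<And>i. i \<le> k \<Longrightarrow> dist (f (E (of_real (t i) * v))) (f (E (of_real (t 0) * v))) < c"
    and U: "\<And>i. i \<le> k \<Longrightarrow> ball (f (E (of_real (t i) * v))) c \<subseteq> f ` U"
    and disj: "\<And>i j. i \<le> k \<Longrightarrow> j \<le> k \<Longrightarrow> i \<noteq> j \<Longrightarrow>
      ball (of_real (t i) * v) (c / a i) \<inter> ball (of_real (t j) * v) (c / a j) = {}"
  shows False
proof -
  have apos: "a i > 0" and Uf: "(U, f) \<in> atlas X" if "i \<le> k" for i using at[OF that] by (auto simp: dev_at_def)
  have Uf: "(U, f) \<in> atlas X" using Uf[of 0] by simp
  have tpos: "t i > 0" if "i \<le> k" for i using rho(2)[OF that] apos[OF that] c C(2)
    by (meson divide_pos_pos mult_pos_pos order_less_trans)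
  have tD: "of_real (t i) * v \<in> D" if "i \<le> k" for i
  proof -
    have "of_real (t i) * v \<in> ball (of_real (t i) * v) (c / a i)" using apos[OF that] c by simp
    then show ?thesis using D[OF that, of "t i"] tpos[OF that] by auto
  qed
  define x where "x i = f (E (of_real (t i) * v))" for i
  have xval: "x i = of_real (a i) * (of_real (t i) * v) + b i" "E (of_real (t i) * v) \<in> U" if "i \<le> k" for i
    using dev_at_value[OF at[OF that] tD[OF that]] by (auto simp: x_def)
  \<comment> \<open>The affine form of \<open>f\<close> composed with \<open>E\<close> near
    \<open>t i v\<close>, solved for the value \<open>x 0\<close>.\<close>
  define y where "y i = of_real (t i) * v + (x 0 - x i) / of_real (a i)" for i
  have y_ball: "y i \<in> ball (of_real (t i) * v) (c / a i)" if "i \<le> k" for i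
  proof -
    have "norm (x 0 - x i) < c" using near[OF that] by (simp add: x_def dist_norm norm_minus_commute)
    then show ?thesis using apos[OF that] by (simp add: y_def dist_norm norm_divide divide_strict_right_mono)
  qed
  have y: "E (y i) \<in> U" "f (E (y i)) = of_real (a i) * y i + b i" "dev_at X D E (y i) U f (a i) (b i)"
    if "i \<le> k" for i
  proof -
    have sub: "ball (of_real (t i) * v) (c / a i) \<subseteq> D" using D[OF that, of "t i"] tpos[OF that] by auto
    have ball: "ball (of_real (a i) * (of_real (t i) * v) + b i) (a i * (c / a i)) \<subseteq> f ` U"
      using U[OF that] apos[OF that] xval(1)[OF that] by (simp add: x_def)
    from chart_ball(2-4)[OF dev_D at[OF that] sub ball y_ball[OF that]]
    show "E (y i) \<in> U" "f (E (y i)) = of_real (a i) * y i + b i" "dev_at X D E (y i) U f (a i) (b i)" by auto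
  qed
  have fy: "f (E (y i)) = x 0" if "i \<le> k" for i
  proof -
    have "of_real (a i) * ((x 0 - x i) / of_real (a i)) = x 0 - x i" using apos[OF that] by simp
    then have "of_real (a i) * y i + b i = x 0"
      unfolding y_def distrib_left using xval(1)[OF that] by simp
    then show ?thesis using y(2)[OF that] by simp
  qed
  obtain \<tau> \<sigma> where ts: "\<And>d. d = of_real (\<tau> d) * u + of_real (\<sigma> d) * v"
    "\<And>d. \<bar>\<tau> d\<bar> \<le> C * norm d" "\<And>d. \<bar>\<sigma> d\<bar> \<le> C * norm d"
    using C(1) by metis
  \<comment> \<open>In oblique coordinates \<open>y i\<close> is
    \<open>\<tau> (d i) u + s i v\<close>, so going back by \<open>s i\<close> ends exactly on the
    base diameter.\<close>
  define d where "d i = y i - of_real (t i) * v" for i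
  define s where "s i = t i + \<sigma> (d i)" for i
  have dn: "norm (d i) < c / a i" if "i \<le> k" for i
    using y_ball[OF that] by (simp add: d_def dist_norm norm_minus_commute)
  have small: "\<bar>\<tau> (d i)\<bar> < \<delta> / 4" "\<bar>\<sigma> (d i)\<bar> < \<delta> / 4" "\<bar>\<sigma> (d i)\<bar> < t i" if "i \<le> k" for i
  proof -
    have "C * norm (d i) < C * (c / a i)" using dn[OF that] C(2) by (rule mult_strict_left_mono)
    then show "\<bar>\<tau> (d i)\<bar> < \<delta> / 4" "\<bar>\<sigma> (d i)\<bar> < \<delta> / 4" "\<bar>\<sigma> (d i)\<bar> < t i"
      using ts(2,3)[of "d i"] rho[OF that] by linarith+
  qed
  have spos: "s i > 0" if "i \<le> k" for i using small(3)[OF that] by (simp add: s_def)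
  have y_eq: "y i = of_real (\<tau> (d i)) * u + of_real (s i) * v" for i
  proof -
    have "y i = d i + of_real (t i) * v" by (simp add: d_def)
    also have "d i = of_real (\<tau> (d i)) * u + of_real (\<sigma> (d i)) * v" by (rule ts)
    finally show ?thesis by (simp add: s_def algebra_simps)
  qed
  have nb: "of_real (\<tau> (d i)) * u + of_real h * v \<in> ball 0 \<delta>" if "i \<le> k" "\<bar>h\<bar> \<le> \<delta> / 2" for i h
  proof -
    have "norm (of_real (\<tau> (d i)) * u + of_real h * v) \<le> \<bar>\<tau> (d i)\<bar> + \<bar>h\<bar>"
      using norm_triangle_ineq[of "of_real (\<tau> (d i)) * u" "of_real h * v"] v norm_u by (simp add: norm_mult)
    then show ?thesis using small(1)[OF that(1)] that(2) \<delta> by simp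
  qed
  define g where "g i = (\<lambda>w. E (of_real 1 * w + y i))" for i
  \<comment> \<open>The extra length \<open>\<delta> / 2\<close> makes the hit an interior time and
    later allows two rays to be compared beyond the diameter.\<close>
  define R where "R i = (\<lambda>h. of_real h * v) ` {- (s i + \<delta> / 2)..0}" for i
  have R_D: "R i \<subseteq> {w. of_real 1 * w + y i \<in> D}" if i: "i \<le> k" for i
  proof
    fix w assume "w \<in> R i"
    then obtain h where "h \<in> {- (s i + \<delta> / 2)..0}" "w = of_real h * v" unfolding R_def by blast
    then have h: "w = of_real h * v" "- (s i + \<delta> / 2) \<le> h" "h \<le> 0" by auto
    have wy: "w + y i = of_real (\<tau> (d i)) * u + of_real (s i + h) * v"
      unfolding y_eq h(1) by (simp add: algebra_simps)
    \<comment> \<open>Close to the diameter the backward ray is inside the base disc. Elsewhere it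
      is the original ray shifted by \<open>d i\<close>, hence in the tube.\<close>
    have "w + y i \<in> D"
    proof (cases "s i + h \<le> \<delta> / 2")
      case True
      then have "\<bar>s i + h\<bar> \<le> \<delta> / 2" using h by linarith
      then show ?thesis using nb[OF i] ball_D unfolding wy by blast
    next
      case False
      have r: "0 \<le> t i + h" "t i + h \<le> t i" using False h small(2)[OF i] \<delta> by (auto simp: s_def)
      have "w + y i = of_real (t i + h) * v + d i" unfolding h(1) d_def by (simp add: algebra_simps)
      then have "dist (of_real (t i + h) * v) (w + y i) = norm (d i)" by (simp add: dist_norm)
      then show ?thesis using D[OF i r] dn[OF i] by auto
    qed
    then show "w \<in> {w. of_real 1 * w + y i \<in> D}" by simp
  qed
  have dev_g: "developing X (R i) (g i)" if "i \<le> k" for i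
    unfolding g_def by (rule developing_mono[OF developing_affine[OF dev_D] R_D[OF that]]) auto
  have at_g: "dev_at X (R i) (g i) 0 U f (a i) (x 0)" if "i \<le> k" for i
  proof -
    have "dev_at X D E (of_real 1 * 0 + y i) U f (a i) (b i)" using y(3)[OF that] by simp
    from dev_at_mono[OF dev_at_affine[OF this] R_D[OF that]]
    have "dev_at X (R i) (g i) 0 U f (a i) (of_real (a i) * y i + b i)" by (simp add: g_def)
    then show ?thesis using fy[OF that] y(2)[OF that] by simp
  qed
  have gval: "g i (of_real (- (s i + h)) * v) = E0 (of_real (\<tau> (d i)) * u + of_real (- h) * v)"
    if "i \<le> k" "\<bar>h\<bar> \<le> \<delta> / 2" for i h
  proof -
    have "of_real 1 * (of_real (- (s i + h)) * v) + y i = of_real (\<tau> (d i)) * u + of_real (- h) * v"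
      unfolding y_eq by (simp add: algebra_simps)
    then show ?thesis unfolding g_def using E_eq nb[of i "- h"] that by simp
  qed
  have "card ((\<lambda>i. a i * s i) ` {..k}) \<le> k"
  proof (rule bounded_returns[OF v(1) crossings[OF v(2,3)], where \<sigma> = "\<lambda>i. s i + \<delta> / 2" and g = g and U = U and f = f and b = "x 0"])
    fix i assume "i \<in> {..k}"
    then have i: "i \<le> k" by simp
    show "developing X ((\<lambda>t. complex_of_real t * v) ` {- (s i + \<delta> / 2)..0}) (g i)" using dev_g[OF i] by (simp add: R_def)
    show "dev_at X ((\<lambda>t. complex_of_real t * v) ` {- (s i + \<delta> / 2)..0}) (g i) 0 U f (a i) (x 0)"
      using at_g[OF i] by (simp add: R_def)
    show "0 < s i" "s i < s i + \<delta> / 2" using spos[OF i] \<delta> by auto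
    show "g i (of_real (- s i) * v) \<in> B"
      using gval[OF i, of 0] base_cross[of "\<tau> (d i)"] small(1)[OF i] \<delta> by simp
  qed auto
  then have "\<not> inj_on (\<lambda>i. a i * s i) {..k}" using card_image by fastforce
  then obtain i j where ij: "i \<le> k" "j \<le> k" "i \<noteq> j" "a i * s i = a j * s j" by (auto simp: inj_on_def)
  note ai = apos[OF ij(1)] and aj = apos[OF ij(2)]
  have same: "E0 (of_real (\<tau> (d i)) * u + of_real (- (h / a i)) * v) = E0 (of_real (\<tau> (d j)) * u + of_real (- (h / a j)) * v)"
    if h: "0 \<le> h" "h \<le> a i * (\<delta> / 2)" "h \<le> a j * (\<delta> / 2)" for h
  proof -
    have eq: "g i (of_real (- (a i * s i + h) / a i) * v) = g j (of_real (- (a i * s i + h) / a j) * v)"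
    proof (rule backward_unique[OF v(1), of "s i + \<delta> / 2" _ U f _ "x 0" "s j + \<delta> / 2"])
      show "0 \<le> a i * s i + h" using ai spos[OF ij(1)] h by simp
      show "a i * s i + h \<le> a i * (s i + \<delta> / 2)" using h by (simp add: algebra_simps)
      show "a i * s i + h \<le> a j * (s j + \<delta> / 2)" using h unfolding ij(4) by (simp add: algebra_simps)
    qed (use dev_g[OF ij(1)] at_g[OF ij(1)] dev_g[OF ij(2)] at_g[OF ij(2)] in \<open>auto simp: R_def\<close>)
    have e1: "- (a i * s i + h) / a i = - (s i + h / a i)" using ai by (simp add: field_simps)
    have e2: "- (a i * s i + h) / a j = - (s j + h / a j)" using aj by (simp add: ij(4) field_simps)
    have "\<bar>h / a i\<bar> \<le> \<delta> / 2" "\<bar>h / a j\<bar> \<le> \<delta> / 2" using h ai aj by (auto simp: field_simps)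
    then show ?thesis
      using eq unfolding e1 e2 by (simp only: gval[OF ij(1)] gval[OF ij(2)])
  qed
  have inj: "p = q" if "E0 p = E0 q" "p \<in> ball 0 \<delta>" "q \<in> ball 0 \<delta>" for p q
    using base_inj that by (auto simp: inj_on_def)
  have u0: "u \<noteq> 0" and v0: "v \<noteq> 0" using norm_u v by auto
  have "of_real (\<tau> (d i)) * u + of_real (- (0 / a i)) * v = of_real (\<tau> (d j)) * u + of_real (- (0 / a j)) * v"
    by (rule inj[OF same nb[OF ij(1)] nb[OF ij(2)]]) (use \<delta> ai aj in auto)
  then have tau: "\<tau> (d i) = \<tau> (d j)" using u0 by simp
  \<comment> \<open>Equality on the diameter gives the same \<open>\<tau>\<close>. Equality a
    further chart length \<open>h\<close> back gives \<open>h / a i = h / a j\<close>, so the scales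
    agree as well.\<close>
  define h where "h = min (a i) (a j) * (\<delta> / 2)"
  have h: "0 < h" "h \<le> a i * (\<delta> / 2)" "h \<le> a j * (\<delta> / 2)" using ai aj \<delta> by (auto simp: h_def)
  have "of_real (\<tau> (d i)) * u + of_real (- (h / a i)) * v = of_real (\<tau> (d j)) * u + of_real (- (h / a j)) * v"
    by (rule inj[OF same nb[OF ij(1)] nb[OF ij(2)]]) (use h ai aj in \<open>auto simp: field_simps\<close>)
  then have "complex_of_real (h / a i) = of_real (h / a j)" using tau v0 by simp
  then have "h / a i = h / a j" by (simp only: of_real_eq_iff)
  then have "a i = a j" using h(1) ai aj by (simp add: field_simps)
  then have "s i = s j" using ij(4) ai by simp
  then have "y i = y j" unfolding y_eq using tau by simp
  then show False using disj[OF ij(1-3)] y_ball[OF ij(1)] y_ball[OF ij(2)] by auto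
qed

end

section \<open>Limits of paths in the compact surface, and closing up a segment\<close>

context dilation_surf
begin

text \<open>Finitely many sets cover the surface; after the last of the finitely many times at which
  the path leaves the sets outside \<open>\<V>\<close> for good, only members of \<open>\<V>\<close>
  remain.\<close>

lemma eventually_outside:
  assumes I: "I \<noteq> {}" and cover: "topspace TX \<subseteq> \<Union>\<U>" "\<And>W. W \<in> \<U> \<Longrightarrow> openin TX W"
    and out: "\<And>W. W \<in> \<U> - \<V> \<Longrightarrow> \<exists>t0\<in>I. \<forall>t\<in>I. t0 \<le> t \<longrightarrow> \<gamma> t \<notin> W"
    and \<gamma>: "\<And>t. t \<in> I \<Longrightarrow> \<gamma> t \<in> topspace TX"
  shows "\<exists>t0\<in>I. \<forall>t\<in>(I::real set). t0 \<le> t \<longrightarrow> \<gamma> t \<in> \<Union>\<V>"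
proof -
  obtain F where F: "finite F" "F \<subseteq> \<U>" "topspace TX \<subseteq> \<Union>F"
  proof -
    have "\<exists>F. finite F \<and> F \<subseteq> \<U> \<and> topspace TX \<subseteq> \<Union>F"
      using compact[unfolded compact_space_alt, rule_format, of \<U>] cover by simp
    then show ?thesis using that by auto
  qed
  obtain t0 where t0: "\<And>W. W \<in> \<U> - \<V> \<Longrightarrow> t0 W \<in> I \<and> (\<forall>t\<in>I. t0 W \<le> t \<longrightarrow> \<gamma> t \<notin> W)"
    using out by metis
  obtain i0 where i0: "i0 \<in> I" using I by blast
  define T where "T = insert i0 (t0 ` (F - \<V>))"
  have T: "finite T" "T \<noteq> {}" "T \<subseteq> I" using F t0 i0 by (auto simp: T_def)
  have "\<gamma> t \<in> \<Union>\<V>" if t: "t \<in> I" "Max T \<le> t" for t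
  proof -
    obtain W where W: "W \<in> F" "\<gamma> t \<in> W" using \<gamma>[OF t(1)] F(3) by blast
    show ?thesis
    proof (cases "W \<in> \<V>")
      case False
      then have "t0 W \<le> Max T" using W T by (auto simp: T_def)
      then have "t0 W \<le> t" using t by simp
      then show ?thesis using t0[of W] W F(2) False t by blast
    qed (use W in blast)
  qed
  moreover have "Max T \<in> I" using Max_in[OF T(1,2)] T(3) by (rule rev_subsetD)
  ultimately show ?thesis by (intro bexI[of _ "Max T"]) auto
qed

text \<open>Without a regular cluster point, compactness leaves only neighbourhoods of the finitely
  many singularities. A tail of the path is connected, so it cannot jump between disjoint
  neighbourhoods and converges to one singularity.\<close>

lemma limit_cases:
  assumes I: "is_interval (I :: real set)" "I \<noteq> {}" and cont: "continuous_map (top_of_set I) TX \<gamma>"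
  obtains (singular) s where "s \<in> sings X"
      "\<And>W. openin TX W \<Longrightarrow> s \<in> W \<Longrightarrow> \<exists>t0\<in>I. \<forall>t\<in>I. t0 \<le> t \<longrightarrow> \<gamma> t \<in> W"
    | (regular) q where "q \<in> regular_part X"
      "\<And>W t0. openin TX W \<Longrightarrow> q \<in> W \<Longrightarrow> t0 \<in> I \<Longrightarrow> \<exists>t\<in>I. t0 \<le> t \<and> \<gamma> t \<in> W"
proof -
  have \<gamma>: "\<gamma> t \<in> topspace TX" if "t \<in> I" for t
    using cont that by (auto simp: continuous_map_def)
  define cluster where "cluster q \<longleftrightarrow> (\<forall>W t0. openin TX W \<longrightarrow> q \<in> W \<longrightarrow> t0 \<in> I \<longrightarrow> (\<exists>t\<in>I. t0 \<le> t \<and> \<gamma> t \<in> W))" for q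
  show ?thesis
  proof (cases "\<exists>q \<in> regular_part X. cluster q")
    case True
    then obtain q where q: "q \<in> regular_part X" "cluster q" by blast
    show ?thesis by (rule regular[OF q(1)]) (use q(2) in \<open>auto simp: cluster_def\<close>)
  next
    case False
    define \<O> where "\<O> = {W. openin TX W \<and> (\<exists>t0\<in>I. \<forall>t\<in>I. t0 \<le> t \<longrightarrow> \<gamma> t \<notin> W)}"
    have O: "\<exists>W\<in>\<O>. q \<in> W" if "\<not> cluster q" for q
      using that unfolding cluster_def \<O>_def by blast
    have "\<exists>s\<in>sings X. cluster s"
    proof (rule ccontr)
      assume "\<not> (\<exists>s\<in>sings X. cluster s)"
      then have "topspace TX \<subseteq> \<Union>\<O>" using False O unfolding regular_part_def by blast
      then have "\<exists>t0\<in>I. \<forall>t\<in>I. t0 \<le> t \<longrightarrow> \<gamma> t \<in> \<Union>{}"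
        by (rule eventually_outside[OF I(2)]) (auto simp: \<O>_def \<gamma>)
      then show False by auto
    qed
    then obtain s where s: "s \<in> sings X" "cluster s" by blast
    have "\<exists>t0\<in>I. \<forall>t\<in>I. t0 \<le> t \<longrightarrow> \<gamma> t \<in> W" if W: "openin TX W" "s \<in> W" for W
    proof -
      have "compactin TX {s}" "compactin TX (sings X - {s})"
        using s(1) sings_subset finite_sings by (auto intro!: finite_imp_compactin)
      then obtain A V where AV: "openin TX A" "openin TX V" "{s} \<subseteq> A" "sings X - {s} \<subseteq> V" "disjnt A V"
        using Hausdorff_space_compact_separation[OF Hausdorff, of "{s}" "sings X - {s}"]
        by (metis Diff_disjoint disjnt_def)
      define A' where "A' = A \<inter> W"
      have A': "openin TX A'" "s \<in> A'" "A' \<inter> V = {}" using AV W by (auto simp: A'_def disjnt_def)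
      have "\<exists>t0\<in>I. \<forall>t\<in>I. t0 \<le> t \<longrightarrow> \<gamma> t \<in> \<Union>{A', V}"
      proof (rule eventually_outside[OF I(2), where \<U> = "\<O> \<union> {A', V}"])
        show "topspace TX \<subseteq> \<Union>(\<O> \<union> {A', V})"
        proof
          fix x assume x: "x \<in> topspace TX"
          show "x \<in> \<Union>(\<O> \<union> {A', V})"
          proof (cases "x \<in> sings X")
            case True
            then show ?thesis using A' AV by (cases "x = s") auto
          next
            case False
            then have "\<not> cluster x" using x \<open>\<not> (\<exists>q\<in>regular_part X. cluster q)\<close> by (auto simp: regular_part_def)
            then show ?thesis using O by blast
          qed
        qed
      qed (use A' AV \<gamma> in \<open>auto simp: \<O>_def\<close>)
      then obtain t0 where t0: "t0 \<in> I" "\<And>t. t \<in> I \<Longrightarrow> t0 \<le> t \<Longrightarrow> \<gamma> t \<in> A' \<union> V" by auto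
      define J where "J = I \<inter> {t0..}"
      have "connected J" unfolding J_def using I(1)
        by (intro is_interval_connected is_interval_Int) (auto simp: is_interval_ci)
      then have "connectedin (top_of_set I) J" by (simp add: connectedin_subtopology J_def)
      then have con: "connectedin TX (\<gamma> ` J)" using connectedin_continuous_map_image[OF cont] by blast
      obtain t1 where t1: "t1 \<in> I" "t0 \<le> t1" "\<gamma> t1 \<in> A'"
        using s(2) A' t0(1) unfolding cluster_def by blast
      have "V \<inter> \<gamma> ` J = {}"
      proof (rule ccontr)
        assume "V \<inter> \<gamma> ` J \<noteq> {}"
        moreover have "A' \<inter> \<gamma> ` J \<noteq> {}" using t1 by (auto simp: J_def)
        moreover have "\<gamma> ` J \<subseteq> A' \<union> V" using t0 by (auto simp: J_def)
        moreover have "A' \<inter> V \<inter> \<gamma> ` J = {}" using A'(3) by blast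
        ultimately show False using con A'(1) AV(2) unfolding connectedin by blast
      qed
      then have "\<gamma> t \<in> W" if "t \<in> I" "t0 \<le> t" for t
        using t0(2)[OF that] that by (auto simp: J_def A'_def)
      then show ?thesis using t0(1) by blast
    qed
    then show ?thesis by (rule singular[OF s(1)])
  qed
qed

text \<open>The local inverses of \<open>E\<close> along the segment continue each other, so the
  holonomy can be read off at the ends: \<open>(f - b') / a'\<close> at \<open>y\<close> is
  continued to \<open>(f - b) / a\<close> at \<open>x\<close>, and the ratio is
  \<open>a' / a\<close>. The geodesic runs from \<open>y\<close> to \<open>x\<close>, that is from
  the small slope to the large one.\<close>

lemma closed_geodesic_between:
  assumes S: "open S" "convex S" and E: "developing X S E"
    and x: "x \<in> S" "y \<in> S" and Exy: "E x = E y" and neq: "x \<noteq> y"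
    and atx: "dev_at X S E x U f a b" and aty: "dev_at X S E y U f a' b'" and less: "a' < a"
  shows "(x - y) / of_real (norm (x - y)) \<in> hyperbolic_directions X"
proof -
  define v where "v = (x - y) / of_real (norm (x - y))"
  define c where "c = norm (x - y)"
  define p where "p t = y + of_real (c * t) * v" for t
  define \<gamma> where "\<gamma> t = E (p t)" for t
  have c: "c > 0" using neq by (simp add: c_def)
  have v: "norm v = 1" using neq by (simp add: v_def norm_divide)
  have p01: "p 0 = y" "p 1 = x" using neq by (auto simp: p_def c_def v_def)
  have p_S: "p t \<in> S" if "t \<in> {0..1}" for t
  proof -
    have "of_real c * v = x - y" using neq by (simp add: c_def v_def)
    then have "p t = y + of_real t * (x - y)" by (simp add: p_def mult_ac)
    then have "p t = (1 - t) *\<^sub>R y + t *\<^sub>R x" by (simp add: scaleR_conv_of_real algebra_simps)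
    then show ?thesis using convexD_alt[OF S(2) x(2,1)] that by auto
  qed
  have apos: "a > 0" "a' > 0" "(U, f) \<in> atlas X" using atx aty by (auto simp: dev_at_def)
  have traj: "trajectory X {0..1} \<gamma> v" unfolding \<gamma>_def p_def
    by (rule developing_trajectory[OF E _ v c]) (use p_S p_def in \<open>auto simp: is_interval_cc\<close>)
  then have cg: "closed_geodesic X \<gamma> v"
    using Exy by (simp add: closed_geodesic_def \<gamma>_def p01)
  have "\<forall>z\<in>S. \<exists>q. dev_at X S E z (fst q) (fst (snd q)) (fst (snd (snd q))) (snd (snd (snd q)))"
  proof
    fix z assume "z \<in> S"
    then obtain V g c d where "dev_at X S E z V g c d" using E unfolding developing_def by blast
    then show "\<exists>q. dev_at X S E z (fst q) (fst (snd q)) (fst (snd (snd q))) (snd (snd (snd q)))"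
      by (intro exI[of _ "(V, g, c, d)"]) simp
  qed
  from bchoice[OF this] obtain C where C: "\<forall>z\<in>S.
      dev_at X S E z (fst (C z)) (fst (snd (C z))) (fst (snd (snd (C z)))) (snd (snd (snd (C z))))"
    ..
  \<comment> \<open>At the two ends the charts must be the given ones, to be comparable; in between
    any choice will do.\<close>
  define C' where "C' z = (if z = x then (U, f, a, b) else if z = y then (U, f, a', b') else C z)" for z
  define CU where "CU z = fst (C' z)" for z
  define Cf where "Cf z = fst (snd (C' z))" for z
  define Ca where "Ca z = fst (snd (snd (C' z)))" for z
  define Cb where "Cb z = snd (snd (snd (C' z)))" for z
  have at: "dev_at X S E z (CU z) (Cf z) (Ca z) (Cb z)" if "z \<in> S" for z
    using C that atx aty by (auto simp: CU_def Cf_def Ca_def Cb_def C'_def)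
  define \<psi> where "\<psi> t q = (Cf (p t) q - Cb (p t)) / of_real (Ca (p t))" for t q
  have Ca: "Ca z > 0" and Cat: "(CU z, Cf z) \<in> atlas X" if "z \<in> S" for z
    using at[OF that] by (auto simp: dev_at_def)
  have inv: "\<exists>d>0. ball z d \<subseteq> S \<and> (\<forall>w\<in>ball z d. E w \<in> CU z \<and> (Cf z (E w) - Cb z) / of_real (Ca z) = w)"
    if z: "z \<in> S" for z
  proof -
    obtain d where d: "d > 0" "\<And>w. w \<in> S \<inter> ball z d \<Longrightarrow> E w \<in> CU z \<and> Cf z (E w) = of_real (Ca z) * w + Cb z"
      using at[OF z] unfolding dev_at_def by auto
    obtain e where e: "e > 0" "ball z e \<subseteq> S" using openE[OF S(1) z] by blast
    show ?thesis
      using d e Ca[OF z] by (intro exI[of _ "min d e"]) (auto simp: subset_eq)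
  qed
  \<comment> \<open>Openness of \<open>E\<close>: coordinates have to agree on a neighbourhood in
    \<open>X\<close>, not only along the geodesic.\<close>
  have image_open: "\<exists>W. openin TX W \<and> E z \<in> W \<and> W \<subseteq> E ` ball z d" if z: "z \<in> S" and d: "d > 0" for z d
  proof -
    obtain e where e: "e > 0" "ball z e \<subseteq> S" "\<And>w. w \<in> ball z e \<Longrightarrow> E w \<in> CU z \<and> (Cf z (E w) - Cb z) / of_real (Ca z) = w"
      using inv[OF z] by blast
    define m where "m = min d e"
    have m: "m > 0" using d e by (simp add: m_def)
    define W where "W = {q \<in> CU z. Cf z q \<in> (\<lambda>w. of_real (Ca z) * w + Cb z) ` ball z m}"
    have "open ((\<lambda>w. of_real (Ca z) * w + Cb z) ` ball z m)"
    proof -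
      have "(\<lambda>w. of_real (Ca z) * w + Cb z) = (\<lambda>w. Cb z + Ca z *\<^sub>R w)"
        by (simp add: fun_eq_iff scaleR_conv_of_real add.commute)
      moreover have "open ((\<lambda>w. Cb z + Ca z *\<^sub>R w) ` ball z m)"
        by (rule open_affinity) (use Ca[OF z] in auto)
      ultimately show ?thesis by (simp only:)
    qed
    then have "openin TX W" unfolding W_def by (rule chart_preimage[OF Cat[OF z]])
    moreover have Ez: "E w \<in> CU z" "Cf z (E w) = of_real (Ca z) * w + Cb z" if "w \<in> ball z m" for w
      using e(3)[of w] that Ca[OF z] by (auto simp: m_def field_simps)
    then have "E z \<in> W" using m by (auto simp: W_def)
    moreover have "W \<subseteq> E ` ball z m"
    proof
      fix q assume "q \<in> W"
      then obtain w where w: "q \<in> CU z" "w \<in> ball z m" "Cf z q = of_real (Ca z) * w + Cb z" by (auto simp: W_def)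
      then have "q = E w" using Ez[OF w(2)] chart_inj[OF Cat[OF z]] by (auto simp: inj_on_def)
      then show "q \<in> E ` ball z m" using w by blast
    qed
    moreover have "ball z m \<subseteq> ball z d" by (auto simp: m_def)
    ultimately show ?thesis by blast
  qed
  have "coordinate_continuation X \<gamma> \<psi>"
    unfolding coordinate_continuation_def
  proof (intro conjI ballI)
    fix t :: real assume t: "t \<in> {0..1}"
    have "dilation_germ TX (\<gamma> t) (\<psi> t) (1 / Ca (p t)) (Cf (p t))"
      unfolding dilation_germ_def \<psi>_def using Ca[OF p_S[OF t]]
      by (intro conjI exI[of _ "- Cb (p t) / of_real (Ca (p t))"]) (auto simp: field_simps)
    moreover have "\<gamma> t \<in> CU (p t)" using dev_at_value[OF at[OF p_S[OF t]] p_S[OF t]] by (simp add: \<gamma>_def)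
    ultimately show "local_coordinate X (\<gamma> t) (\<psi> t)"
      unfolding local_coordinate_def using Cat[OF p_S[OF t]] by blast
    obtain d where d: "d > 0" "ball (p t) d \<subseteq> S" "\<And>w. w \<in> ball (p t) d \<Longrightarrow> (Cf (p t) (E w) - Cb (p t)) / of_real (Ca (p t)) = w"
      using inv[OF p_S[OF t]] by blast
    have "\<forall>\<^sub>F q in nhdsin TX (\<gamma> s). \<psi> s q = \<psi> t q" if s: "s \<in> {0..1}" "dist s t < d / c" for s
    proof -
      have "p t - p s = of_real (c * (t - s)) * v" by (simp add: p_def algebra_simps)
      then have "dist (p t) (p s) = c * \<bar>t - s\<bar>" using v c
        by (simp only: dist_norm norm_mult norm_of_real abs_mult)
      then have "p s \<in> ball (p t) d" using s(2) c by (simp add: dist_real_def field_simps abs_minus_commute)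
      then obtain e1 where e1: "e1 > 0" "ball (p s) e1 \<subseteq> ball (p t) d" using openE[OF open_ball] by blast
      obtain e2 where e2: "e2 > 0" "\<And>w. w \<in> ball (p s) e2 \<Longrightarrow> (Cf (p s) (E w) - Cb (p s)) / of_real (Ca (p s)) = w"
        using inv[OF p_S[OF s(1)]] by blast
      obtain W where W: "openin TX W" "E (p s) \<in> W" "W \<subseteq> E ` ball (p s) (min e1 e2)"
        using image_open[OF p_S[OF s(1)], of "min e1 e2"] e1 e2 by auto
      have "\<psi> s q = \<psi> t q" if "q \<in> W" for q
      proof -
        have "q \<in> E ` ball (p s) (min e1 e2)" using that W(3) by (rule rev_subsetD)
        then obtain w where w: "q = E w" "w \<in> ball (p s) e1" "w \<in> ball (p s) e2" by auto
        then show ?thesis using e2(2)[of w] d(3)[of w] e1(2) by (auto simp: \<psi>_def)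
      qed
      then show ?thesis using W(1,2) openin_subset[OF W(1)] by (auto simp: eventually_nhdsin \<gamma>_def)
    qed
    then show "\<forall>\<^sub>F s in at t within {0..1}. \<forall>\<^sub>F q in nhdsin TX (\<gamma> s). \<psi> s q = \<psi> t q"
      unfolding eventually_at using d(1) c by (intro exI[of _ "d / c"]) auto
  qed
  moreover have "dilation_germ TX (\<gamma> 0) (\<psi> 1) (a' / a) (\<psi> 0)"
    unfolding dilation_germ_def \<psi>_def using apos neq
    by (intro conjI exI[of _ "(b' - b) / of_real a"])
      (auto simp: p01 Cf_def Ca_def Cb_def C'_def field_simps)
  ultimately have ratio: "dilation_ratio X \<gamma> (a' / a)" unfolding dilation_ratio_def by blast
  have "a' / a < 1" using apos less by simp
  then have "hyperbolic X \<gamma>" "contracting X \<gamma>"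
    unfolding hyperbolic_def contracting_def using ratio by force+
  then show ?thesis unfolding hyperbolic_directions_def using cg by (auto simp: v_def)
qed

end

section \<open>Rays in the maximal domain\<close>

text \<open>\<open>Im (cnj u * v)\<close> is the determinant of the pair \<open>u\<close>,
  \<open>v\<close>, which vanishes only for parallel vectors.\<close>

lemma oblique_determinant:
  fixes u v :: complex
  assumes "norm u = 1" "norm v = 1" "v \<noteq> u" "v \<noteq> - u"
  shows "Im (cnj u * v) \<noteq> 0"
proof
  assume im: "Im (cnj u * v) = 0"
  define x where "x = cnj u * v"
  have "Im x = 0" using im by (simp add: x_def)
  moreover have "norm x = 1" using assms by (simp add: x_def norm_mult)
  ultimately have "\<bar>Re x\<bar> = 1" by (simp add: norm_complex_def)
  with \<open>Im x = 0\<close> have "x = 1 \<or> x = - 1" by (auto simp: complex_eq_iff abs_if split: if_splits)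
  moreover have "v = u * x"
  proof -
    have "u * x = (u * cnj u) * v" by (simp add: x_def mult.assoc)
    also have "u * cnj u = 1" using assms(1) by (simp add: complex_norm_square[symmetric])
    finally show ?thesis by simp
  qed
  ultimately show False using assms by auto
qed

text \<open>Cramer's rule for the basis \<open>u\<close>, \<open>v\<close>.\<close>

lemma oblique_decomposition:
  fixes u v d :: complex
  assumes "Im (cnj u * v) \<noteq> 0"
  shows "d = of_real (Im (cnj d * v) / Im (cnj u * v)) * u + of_real (Im (cnj u * d) / Im (cnj u * v)) * v"
proof -
  define \<Delta> where "\<Delta> = Im (cnj u * v)"
  have "\<Delta> \<noteq> 0" unfolding \<Delta>_def by (rule assms)
  have "of_real \<Delta> * d = of_real (Im (cnj d * v)) * u + of_real (Im (cnj u * d)) * v"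
    by (simp add: \<Delta>_def complex_eq_iff algebra_simps)
  then have "d = (of_real (Im (cnj d * v)) * u + of_real (Im (cnj u * d)) * v) / of_real \<Delta>"
    using \<open>\<Delta> \<noteq> 0\<close> by (simp add: nonzero_eq_divide_eq mult.commute)
  then show ?thesis unfolding \<Delta>_def by (simp add: add_divide_distrib)
qed

lemma oblique_coordinates:
  fixes u v :: complex
  assumes "norm u = 1" "norm v = 1" "v \<noteq> u" "v \<noteq> - u"
  obtains C where "C > 0"
    "\<And>d. \<exists>\<tau> \<sigma>. d = of_real \<tau> * u + of_real \<sigma> * v \<and> \<bar>\<tau>\<bar> \<le> C * norm d \<and> \<bar>\<sigma>\<bar> \<le> C * norm d"
proof -
  define \<Delta> where "\<Delta> = Im (cnj u * v)"
  have "\<Delta> \<noteq> 0" using oblique_determinant[OF assms] by (simp add: \<Delta>_def)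
  show ?thesis
  proof (rule that[of "1 / \<bar>\<Delta>\<bar>"])
    show "1 / \<bar>\<Delta>\<bar> > 0" using \<open>\<Delta> \<noteq> 0\<close> by simp
    fix d :: complex
    have "\<bar>Im (cnj d * v) / \<Delta>\<bar> \<le> 1 / \<bar>\<Delta>\<bar> * norm d"
      using abs_Im_le_cmod[of "cnj d * v"] assms(2) by (simp add: norm_mult divide_right_mono)
    moreover have "\<bar>Im (cnj u * d) / \<Delta>\<bar> \<le> 1 / \<bar>\<Delta>\<bar> * norm d"
      using abs_Im_le_cmod[of "cnj u * d"] assms(1) by (simp add: norm_mult divide_right_mono)
    ultimately show "\<exists>\<tau> \<sigma>. d = of_real \<tau> * u + of_real \<sigma> * v \<and> \<bar>\<tau>\<bar> \<le> 1 / \<bar>\<Delta>\<bar> * norm d \<and> \<bar>\<sigma>\<bar> \<le> 1 / \<bar>\<Delta>\<bar> * norm d"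
      using oblique_decomposition[of u v d] \<open>\<Delta> \<noteq> 0\<close> unfolding \<Delta>_def by blast
  qed
qed

lemma real_sequence_choice:
  fixes P :: "real \<Rightarrow> bool"
  assumes "\<exists>x. P x" "\<And>x. P x \<Longrightarrow> \<exists>y. P y \<and> Q x y"
  obtains t :: "nat \<Rightarrow> real" where "\<And>n. P (t n)" "\<And>n. Q (t n) (t (Suc n))"
proof -
  have "\<exists>f. \<forall>n. P (f n) \<and> Q (f n) (f (Suc n))"
    using dependent_nat_choice[of "\<lambda>_. P" "\<lambda>_. Q"] assms by simp
  then show ?thesis using that by auto
qed

lemma dist_ray:
  fixes v :: complex
  assumes "norm v = 1"
  shows "dist (of_real s * v) (of_real t * v) = \<bar>s - t\<bar>"
proof -
  have "of_real s * v - of_real t * v = of_real (s - t) * v" by (simp add: algebra_simps)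
  then show ?thesis using assms by (simp only: dist_norm norm_mult norm_of_real) simp
qed

lemma ball_subset_double:
  fixes x y :: "'a::metric_space"
  assumes "dist x y < r"
  shows "ball x r \<subseteq> ball y (2 * r)"
proof
  fix z assume "z \<in> ball x r"
  then show "z \<in> ball y (2 * r)" using assms dist_triangle[of y z x] by (simp add: dist_commute)
qed

lemma balls_disjoint:
  fixes x y :: "'a::metric_space"
  assumes "r + s \<le> dist x y"
  shows "ball x r \<inter> ball y s = {}"
proof (rule ccontr)
  assume "ball x r \<inter> ball y s \<noteq> {}"
  then obtain z where "dist x z < r" "dist y z < s" by auto
  then show False using assms dist_triangle[of x y z] by (simp add: dist_commute)
qed

context dilation_surf
begin

text \<open>The interval has no last element because the singularity is a limit and not a point of
  the ray. Whether it is bounded is left open here; the local structure at cone points decides it.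
  The scale of \<open>g\<close> at its starting point is left free too.\<close>

definition singular_ray :: "complex \<Rightarrow> 'a \<Rightarrow> bool" where
  "singular_ray v p \<longleftrightarrow> (\<exists>I g s. is_interval I \<and> 0 \<in> I \<and> I \<subseteq> {0..} \<and> (\<forall>t\<in>I. \<exists>t'\<in>I. t < t') \<and>
     developing X ((\<lambda>t. of_real t * v) ` I) g \<and> g 0 = p \<and> s \<in> sings X \<and>
     (\<forall>W. openin TX W \<longrightarrow> s \<in> W \<longrightarrow> (\<exists>t0\<in>I. \<forall>t\<in>I. t0 \<le> t \<longrightarrow> g (of_real t * v) \<in> W)))"

lemma singular_rayE:
  assumes "singular_ray v p"
  obtains I g s where "is_interval I" "0 \<in> I" "I \<subseteq> {0..}" "\<forall>t\<in>I. \<exists>t'\<in>I. t < t'"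
    "developing X ((\<lambda>t. of_real t * v) ` I) g" "g 0 = p" "s \<in> sings X"
    "\<forall>W. openin TX W \<longrightarrow> s \<in> W \<longrightarrow> (\<exists>t0\<in>I. \<forall>t\<in>I. t0 \<le> t \<longrightarrow> g (of_real t * v) \<in> W)"
  using assms unfolding singular_ray_def by (elim exE conjE) (rule that)

end

context crossing_domain
begin

text \<open>The interval \<open>I\<close> may be bounded or not, so that both a ray running up to an
  unreached point and an infinite ray are covered. The radius \<open>2 * r\<close> leaves room for
  discs of radius \<open>r\<close> around images close to \<open>q\<close>.\<close>

lemma ray_accumulation:
  assumes v: "norm v = 1" and I: "is_interval I" "0 \<in> I" "I \<subseteq> {0..}" "\<And>t. t \<in> I \<Longrightarrow> \<exists>t'\<in>I. t < t'"
    and D: "\<And>t. t \<in> I \<Longrightarrow> of_real t * v \<in> D" and ns: "\<not> singular_ray v (E0 0)"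
  obtains U f q r a b where "(U, f) \<in> atlas X" "q \<in> U" "r > 0" "ball (f q) (2 * r) \<subseteq> f ` U"
    "\<And>t0 \<epsilon>. t0 \<in> I \<Longrightarrow> \<epsilon> > 0 \<Longrightarrow> \<exists>t\<in>I. t0 \<le> t \<and> E (of_real t * v) \<in> U \<and> dist (f (E (of_real t * v))) (f q) < \<epsilon>"
    "\<And>t. t \<in> I \<Longrightarrow> E (of_real t * v) \<in> U \<Longrightarrow> dev_at X D E (of_real t * v) U f (a t) (b t)"
proof -
  have "trajectory X I (\<lambda>t. E (0 + of_real (1 * t) * v)) v"
    by (rule developing_trajectory[OF dev_D I(1) v]) (use D in auto)
  then have cont: "continuous_map (top_of_set I) TX (\<lambda>t. E (of_real t * v))"
    unfolding trajectory_def by (auto simp: continuous_map_in_subtopology)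
  have "I \<noteq> {}" using I(2) by auto
  show ?thesis
  proof (rule limit_cases[OF I(1) \<open>I \<noteq> {}\<close> cont])
    fix s assume singular: "s \<in> sings X"
      "\<And>W. openin TX W \<Longrightarrow> s \<in> W \<Longrightarrow> \<exists>t0\<in>I. \<forall>t\<in>I. t0 \<le> t \<longrightarrow> E (of_real t * v) \<in> W"
    have "singular_ray v (E0 0)" unfolding singular_ray_def
    proof (intro exI[of _ I] exI[of _ E] exI[of _ s] conjI)
      show "developing X ((\<lambda>t. of_real t * v) ` I) E"
        by (rule developing_mono[OF dev_D]) (use D in auto)
      show "E 0 = E0 0" using E_eq \<delta> by simp
    qed (use I singular in auto)
    then show ?thesis using ns by simp
  next
    fix q assume regular: "q \<in> regular_part X"
      "\<And>W t0. openin TX W \<Longrightarrow> q \<in> W \<Longrightarrow> t0 \<in> I \<Longrightarrow> \<exists>t\<in>I. t0 \<le> t \<and> E (of_real t * v) \<in> W"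
    obtain U f where U: "(U, f) \<in> atlas X" "q \<in> U" using chart_exists[OF regular(1)] by blast
    obtain r' where r': "r' > 0" "ball (f q) r' \<subseteq> f ` U"
      using openE[OF chart_image_open[OF U(1)]] U(2) by (metis imageI)
    have "\<exists>a b. E (of_real t * v) \<in> U \<longrightarrow> dev_at X D E (of_real t * v) U f a b" if "t \<in> I" for t
      using developing_chart[OF dev_D D[OF that] U(1)] by metis
    then obtain a b where ab: "\<And>t. t \<in> I \<Longrightarrow> E (of_real t * v) \<in> U \<Longrightarrow> dev_at X D E (of_real t * v) U f (a t) (b t)"
      by metis
    show ?thesis
    proof (rule that[of U f q "r' / 2" a b])
      fix t0 \<epsilon> :: real assume t0: "t0 \<in> I" and e: "\<epsilon> > 0"
      have "openin TX {x \<in> U. f x \<in> ball (f q) \<epsilon>}" by (rule chart_preimage[OF U(1) open_ball])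
      from regular(2)[OF this _ t0] U(2) e
      show "\<exists>t\<in>I. t0 \<le> t \<and> E (of_real t * v) \<in> U \<and> dist (f (E (of_real t * v))) (f q) < \<epsilon>"
        by (auto simp: dist_commute)
    qed (use U r' ab in auto)
  qed
qed

text \<open>The unreached point \<open>z\<close> is found as a nearest point of the complement of
  \<open>D\<close> at the first time the ray comes within \<open>\<rho>\<close> of it. Its direction
  \<open>v\<close> may differ from \<open>v0\<close>, which is why the hypothesis covers a
  neighbourhood. The gain is a whole tube around the earlier part of the ray, hence a cone of discs
  in \<open>D\<close> with apex \<open>z\<close>.\<close>

lemma ray_in_domain:
  assumes v0: "norm v0 = 1" and \<eta>: "\<eta> > 0"
    and good: "\<And>v. norm v = 1 \<Longrightarrow> norm (v - v0) < \<eta> \<Longrightarrow> v \<noteq> u \<and> v \<noteq> - u \<and> \<not> singular_ray v (E0 0)"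
    and r0: "0 \<le> r0"
  shows "of_real r0 * v0 \<in> D"
proof (rule ccontr)
  assume r0D: "of_real r0 * v0 \<notin> D"
  define Q where "Q = - D"
  have Q: "closed Q" "Q \<noteq> {}" using open_D r0D by (auto simp: Q_def)
  \<comment> \<open>Since \<open>R \<ge> \<delta>\<close>, the bound
    \<open>4 * \<rho> \<le> \<delta>\<close> gives \<open>\<rho> / R \<le> 1 / 4\<close>, and
    \<open>4 * \<rho> \<le> \<delta> * \<eta>\<close> keeps the direction of \<open>z\<close> within
    \<open>\<eta>\<close> of \<open>v0\<close>.\<close>
  define \<rho> where "\<rho> = \<delta> * min 1 \<eta> / 4"
  have \<rho>: "\<rho> > 0" "4 * \<rho> \<le> \<delta>" "4 * \<rho> \<le> \<delta> * \<eta>" using \<delta> \<eta> by (auto simp: \<rho>_def min_def)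
  define K where "K = {s \<in> {0..r0}. infdist (of_real s * v0) Q \<le> \<rho>}"
  have "closed {s. infdist (of_real s * v0) Q \<le> \<rho>}"
    by (intro closed_Collect_le continuous_intros)
  then have "compact ({0..r0} \<inter> {s. infdist (of_real s * v0) Q \<le> \<rho>})"
    by (intro compact_Int_closed compact_Icc)
  then have "compact K" unfolding K_def by (simp add: Int_def)
  moreover have "r0 \<in> K" using r0D r0 \<rho> Q by (auto simp: K_def Q_def)
  ultimately obtain s where s: "s \<in> K" "\<And>s'. s' \<in> K \<Longrightarrow> s \<le> s'"
    using compact_attains_inf[of K] by auto
  obtain z where z: "z \<in> Q" "infdist (of_real s * v0) Q = dist (of_real s * v0) z"
    using infdist_attains_inf[OF Q] by blast
  define R where "R = norm z"
  have zR: "R \<ge> \<delta>" using z(1) ball_D by (force simp: Q_def R_def)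
  have R: "R > 0" using zR \<delta> by simp
  define w where "w = z - of_real s * v0"
  have w: "norm w \<le> \<rho>" using s(1) z(2) by (simp add: K_def w_def dist_norm norm_minus_commute)
  have s0: "s \<ge> 0" using s(1) by (simp add: K_def)
  have spos: "s > 0"
  proof -
    have "R \<le> s + norm w" using norm_triangle_ineq[of w "of_real s * v0"] v0 s0
      by (simp add: w_def R_def norm_mult)
    then show ?thesis using w zR \<rho> by linarith
  qed
  have tube: "of_real s' * v0 + e \<in> D" if "0 \<le> s'" "s' < s" "norm e \<le> \<rho>" for s' e
  proof (rule ccontr)
    assume "of_real s' * v0 + e \<notin> D"
    then have "infdist (of_real s' * v0) Q \<le> dist (of_real s' * v0) (of_real s' * v0 + e)"
      by (intro infdist_le) (simp add: Q_def)
    then have "s' \<in> K" using that s(1) by (simp add: K_def dist_norm)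
    then show False using s(2) that(2) by force
  qed
  define v where "v = z / of_real R"
  have v: "norm v = 1" "of_real R * v = z" using R by (auto simp: v_def R_def norm_divide)
  have "norm (v - v0) < \<eta>"
  proof -
    have "\<bar>s - R\<bar> \<le> norm w"
      using norm_triangle_ineq3[of "of_real s * v0" z] v0 s0 by (simp add: w_def R_def norm_mult norm_minus_commute)
    have "v - v0 = (w + of_real (s - R) * v0) / of_real R" using R by (simp add: v_def w_def field_simps)
    also have "norm \<dots> \<le> (norm w + \<bar>s - R\<bar>) / R"
      using norm_triangle_ineq[of w "of_real (s - R) * v0"] v0 R
      by (simp add: norm_divide norm_mult divide_right_mono del: of_real_diff)
    also have "\<dots> \<le> (2 * \<rho>) / R" using \<open>\<bar>s - R\<bar> \<le> norm w\<close> w R by (intro divide_right_mono) auto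
    also have "\<dots> < \<eta>"
    proof -
      have "\<delta> * \<eta> \<le> R * \<eta>" using zR \<eta> by simp
      then show ?thesis using \<rho> R by (simp add: pos_divide_less_eq mult.commute)
    qed
    finally show ?thesis .
  qed
  note good_v = good[OF v(1) this]
  \<comment> \<open>With \<open>l = t / R\<close>, the point \<open>l z\<close> is
    \<open>l s v0\<close> shifted by \<open>l w\<close>; of the width \<open>\<rho>\<close> of the
    tube this uses at most \<open>l \<rho>\<close>, which leaves
    \<open>\<rho> (1 - l)\<close>.\<close>
  have cone: "ball (of_real t * v) (\<rho> * (1 - t / R)) \<subseteq> D" if t: "0 \<le> t" "t < R" for t
  proof
    fix y assume y: "y \<in> ball (of_real t * v) (\<rho> * (1 - t / R))"
    define l where "l = t / R"
    have l: "0 \<le> l" "l < 1" using t R by (auto simp: l_def)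
    define e where "e = y - of_real l * z"
    have "of_real t * v = of_real l * z" using R by (simp add: l_def v_def)
    then have "norm e < \<rho> * (1 - l)" using y by (simp add: e_def dist_norm norm_minus_commute l_def)
    moreover have "norm (of_real l * w) \<le> l * \<rho>" using w l by (simp add: norm_mult mult_left_mono)
    ultimately have "norm (of_real l * w + e) \<le> \<rho>"
      using norm_triangle_ineq[of "of_real l * w" e] by (simp add: algebra_simps)
    moreover have "y = of_real (l * s) * v0 + (of_real l * w + e)" by (simp add: e_def w_def algebra_simps)
    moreover have "0 \<le> l * s" "l * s < s" using l spos by auto
    ultimately show "y \<in> D" using tube by metis
  qed
  have vD: "of_real t * v \<in> D" if "0 \<le> t" "t < R" for t
  proof -
    have "\<rho> * (1 - t / R) > 0" using that R \<rho> by simp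
    then show ?thesis using cone[OF that] by (meson centre_in_ball subsetD)
  qed
  have I: "is_interval {0..<R}" "0 \<in> {0..<R}" "{0..<R} \<subseteq> {0..}"
    using R by (auto simp: is_interval_co)
  have I': "\<exists>t'\<in>{0..<R}. t < t'" if "t \<in> {0..<R}" for t
    using that by (intro bexI[of _ "(t + R) / 2"]) auto
  have vD': "of_real t * v \<in> D" if "t \<in> {0..<R}" for t using that vD by auto
  obtain U f q r a b where U: "(U, f) \<in> atlas X" "q \<in> U" and r: "r > 0" "ball (f q) (2 * r) \<subseteq> f ` U"
    and visit: "\<And>t0 \<epsilon>. t0 \<in> {0..<R} \<Longrightarrow> \<epsilon> > 0 \<Longrightarrow>
      \<exists>t\<in>{0..<R}. t0 \<le> t \<and> E (of_real t * v) \<in> U \<and> dist (f (E (of_real t * v))) (f q) < \<epsilon>"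
    and ab: "\<And>t. t \<in> {0..<R} \<Longrightarrow> E (of_real t * v) \<in> U \<Longrightarrow> dev_at X D E (of_real t * v) U f (a t) (b t)"
    by (rule ray_accumulation[OF v(1) I I' vD' good_v[THEN conjunct2, THEN conjunct2]]; (assumption | rule that))
  obtain C where C: "C > 0"
    "\<And>d. \<exists>\<tau> \<sigma>. d = of_real \<tau> * u + of_real \<sigma> * v \<and> \<bar>\<tau>\<bar> \<le> C * norm d \<and> \<bar>\<sigma>\<bar> \<le> C * norm d"
    using oblique_coordinates[OF norm_u v(1)] good_v by metis
  \<comment> \<open>Once \<open>a (R - t) \<ge> r\<close> is known, this value gives
    \<open>c / a \<le> \<rho> / R * (R - t)\<close>, the radius available in the cone.\<close>
  define c where "c = r * (\<rho> / R)"
  have \<rho>R: "\<rho> / R \<le> 1 / 4" using \<rho> zR R by (simp add: field_simps)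
  have c: "c > 0" "c \<le> r / 4"
    using r(1) \<rho>(1) R mult_left_mono[OF \<rho>R, of r] by (auto simp: c_def)
  \<comment> \<open>So late that \<open>C\<close> times the disc radius is below both
    \<open>\<delta> / 4\<close> and the elapsed time, as \<open>too_many_visits\<close>
    demands.\<close>
  define good_time where "good_time t \<longleftrightarrow> R - min (R / 2) (min (\<delta> / 8) (R / 4) / (C * (\<rho> / R))) \<le> t \<and> t \<in> {0..<R} \<and>
     E (of_real t * v) \<in> U \<and> dist (f (E (of_real t * v))) (f q) < c / 2" for t
  have later: "\<exists>t. good_time t \<and> t0 \<le> t" if "t0 < R" for t0
  proof -
    define m where "m = min (R / 2) (min (\<delta> / 8) (R / 4) / (C * (\<rho> / R)))"
    have "m > 0" using R \<delta> C(1) \<rho>(1) by (auto simp: m_def)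
    then have "max t0 (max 0 (R - m)) \<in> {0..<R}" using that R by auto
    from visit[OF this, of "c / 2"] c show ?thesis by (auto simp: good_time_def m_def)
  qed
  \<comment> \<open>The distance to \<open>z\<close> shrinks by a factor 4 at each step while the
    disc radii are at most a quarter of it, so the discs are disjoint.\<close>
  obtain t where t: "\<And>n. good_time (t n)" "\<And>n. R - (R - t n) / 4 \<le> t (Suc n)"
  proof (rule real_sequence_choice[of good_time "\<lambda>x y. R - (R - x) / 4 \<le> y"])
    show "\<exists>x. good_time x" using later[of 0] R by auto
    show "\<exists>y. good_time y \<and> R - (R - x) / 4 \<le> y" if "good_time x" for x
      using that by (intro later) (auto simp: good_time_def)
  qed (use that in blast)
  have tR: "0 \<le> t n" "t n < R" and tU: "E (of_real (t n) * v) \<in> U"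
    and tq: "dist (f (E (of_real (t n) * v))) (f q) < c / 2" for n
    using t(1)[of n] by (auto simp: good_time_def)
  have tm: "R - t n \<le> R / 2" "C * (\<rho> / R) * (R - t n) \<le> \<delta> / 8" "C * (\<rho> / R) * (R - t n) \<le> R / 4" for n
  proof -
    have "R - t n \<le> min (R / 2) (min (\<delta> / 8) (R / 4) / (C * (\<rho> / R)))"
      using t(1)[of n, unfolded good_time_def] by linarith
    then have *: "R - t n \<le> R / 2" "R - t n \<le> min (\<delta> / 8) (R / 4) / (C * (\<rho> / R))"
      by (simp_all only: min.bounded_iff)
    have p: "C * (\<rho> / R) > 0" using C \<rho> R by simp
    from * p have "C * (\<rho> / R) * (R - t n) \<le> min (\<delta> / 8) (R / 4)"
      by (metis mult.commute pos_le_divide_eq)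
    then show "R - t n \<le> R / 2" "C * (\<rho> / R) * (R - t n) \<le> \<delta> / 8" "C * (\<rho> / R) * (R - t n) \<le> R / 4"
      using * by auto
  qed
  have at: "dev_at X D E (of_real (t n) * v) U f (a (t n)) (b (t n))" for n
    using ab tU tR by auto
  have apos: "a (t n) > 0" for n using at by (auto simp: dev_at_def)
  have ballU: "ball (f (E (of_real (t n) * v))) r \<subseteq> f ` U" for n
  proof -
    have "dist (f (E (of_real (t n) * v))) (f q) < r" using tq[of n] c r by linarith
    from ball_subset_double[OF this] show ?thesis using r(2) by blast
  qed
  \<comment> \<open>Otherwise the chart at \<open>q\<close> would continue \<open>E\<close> beyond \<open>z\<close>.\<close>
  have a_large: "r \<le> a (t n) * (R - t n)" for n
  proof (rule ccontr)
    assume "\<not> ?thesis"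
    then have less: "R - t n < r / a (t n)" using apos[of n] by (simp add: pos_less_divide_eq mult.commute)
    have "of_real R * v \<in> D"
    proof (rule extend[OF vD at])
      show "ball (of_real (a (t n)) * (of_real (t n) * v) + b (t n)) r \<subseteq> f ` U"
        using ballU[of n] dev_at_value[OF at vD[OF tR]] by simp
      show "dist (of_real R * v) (of_real (t n) * v) < r / a (t n)"
        unfolding dist_ray[OF v(1)] using less tR[of n] by simp
      have "of_real (t n) * v = (t n / R) *\<^sub>R (of_real R * v)" using R by (simp add: scaleR_conv_of_real)
      then show "of_real (t n) * v \<in> closed_segment 0 (of_real R * v)"
        unfolding in_segment using tR[of n] R by (intro exI[of _ "t n / R"]) auto
    qed (use tR in auto)
    then show False using z(1) v(2) by (simp add: Q_def)
  qed
  have radius: "c / a (t n) \<le> \<rho> / R * (R - t n)" for n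
  proof -
    have "c \<le> \<rho> / R * (a (t n) * (R - t n))"
      unfolding c_def mult.commute[of r] using a_large[of n] \<rho> R by (intro mult_left_mono) auto
    then show ?thesis using apos[of n] by (simp add: pos_divide_le_eq mult_ac)
  qed
  have decr: "R - t j \<le> (R - t i) / 4" if "i < j" for i j
    using that
  proof (induction rule: strict_inc_induct)
    case (base i)
    then have j: "j = Suc i" by simp
    show ?case unfolding j using t(2)[of i] by linarith
  next
    case (step i)
    have "R - t (Suc i) \<le> (R - t i) / 4" using t(2)[of i] by linarith
    also have "\<dots> \<le> R - t i" using tR[of i] by simp
    finally have "(R - t (Suc i)) / 4 \<le> (R - t i) / 4" by (intro divide_right_mono) auto
    with step(2) show ?case by (rule order_trans)
  qed
  have quarter: "\<rho> / R * (R - t n) \<le> (R - t n) / 4" for n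
    using mult_right_mono[OF \<rho>R, of "R - t n"] tR[of n] by simp
  have aux: "x + y \<le> \<bar>p - q\<bar>"
    if "x \<le> (R - p) / 4" "y \<le> (R - q) / 4" "R - q \<le> (R - p) / 4" "p < R" "q < R" for x y p q
    using that by (simp add: abs_if)
  have disj: "ball (of_real (t i) * v) (c / a (t i)) \<inter> ball (of_real (t j) * v) (c / a (t j)) = {}"
    if "i < j" for i j
  proof (rule balls_disjoint)
    have "c / a (t i) \<le> (R - t i) / 4" "c / a (t j) \<le> (R - t j) / 4"
      using radius[of i] radius[of j] quarter[of i] quarter[of j] by linarith+
    then show "c / a (t i) + c / a (t j) \<le> dist (of_real (t i) * v) (of_real (t j) * v)"
      unfolding dist_ray[OF v(1)] using decr[OF that] tR[of i] tR[of j] by (intro aux)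
  qed
  have C_rad: "C * (c / a (t n)) \<le> C * (\<rho> / R) * (R - t n)" for n
    using mult_left_mono[OF radius[of n], of C] C by (simp add: mult.assoc)
  show False
  proof (rule too_many_visits[OF v(1) _ _ C(2,1) at, where c = c])
    show "v \<noteq> u" "v \<noteq> - u" using good_v by auto
    show "c > 0" by (rule c)
    fix i assume "i \<le> k"
    show "C * (c / a (t i)) < \<delta> / 4" using C_rad[of i] tm(2)[of i] \<delta> by linarith
    show "C * (c / a (t i)) < t i" using C_rad[of i] tm(1,3)[of i] R by linarith
    show "dist (f (E (of_real (t i) * v))) (f (E (of_real (t 0) * v))) < c"
      using dist_triangle_half_l[of "f (E (of_real (t i) * v))" "f q" c] tq[of i] tq[of 0]
      by (meson dist_triangle_half_l)
    show "ball (f (E (of_real (t i) * v))) c \<subseteq> f ` U"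
      using subset_ball[of c r] ballU[of i] c r by fastforce
    fix s' assume s': "0 \<le> s'" "s' \<le> t i"
    have "\<rho> / R * (R - t i) \<le> \<rho> / R * (R - s')" using s' \<rho> R by (intro mult_left_mono) auto
    then have "c / a (t i) \<le> \<rho> * (1 - s' / R)" using radius[of i] R by (simp add: field_simps)
    then show "ball (of_real s' * v) (c / a (t i)) \<subseteq> D"
      using cone[of s'] s' tR[of i] by (meson subset_ball order_trans order_le_less_trans)
  next
    fix i j assume "i \<le> k" "j \<le> k" "i \<noteq> j"
    then show "ball (of_real (t i) * v) (c / a (t i)) \<inter> ball (of_real (t j) * v) (c / a (t j)) = {}"
      using disj[of i j] disj[of j i] by (cases "i < j") auto
  qed
qed

end

section \<open>Closed geodesics from a sector\<close>

text \<open>An open cone around the ray, written as a union of discs so that openness and convexity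
  need no angles.\<close>

definition sector :: "complex \<Rightarrow> real \<Rightarrow> complex set" where
  "sector v \<kappa> = {z. \<exists>t>0. norm (z - of_real t * v) < \<kappa> * t}"

lemma open_sector: "open (sector v \<kappa>)"
proof -
  have "sector v \<kappa> = (\<Union>t\<in>{0<..}. ball (of_real t * v) (\<kappa> * t))"
    by (auto simp: sector_def dist_norm norm_minus_commute)
  then show ?thesis by auto
qed

lemma convex_sector: "convex (sector v \<kappa>)"
  unfolding convex_def
proof (intro ballI allI impI)
  fix x y a b assume x: "x \<in> sector v \<kappa>" and y: "y \<in> sector v \<kappa>" and ab: "0 \<le> a" "0 \<le> b" "a + b = (1::real)"
  obtain s t where s: "s > 0" "norm (x - of_real s * v) < \<kappa> * s" and t: "t > 0" "norm (y - of_real t * v) < \<kappa> * t"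
    using x y by (auto simp: sector_def)
  have "a * s + b * t > 0"
    using ab s t by (cases "a = 0") (auto intro: add_pos_nonneg)
  moreover have "norm (a *\<^sub>R x + b *\<^sub>R y - of_real (a * s + b * t) * v) < \<kappa> * (a * s + b * t)"
  proof -
    have eq: "a *\<^sub>R x + b *\<^sub>R y - of_real (a * s + b * t) * v = a *\<^sub>R (x - of_real s * v) + b *\<^sub>R (y - of_real t * v)"
      by (simp add: scaleR_conv_of_real algebra_simps)
    have "norm (a *\<^sub>R (x - of_real s * v) + b *\<^sub>R (y - of_real t * v)) \<le>
        a * norm (x - of_real s * v) + b * norm (y - of_real t * v)"
      using norm_triangle_ineq[of "a *\<^sub>R (x - of_real s * v)" "b *\<^sub>R (y - of_real t * v)"] ab by simp
    also have "\<dots> < a * (\<kappa> * s) + b * (\<kappa> * t)"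
    proof (cases "a = 0")
      case True
      then show ?thesis using ab t by simp
    next
      case False
      then have "a * norm (x - of_real s * v) < a * (\<kappa> * s)" using ab s by simp
      moreover have "b * norm (y - of_real t * v) \<le> b * (\<kappa> * t)" using ab t by (intro mult_left_mono) auto
      ultimately show ?thesis by simp
    qed
    finally show ?thesis unfolding eq by (simp add: algebra_simps)
  qed
  ultimately show "a *\<^sub>R x + b *\<^sub>R y \<in> sector v \<kappa>" unfolding sector_def by blast
qed

lemma sector_direction:
  assumes v: "norm v = 1" and z: "z \<in> sector v \<kappa>" and \<kappa>: "\<kappa> \<le> 1 / 2"
  shows "z \<noteq> 0" and "norm (z / of_real (norm z) - v) < 4 * \<kappa>"
proof -
  obtain t where t: "t > 0" "norm (z - of_real t * v) < \<kappa> * t" using z by (auto simp: sector_def)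
  have diff: "\<bar>norm z - t\<bar> \<le> norm (z - of_real t * v)"
    using norm_triangle_ineq3[of z "of_real t * v"] v t by (simp add: norm_mult)
  have "\<kappa> * t \<le> t / 2" using mult_right_mono[OF \<kappa>, of t] t(1) by simp
  then have big: "t / 2 < norm z" using diff t by linarith
  then have pos: "norm z > 0" using t(1) by linarith
  then show "z \<noteq> 0" by auto
  have eq: "z / of_real (norm z) - v = ((z - of_real t * v) + of_real (t - norm z) * v) / of_real (norm z)"
    using pos by (simp add: field_simps)
  have "norm (z / of_real (norm z) - v) \<le> (norm (z - of_real t * v) + \<bar>t - norm z\<bar>) / norm z"
    unfolding eq using norm_triangle_ineq[of "z - of_real t * v" "of_real (t - norm z) * v"] v
    by (simp add: norm_divide norm_mult divide_right_mono del: of_real_diff)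
  also have "\<dots> < (2 * (\<kappa> * t)) / norm z"
    using diff t(2) pos by (intro divide_strict_right_mono) linarith+
  also have "\<dots> \<le> 4 * \<kappa>"
  proof -
    have "\<kappa> > 0" using t norm_ge_zero[of "z - of_real t * v"] by (smt (verit) mult_nonpos_nonneg)
    then have "\<kappa> * t \<le> \<kappa> * (2 * norm z)" using big by (intro mult_left_mono) auto
    then show ?thesis using pos by (simp add: pos_divide_le_eq)
  qed
  finally show "norm (z / of_real (norm z) - v) < 4 * \<kappa>" .
qed

context crossing_domain
begin

text \<open>Two opposite estimates on the slopes at times when the ray is close to \<open>q\<close>:
  \<open>a t\<close> tends to 0, which makes the later slope smaller and the geodesic contracting,
  while \<open>a t * t\<close> stays bounded below, so that the correction from \<open>xn\<close> to
  \<open>y\<close> is a small fraction of \<open>n\<close> and does not spoil the direction.\<close>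

lemma hyperbolic_direction_near:
  assumes v0: "norm v0 = 1" "v0 \<noteq> u" "v0 \<noteq> - u" and \<eta>: "\<eta> > 0"
    and D: "\<And>v r. norm v = 1 \<Longrightarrow> norm (v - v0) < \<eta> \<Longrightarrow> 0 \<le> r \<Longrightarrow> of_real r * v \<in> D"
    and ns: "\<not> singular_ray v0 (E0 0)"
  obtains v where "norm v = 1" "norm (v - v0) < \<eta>" "- v \<in> hyperbolic_directions X"
proof -
  define \<kappa> where "\<kappa> = min (1 / 2) (\<eta> / 4)"
  have \<kappa>: "\<kappa> > 0" "\<kappa> \<le> 1 / 2" "4 * \<kappa> \<le> \<eta>" using \<eta> by (auto simp: \<kappa>_def)
  define S where "S = sector v0 \<kappa>"
  have S_dir: "z \<noteq> 0" "norm (z / of_real (norm z) - v0) < \<eta>" if "z \<in> S" for z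
    using sector_direction[OF v0(1) _ \<kappa>(2), of z] that \<kappa>(3) by (auto simp: S_def)
  have S_D: "S \<subseteq> D"
  proof
    fix z assume z: "z \<in> S"
    have "of_real (norm z) * (z / of_real (norm z)) \<in> D"
      using S_dir[OF z] by (intro D) (auto simp: norm_divide)
    then show "z \<in> D" using S_dir[OF z] by simp
  qed
  have S_ball: "ball (of_real t * v0) m \<subseteq> S" if "t > 0" "m \<le> \<kappa> * t" for t m
    using that by (force simp: S_def sector_def dist_norm norm_minus_commute)
  have rayS: "of_real t * v0 \<in> S" if "t > 0" for t
    using that \<kappa> by (force simp: S_def sector_def intro!: exI[of _ t])
  have rayD: "of_real t * v0 \<in> D" if "t \<in> {0..}" for t
    using that D[OF v0(1)] \<eta> by simp
  define \<rho> where "\<rho> = \<delta> * \<kappa> / 4"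
  have \<rho>: "\<rho> > 0" using \<delta> \<kappa> by (simp add: \<rho>_def)
  \<comment> \<open>A tube of constant width along the entire ray: the base disc provides it near 0,
    the sector farther out.\<close>
  have tube: "ball (of_real s * v0) \<rho> \<subseteq> D" if "s \<ge> 0" for s
  proof (cases "\<rho> \<le> \<kappa> * s")
    case True
    then have "s > 0" using \<rho> that by (cases "s = 0") auto
    then show ?thesis using S_ball[OF _ True] S_D by blast
  next
    case False
    then have "s < \<delta> / 4" using \<kappa>(1) by (simp add: \<rho>_def)
    moreover have "\<rho> \<le> \<delta> / 8" using \<kappa>(2) \<delta> by (simp add: \<rho>_def)
    ultimately have le: "s + \<rho> \<le> \<delta>" using \<delta> by linarith
    have "ball (of_real s * v0) \<rho> \<subseteq> ball 0 \<delta>"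
    proof
      fix z assume "z \<in> ball (of_real s * v0) \<rho>"
      then show "z \<in> ball 0 \<delta>"
        using dist_triangle[of 0 z "of_real s * v0"] le that v0(1) by (simp add: norm_mult)
    qed
    then show ?thesis using ball_D by blast
  qed
  have I: "is_interval {0::real..}" "0 \<in> {0::real..}" "{0::real..} \<subseteq> {0..}" by (auto simp: is_interval_ci)
  have I': "\<exists>t'\<in>{0::real..}. t < t'" if "t \<in> {0..}" for t
    using that by (intro bexI[of _ "t + 1"]) auto
  obtain U f q r a b where U: "(U, f) \<in> atlas X" "q \<in> U" and r: "r > 0" "ball (f q) (2 * r) \<subseteq> f ` U"
    and visit: "\<And>t0 \<epsilon>. t0 \<in> {0..} \<Longrightarrow> \<epsilon> > 0 \<Longrightarrow>
      \<exists>t\<in>{0..}. t0 \<le> t \<and> E (of_real t * v0) \<in> U \<and> dist (f (E (of_real t * v0))) (f q) < \<epsilon>"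
    and ab: "\<And>t. t \<in> {0..} \<Longrightarrow> E (of_real t * v0) \<in> U \<Longrightarrow> dev_at X D E (of_real t * v0) U f (a t) (b t)"
    by (rule ray_accumulation[OF v0(1) I I' rayD ns]; (assumption | rule that))
  define near where "near \<epsilon> t \<longleftrightarrow> \<delta> \<le> t \<and> E (of_real t * v0) \<in> U \<and> dist (f (E (of_real t * v0))) (f q) < \<epsilon>" for \<epsilon> t
  have near_later: "\<exists>t. near \<epsilon> t \<and> t0 \<le> t" if "\<epsilon> > 0" for \<epsilon> t0
  proof -
    have "max t0 \<delta> \<in> {0..}" using \<delta> by simp
    from visit[OF this that] show ?thesis by (auto simp: near_def)
  qed
  have near_mono: "near \<epsilon>' t" if "near \<epsilon> t" "\<epsilon> \<le> \<epsilon>'" for \<epsilon> \<epsilon>' t using that by (auto simp: near_def)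
  have near_pos: "t > 0" if "near \<epsilon> t" for \<epsilon> t using that \<delta> by (auto simp: near_def)
  have at: "dev_at X D E (of_real t * v0) U f (a t) (b t)" if "near \<epsilon> t" for \<epsilon> t
    using ab that \<delta> by (auto simp: near_def)
  have apos: "a t > 0" if "near \<epsilon> t" for \<epsilon> t using at[OF that] by (simp add: dev_at_def)
  have val: "f (E (of_real t * v0)) = of_real (a t) * (of_real t * v0) + b t" if "near \<epsilon> t" for \<epsilon> t
    using dev_at_value[OF at[OF that] rayD] near_pos[OF that] by auto
  have ballU: "ball (f (E (of_real t * v0))) r \<subseteq> f ` U" if "near r t" for t
  proof -
    have "dist (f (E (of_real t * v0))) (f q) < r" using that by (simp add: near_def)
    from ball_subset_double[OF this] show ?thesis using r(2) by blast
  qed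
  \<comment> \<open>If a chart at \<open>q\<close> is much larger than \<open>t\<close>, it contains the whole segment from \<open>0\<close> to \<open>t v0\<close>.\<close>
  have segment: "E (of_real s * v0) \<in> U \<and> dist (f (E (of_real s * v0))) (f (E (of_real t * v0))) < \<epsilon>"
    if t: "near r t" and e: "a t * t < \<epsilon>" "\<epsilon> \<le> r" and s: "0 \<le> s" "s \<le> t" for s t \<epsilon>
  proof -
    let ?L = "(\<lambda>s. of_real s * v0) ` {0..t}"
    have d: "dist (of_real (a t) * (of_real t * v0) + b t) (of_real (a t) * (of_real s * v0) + b t) < \<epsilon>"
      if "0 \<le> s" "s \<le> t" for s
    proof -
      have "dist (of_real (a t) * (of_real t * v0) + b t) (of_real (a t) * (of_real s * v0) + b t)
          = dist (of_real (a t * t) * v0) (of_real (a t * s) * v0)"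
        by (simp add: dist_norm mult.assoc)
      also have "\<dots> = a t * (t - s)"
        unfolding dist_ray[OF v0(1)] using apos[OF t] that by (simp add: right_diff_distrib[symmetric])
      also have "\<dots> \<le> a t * t" using apos[OF t] that by simp
      finally show ?thesis using e by simp
    qed
    have sub: "(\<lambda>w. of_real (a t) * w + b t) ` ?L \<subseteq> f ` U"
      using d e(2) ballU[OF t] unfolding val[OF t] by (force simp: subset_eq)
    note inv = chart_inverse(1)[OF U(1) apos[OF t] sub]
    obtain e where e': "e > 0" "\<And>w. w \<in> D \<inter> ball (of_real t * v0) e \<Longrightarrow> E w \<in> U \<and> f (E w) = of_real (a t) * w + b t"
      using at[OF t] unfolding dev_at_def by auto
    have LD: "?L \<subseteq> D" using rayD by auto
    have "E (of_real s * v0) = inv_into U f (of_real (a t) * (of_real s * v0) + b t)"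
    proof (rule developing_unique[OF _ developing_mono[OF dev_D LD] inv _ e'(1)])
      show "connected ?L" by (intro connected_continuous_image continuous_intros) auto
      show "of_real t * v0 \<in> ?L" using near_pos[OF t] by auto
      show "of_real s * v0 \<in> ?L" using s by auto
      fix w assume "w \<in> ?L \<inter> ball (of_real t * v0) e"
      then have "E w \<in> U" "f (E w) = of_real (a t) * w + b t" using e'(2) LD by auto
      then show "E w = inv_into U f (of_real (a t) * w + b t)"
        using chart_inj[OF U(1)] by (metis inv_into_f_f)
    qed
    moreover have "of_real (a t) * (of_real s * v0) + b t \<in> f ` U"
      by (rule subsetD[OF sub]) (use s in \<open>auto intro!: imageI\<close>)
    ultimately have "E (of_real s * v0) \<in> U" "f (E (of_real s * v0)) = of_real (a t) * (of_real s * v0) + b t"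
      by (auto simp: inv_into_into f_inv_into_f)
    then show ?thesis using d[OF s] val[OF t] by (simp add: dist_commute)
  qed
  \<comment> \<open>Otherwise the initial part of the ray would lie in arbitrarily small discs of
    the chart, so \<open>E 0\<close> and \<open>E (s v0)\<close> would coincide, contrary to
    injectivity of the base disc.\<close>
  have "\<exists>\<epsilon>>0. \<epsilon> \<le> r \<and> (\<forall>t. near \<epsilon> t \<longrightarrow> \<epsilon> \<le> a t * t)"
  proof (rule ccontr)
    assume contr: "\<not> ?thesis"
    have small: "\<exists>t. near \<epsilon> t \<and> a t * t < \<epsilon>" if "\<epsilon> > 0" "\<epsilon> \<le> r" for \<epsilon>
      using contr that by (metis not_le)
    define s where "s = \<delta> / 2"
    have s: "0 \<le> s" "s \<le> \<delta>" using \<delta> by (auto simp: s_def)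
    have both: "E 0 \<in> U \<and> E (of_real s * v0) \<in> U \<and> dist (f (E 0)) (f (E (of_real s * v0))) < 2 * \<epsilon>"
      if e: "\<epsilon> > 0" "\<epsilon> \<le> r" for \<epsilon>
    proof -
      obtain t where t: "near \<epsilon> t" "a t * t < \<epsilon>" using small[OF e] by blast
      have st: "s \<le> t" "0 \<le> t" using s t(1) \<delta> by (auto simp: near_def)
      have nt: "near r t" using near_mono[OF t(1) e(2)] .
      show ?thesis
        using segment[OF nt t(2) e(2), of 0] segment[OF nt t(2) e(2) s(1) st(1)] st(2)
          dist_triangle3[of "f (E 0)" "f (E (of_real s * v0))" "f (E (of_real t * v0))"]
        by (auto simp: dist_commute)
    qed
    have "E 0 = E (of_real s * v0)"
    proof (rule ccontr)
      assume "E 0 \<noteq> E (of_real s * v0)"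
      then have "f (E 0) \<noteq> f (E (of_real s * v0))"
        using both[OF r(1)] chart_inj[OF U(1)] by (auto simp: inj_on_def)
      then have "dist (f (E 0)) (f (E (of_real s * v0))) > 0" by simp
      with both[of "min r (dist (f (E 0)) (f (E (of_real s * v0))) / 2)"] r(1) show False by auto
    qed
    moreover have "of_real s * v0 \<in> ball 0 \<delta>" using v0(1) \<delta> by (simp add: norm_mult s_def)
    ultimately have "E0 0 = E0 (of_real s * v0)" using E_eq \<delta> by (metis centre_in_ball)
    then have "0 = of_real s * v0"
      using base_inj \<open>of_real s * v0 \<in> ball 0 \<delta>\<close> \<delta> unfolding inj_on_def by (metis centre_in_ball)
    then show False using v0(1) \<delta> by (auto simp: s_def)
  qed
  then obtain \<epsilon>0 where \<epsilon>0: "\<epsilon>0 > 0" "\<epsilon>0 \<le> r" and a_large: "\<And>t. near \<epsilon>0 t \<Longrightarrow> \<epsilon>0 \<le> a t * t"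
    by blast
  obtain C where C: "C > 0"
    "\<And>d. \<exists>\<tau> \<sigma>. d = of_real \<tau> * u + of_real \<sigma> * v0 \<and> \<bar>\<tau>\<bar> \<le> C * norm d \<and> \<bar>\<sigma>\<bar> \<le> C * norm d"
    using oblique_coordinates[OF norm_u v0] by metis
  \<comment> \<open>If slopes of at least \<open>a0\<close> kept occurring, discs of radius at most
    \<open>c / a0\<close> would fit into the tube at centres \<open>2 * \<rho>\<close> apart, and
    \<open>too_many_visits\<close> would apply.\<close>
  have a_small: "\<exists>\<epsilon>>0. \<exists>T. \<forall>t. near \<epsilon> t \<longrightarrow> T \<le> t \<longrightarrow> a t < a0" if a0: "a0 > 0" for a0
  proof (rule ccontr)
    assume contr: "\<not> ?thesis"
    define c where "c = min r (min (\<rho> * a0) (\<delta> * a0 / (8 * C)))"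
    have c: "c > 0" "c \<le> r" using r \<rho> a0 \<delta> C(1) by (auto simp: c_def)
    have c2: "c \<le> \<rho> * a0" "c \<le> \<delta> * a0 / (8 * C)" unfolding c_def by (simp_all only: min.bounded_iff min_le_iff_disj order_refl simp_thms)
    define P where "P t \<longleftrightarrow> near (c / 2) t \<and> a0 \<le> a t" for t
    have later: "\<exists>t. P t \<and> T \<le> t" for T
      using contr c(1) unfolding P_def by (metis half_gt_zero not_le)
    obtain t where t: "\<And>n. P (t n)" "\<And>n. t n + 2 * \<rho> \<le> t (Suc n)"
      by (rule real_sequence_choice[of P "\<lambda>x y. x + 2 * \<rho> \<le> y"]) (use later in auto)
    have n: "near (c / 2) (t n)" and an: "a0 \<le> a (t n)" for n using t(1)[of n] by (auto simp: P_def)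
    have nr: "near r (t n)" for n using near_mono[OF n] c by auto
    have t\<delta>: "\<delta> \<le> t n" for n using n by (auto simp: near_def)
    have rad: "c / a (t n) \<le> \<rho>" "C * (c / a (t n)) \<le> \<delta> / 8" for n
    proof -
      have "c / a (t n) \<le> c / a0" using an[of n] a0 c by (intro divide_left_mono) auto
      moreover have "c / a0 \<le> \<rho>" using c2(1) a0 by (simp add: pos_divide_le_eq)
      ultimately show "c / a (t n) \<le> \<rho>" by linarith
      have "C * (c / a (t n)) \<le> C * (c / a0)"
        using \<open>c / a (t n) \<le> c / a0\<close> C(1) by (intro mult_left_mono) auto
      also have "\<dots> \<le> \<delta> / 8" using c2(2) a0 C(1) by (simp add: field_simps)
      finally show "C * (c / a (t n)) \<le> \<delta> / 8" .
    qed
    have incr: "t i + 2 * \<rho> \<le> t j" if "i < j" for i j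
      using that
    proof (induction rule: strict_inc_induct)
      case (base i)
      then show ?case using t(2)[of i] by simp
    next
      case (step i)
      then show ?case using t(2)[of i] \<rho> by linarith
    qed
    have disj: "ball (of_real (t i) * v0) (c / a (t i)) \<inter> ball (of_real (t j) * v0) (c / a (t j)) = {}"
      if "i < j" for i j
      by (rule balls_disjoint, unfold dist_ray[OF v0(1)]) (use incr[OF that] rad(1)[of i] rad(1)[of j] in linarith)
    show False
    proof (rule too_many_visits[OF v0 C(2,1) at[OF n], where c = c])
      show "c > 0" by (rule c)
      fix i assume "i \<le> k"
      show "C * (c / a (t i)) < \<delta> / 4" using rad(2)[of i] \<delta> by linarith
      show "C * (c / a (t i)) < t i" using rad(2)[of i] t\<delta>[of i] \<delta> by linarith
      have "dist (f (E (of_real (t i) * v0))) (f q) < c / 2" "dist (f (E (of_real (t 0) * v0))) (f q) < c / 2"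
        using n[of i] n[of 0] by (auto simp: near_def)
      then show "dist (f (E (of_real (t i) * v0))) (f (E (of_real (t 0) * v0))) < c"
        by (rule dist_triangle_half_l)
      show "ball (f (E (of_real (t i) * v0))) c \<subseteq> f ` U"
        using subset_ball[of c r] ballU[OF nr[of i]] c by fastforce
      fix s' assume s': "0 \<le> s'" "s' \<le> t i"
      show "ball (of_real s' * v0) (c / a (t i)) \<subseteq> D"
        using tube[OF s'(1)] subset_ball[OF rad(1)[of i]] by blast
    next
      fix i j assume "i \<le> k" "j \<le> k" "i \<noteq> j"
      then show "ball (of_real (t i) * v0) (c / a (t i)) \<inter> ball (of_real (t j) * v0) (c / a (t j)) = {}"
        using disj[of i j] disj[of j i] by (cases "i < j") auto
    qed
  qed
  \<comment> \<open>With \<open>a n * n \<ge> \<epsilon>0\<close> the radius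
    \<open>2 * \<epsilon> / a n\<close> is at most \<open>\<kappa> / 8 * n\<close>, which is below
    \<open>\<kappa> * (n - m)\<close> because \<open>n \<ge> 2 * m\<close>. Hence
    \<open>y - x\<close> lies in the sector.\<close>
  define \<epsilon> where "\<epsilon> = \<epsilon>0 * \<kappa> / 16"
  have "\<kappa> / 16 \<le> 1 / 2" using \<kappa> by simp
  then have \<epsilon>: "\<epsilon> > 0" "2 * \<epsilon> \<le> \<epsilon>0" using \<epsilon>0 \<kappa> mult_left_mono[of "\<kappa> / 16" "1 / 2" \<epsilon>0] by (auto simp: \<epsilon>_def)
  obtain m where m: "near \<epsilon> m" using near_later[OF \<epsilon>(1)] by blast
  obtain \<epsilon>' T where T: "\<epsilon>' > 0" "\<And>t. near \<epsilon>' t \<Longrightarrow> T \<le> t \<Longrightarrow> a t < a m"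
    using a_small[OF apos[OF m]] by blast
  obtain n where n: "near (min \<epsilon> \<epsilon>') n" "max T (2 * m) \<le> n"
    using near_later[of "min \<epsilon> \<epsilon>'" "max T (2 * m)"] \<epsilon>(1) T(1) by (metis min_less_iff_conj)
  have nn: "near \<epsilon> n" "near \<epsilon>' n" "near \<epsilon>0 n" "near r n"
    using near_mono[OF n(1)] \<epsilon> \<epsilon>0 by auto
  have less: "a n < a m" using T(2)[OF nn(2)] n by simp
  have mn: "m > 0" "n > 0" "2 * m \<le> n" using near_pos[OF m] near_pos[OF n(1)] n by auto
  define x where "x = of_real m * v0"
  define xn where "xn = of_real n * v0"
  \<comment> \<open>The point near \<open>xn\<close> whose value in the affine chart form there is
    \<open>f (E x)\<close>.\<close>
  define y where "y = xn + (f (E x) - f (E xn)) / of_real (a n)"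
  have rad: "2 * \<epsilon> / a n \<le> \<kappa> / 8 * n"
  proof -
    have "2 * \<epsilon> \<le> \<kappa> / 8 * (a n * n)"
      using mult_left_mono[OF a_large[OF nn(3)], of "\<kappa> / 8"] \<kappa> by (simp add: \<epsilon>_def mult.commute)
    then show ?thesis using apos[OF n(1)] by (simp add: pos_divide_le_eq mult_ac)
  qed
  have "\<kappa> / 8 * n \<le> \<kappa> * n" using \<kappa> mn by simp
  with rad have rad': "2 * \<epsilon> / a n \<le> \<kappa> * n" by (rule order_trans)
  have sub: "ball xn (2 * \<epsilon> / a n) \<subseteq> S" unfolding xn_def
    by (rule S_ball[OF mn(2) rad'])
  have ymem: "y \<in> ball xn (2 * \<epsilon> / a n)"
  proof -
    have "dist (f (E x)) (f q) < \<epsilon>" "dist (f (E xn)) (f q) < \<epsilon>"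
      using m nn(1) by (auto simp: near_def x_def xn_def)
    then have "dist (f (E x)) (f (E xn)) < 2 * \<epsilon>" using dist_triangle2[of "f (E x)" "f (E xn)" "f q"] by simp
    then have "norm ((f (E x) - f (E xn)) / of_real (a n)) < 2 * \<epsilon> / a n"
      using apos[OF n(1)] by (simp add: norm_divide dist_norm divide_strict_right_mono)
    then show ?thesis by (simp add: y_def dist_norm)
  qed
  have ballU': "ball (of_real (a n) * xn + b n) (a n * (2 * \<epsilon> / a n)) \<subseteq> f ` U"
  proof -
    have "ball (f (E xn)) (2 * \<epsilon>) \<subseteq> ball (f (E xn)) r" using \<epsilon> \<epsilon>0 by (intro subset_ball) auto
    then show ?thesis using ballU[OF nn(4)] val[OF n(1)] apos[OF n(1)] by (auto simp: xn_def)
  qed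
  have atn: "dev_at X D E xn U f (a n) (b n)" using at[OF n(1)] by (simp add: xn_def)
  have atm: "dev_at X D E x U f (a m) (b m)" using at[OF m] by (simp add: x_def)
  note yy = chart_ball(2-4)[OF dev_D atn order_trans[OF sub S_D] ballU' ymem]
  have "f (E y) = f (E x)"
  proof -
    have "of_real (a n) * y + b n = f (E x)"
      unfolding y_def distrib_left using apos[OF n(1)] val[OF n(1)] by (simp add: xn_def)
    then show ?thesis using yy(2) by simp
  qed
  moreover have "E x \<in> U" using m by (simp add: near_def x_def)
  ultimately have Exy: "E x = E y" using yy(1) chart_inj[OF U(1)] by (auto simp: inj_on_def)
  have "y - x \<in> S"
  proof -
    have "norm (y - x - of_real (n - m) * v0) = dist xn y"
      by (simp add: x_def xn_def dist_norm norm_minus_commute algebra_simps)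
    also have "\<dots> < \<kappa> / 8 * n" using ymem rad by simp
    also have "\<dots> \<le> \<kappa> * (n - m)" using mn \<kappa> by (simp add: field_simps)
    finally show ?thesis unfolding S_def sector_def using mn by (intro CollectI exI[of _ "n - m"]) auto
  qed
  note dir = S_dir[OF this]
  have "(x - y) / of_real (norm (x - y)) \<in> hyperbolic_directions X"
  proof (rule closed_geodesic_between[of S E x y U f "a m" "b m" "a n" "b n"])
    show "open S" "convex S" using open_sector convex_sector by (auto simp: S_def)
    show "developing X S E" by (rule developing_mono[OF dev_D S_D])
    show "x \<in> S" using rayS mn by (simp add: x_def)
    show "y \<in> S" using sub ymem by blast
    show "dev_at X S E x U f (a m) (b m)" by (rule dev_at_mono[OF atm S_D])
    show "dev_at X S E y U f (a n) (b n)" by (rule dev_at_mono[OF yy(3) S_D])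
  qed (use Exy dir less in auto)
  moreover have "(x - y) / of_real (norm (x - y)) = - ((y - x) / of_real (norm (y - x)))"
    by (simp add: norm_minus_commute minus_divide_left)
  ultimately show ?thesis
    using dir by (intro that[of "(y - x) / of_real (norm (y - x))"]) (auto simp: norm_divide)
qed

end

section \<open>Cone points\<close>

locale cone_point = dilation_surf X for X :: "'a dilation_surface" +
  fixes s :: 'a and m :: nat and \<rho> :: real and W :: "(real \<times> real) set" and U :: "'a set"
    and q :: "real \<times> real \<Rightarrow> 'a" and \<epsilon> :: real
  assumes m: "1 \<le> m" and \<rho>: "0 < \<rho>"
    and W_open: "openin (top_of_set (cut_cone m)) W"
    and U_open: "openin TX U" and U_sings: "U \<inter> sings X = {s}"
    and q_quotient: "quotient_map (top_of_set W) (subtopology TX U) q"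
    and q_eq: "x \<in> W \<Longrightarrow> y \<in> W \<Longrightarrow> q x = q y \<longleftrightarrow> cone_glue m \<rho> x y"
    and q_apex: "q (0, 0) = s"
    and q_flat: "x \<in> W \<Longrightarrow> fst x > 0 \<Longrightarrow> (V, f) \<in> atlas X \<Longrightarrow> q x \<in> V \<Longrightarrow>
      \<exists>a b. a > 0 \<and> (\<forall>\<^sub>F y in nhdsin (top_of_set W) x.
        f (q y) = of_real a * (of_real (fst y) * cis (snd y)) + b)"
    and \<epsilon>: "\<epsilon> > 0" and W_tube: "0 \<le> r \<Longrightarrow> r < \<epsilon> \<Longrightarrow> 0 \<le> \<theta> \<Longrightarrow> \<theta> \<le> 2 * pi * real m \<Longrightarrow> (r, \<theta>) \<in> W"

context dilation_surf
begin

text \<open>Saturation puts the whole fibre \<open>r = 0\<close> over the apex into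
  \<open>W\<close>. The fibre is compact, so \<open>W\<close> contains a strip of uniform radius
  around it.\<close>

lemma cone_point_exists:
  assumes "s \<in> sings X"
  shows "\<exists>m \<rho> W U q \<epsilon>. cone_point X s m \<rho> W U q \<epsilon>"
proof -
  obtain m \<rho> W U q where *: "1 \<le> m" "0 < \<rho>"
    "openin (top_of_set (cut_cone m)) W" "(0, 0) \<in> W"
    "\<forall>x \<in> W. \<forall>y \<in> cut_cone m. cone_glue m \<rho> x y \<longrightarrow> y \<in> W"
    "openin TX U" "U \<inter> sings X = {s}"
    "quotient_map (top_of_set W) (subtopology TX U) q"
    "\<forall>x \<in> W. \<forall>y \<in> W. q x = q y \<longleftrightarrow> cone_glue m \<rho> x y"
    "q (0, 0) = s"
    "\<forall>x \<in> W. fst x > 0 \<longrightarrow> (\<forall>(V, f) \<in> atlas X. q x \<in> V \<longrightarrow>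
           (\<exists>a b. (a :: real) > 0 \<and> (\<forall>\<^sub>F y in nhdsin (top_of_set W) x.
              f (q y) = of_real a * (of_real (fst y) * cis (snd y)) + b)))"
    using cone[OF assms] unfolding cone_singularity_def by blast
  obtain G where G: "open G" "W = cut_cone m \<inter> G" using *(3) by (auto simp: openin_open)
  define K where "K = {0::real} \<times> {0..2 * pi * real m}"
  have "K \<subseteq> G"
  proof
    fix x assume "x \<in> K"
    then have "x \<in> cut_cone m" "cone_glue m \<rho> (0, 0) x" by (auto simp: K_def cut_cone_def cone_glue_def)
    then show "x \<in> G" using *(4,5) G(2) by blast
  qed
  moreover have "compact K" unfolding K_def by (intro compact_Times) auto
  ultimately obtain e where e: "e > 0" "(\<Union>x\<in>K. ball x e) \<subseteq> G"
    using compact_subset_open_imp_ball_epsilon_subset[OF _ G(1)] by metis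
  have tube: "(r, \<theta>) \<in> W" if "0 \<le> r" "r < e" "0 \<le> \<theta>" "\<theta> \<le> 2 * pi * real m" for r \<theta>
  proof -
    have "(0, \<theta>) \<in> K" "(r, \<theta>) \<in> ball (0, \<theta>) e" using that by (auto simp: K_def dist_Pair_Pair)
    then have "(r, \<theta>) \<in> G" using e(2) by blast
    then show ?thesis using that G(2) by (simp add: cut_cone_def)
  qed
  have "cone_point X s m \<rho> W U q e"
  proof (unfold_locales)
    show "\<exists>a b. a > 0 \<and> (\<forall>\<^sub>F y in nhdsin (top_of_set W) x.
        f (q y) = of_real a * (of_real (fst y) * cis (snd y)) + b)"
      if "x \<in> W" "fst x > 0" "(V, f) \<in> atlas X" "q x \<in> V" for x V f
      using *(11) that by fastforce
  qed (use * tube e(1) in blast)+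
  then show ?thesis by blast
qed

end

lemma ray_interval_cases:
  assumes I: "is_interval (I::real set)" "0 \<in> I" "I \<subseteq> {0..}" "\<And>t. t \<in> I \<Longrightarrow> \<exists>t'\<in>I. t < t'"
  obtains "I = {0..}" | T where "T > 0" "I = {0..<T}"
proof (cases "bdd_above I")
  case True
  have sub: "{0..t} \<subseteq> I" if "t \<in> I" for t
    by (auto intro: mem_is_interval_1_I[OF I(1,2) that])
  have "I = {0..<Sup I}"
  proof
    show "I \<subseteq> {0..<Sup I}"
    proof
      fix t assume "t \<in> I"
      then obtain t' where "t' \<in> I" "t < t'" using I(4) by blast
      then show "t \<in> {0..<Sup I}" using cSup_upper[OF _ True, of t'] \<open>t \<in> I\<close> I(3) by auto
    qed
    show "{0..<Sup I} \<subseteq> I"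
    proof
      fix t assume t: "t \<in> {0..<Sup I}"
      then obtain t' where "t' \<in> I" "t < t'" using less_cSup_iff[of I t] I(2) True by auto
      then show "t \<in> I" using sub t by (metis atLeastAtMost_iff atLeastLessThan_iff less_imp_le subsetD)
    qed
  qed
  moreover have "Sup I > 0"
    using \<open>I = {0..<Sup I}\<close> I(2) by (metis atLeastLessThan_iff)
  ultimately show ?thesis using that(2) by blast
next
  case False
  have "t \<in> I" if "t \<ge> 0" for t
  proof -
    obtain t' where "t' \<in> I" "t < t'" using False unfolding bdd_above_def by (meson not_le)
    then show ?thesis using mem_is_interval_1_I[OF I(1,2) _ that] by (meson less_imp_le)
  qed
  then have "I = {0..}" using I(3) by auto
  then show ?thesis using that(1) by blast
qed

section \<open>Polar coordinates and slit discs at a cone point\<close>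

context cone_point
begin

abbreviation period :: real where "period \<equiv> 2 * pi * real m"

lemma period: "period \<ge> 2 * pi" "period > 0"
proof -
  show "period \<ge> 2 * pi" using m mult_left_mono[of 1 "real m" "2 * pi"] by simp
  then show "period > 0" using pi_gt_zero by linarith
qed

lemma cis_period: "cis (\<theta> - period) = cis \<theta>" "cis (\<theta> + period) = cis \<theta>" "cis period = 1"
proof -
  show "cis period = 1" by (metis cis_multiple_2pi Ints_of_nat)
  then show "cis (\<theta> - period) = cis \<theta>" "cis (\<theta> + period) = cis \<theta>"
    by (simp_all add: cis_divide[symmetric] cis_mult[symmetric])
qed

lemma s_sing: "s \<in> sings X"
  using U_sings by blast

lemma W_cone: "x \<in> W \<Longrightarrow> 0 \<le> fst x \<and> 0 \<le> snd x \<and> snd x \<le> period"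
  using openin_subset[OF W_open] by (auto simp: cut_cone_def)

lemma q_image: "q ` W = U"
  using q_quotient openin_subset[OF U_open] by (auto simp: quotient_map_def)

lemma apex_W: "(0, 0) \<in> W"
  using W_tube[of 0 0] \<epsilon> period by auto

lemma q_zero: "0 \<le> \<theta> \<Longrightarrow> \<theta> \<le> period \<Longrightarrow> q (0, \<theta>) = s"
  using q_eq[OF W_tube[of 0 \<theta>] apex_W] q_apex \<epsilon> by (auto simp: cone_glue_def)

lemma q_regular:
  assumes "x \<in> W" "fst x > 0"
  shows "q x \<in> regular_part X"
proof -
  have "q x \<noteq> s"
    using q_eq[OF assms(1) apex_W] q_apex assms(2) period(2) by (auto simp: cone_glue_def)
  moreover have "q x \<in> U" using q_image assms(1) by blast
  ultimately show ?thesis using U_sings openin_subset[OF U_open] by (auto simp: regular_part_def)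
qed

lemma q_continuous:
  assumes "x \<in> W" "openin TX N" "q x \<in> N"
  shows "\<exists>d>0. \<forall>y\<in>W. dist y x < d \<longrightarrow> q y \<in> N"
proof -
  have "continuous_map (top_of_set W) TX q"
    using quotient_imp_continuous_map[OF q_quotient] by (simp add: continuous_map_in_subtopology)
  then have "openin (top_of_set W) {y \<in> topspace (top_of_set W). q y \<in> N}"
    using assms(2) by (rule openin_continuous_map_preimage)
  from bspec[OF conjunct2[OF this[unfolded openin_euclidean_subtopology_iff]], of x]
  show ?thesis using assms(1,3) by (auto simp del: split_paired_All split_paired_Ex)
qed

lemma q_chart:
  assumes x: "x \<in> W" "fst x > 0" and V: "(V, f) \<in> atlas X" "q x \<in> V"
  obtains a b d where "a > 0" "d > 0"
    "\<And>y. y \<in> W \<Longrightarrow> dist y x < d \<Longrightarrow> q y \<in> V \<and> f (q y) = of_real a * (of_real (fst y) * cis (snd y)) + b"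
proof -
  obtain a b where a: "a > 0" and ev: "\<forall>\<^sub>F y in nhdsin (top_of_set W) x.
        f (q y) = of_real a * (of_real (fst y) * cis (snd y)) + b"
    using q_flat[OF x V] by blast
  have "\<exists>S. openin (top_of_set W) S \<and> x \<in> S \<and>
      (\<forall>y\<in>S. f (q y) = of_real a * (of_real (fst y) * cis (snd y)) + b)"
    using ev x(1) by (simp add: eventually_nhdsin)
  then obtain S where S: "openin (top_of_set W) S" "x \<in> S"
      "\<And>y. y \<in> S \<Longrightarrow> f (q y) = of_real a * (of_real (fst y) * cis (snd y)) + b" by blast
  obtain d where d: "d > 0" "\<And>y. y \<in> W \<Longrightarrow> dist y x < d \<Longrightarrow> y \<in> S"
    using S(1,2) unfolding openin_euclidean_subtopology_iff by blast
  obtain d' where d': "d' > 0" "\<And>y. y \<in> W \<Longrightarrow> dist y x < d' \<Longrightarrow> q y \<in> V"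
    using q_continuous[OF x(1) chart_open[OF V(1)] V(2)] by blast
  show ?thesis using that[of a "min d d'" b] a d d' S(3) by simp
qed

text \<open>For \<open>r\<close> below this bound both \<open>r\<close> and
  \<open>r / \<rho>\<close> are below \<open>\<epsilon>\<close>, so both sheets of the polar
  coordinates are available.\<close>

definition radius :: real where "radius = \<epsilon> * min 1 \<rho>"

lemma radius: "radius > 0" "radius \<le> \<epsilon>" "radius / \<rho> \<le> \<epsilon>"
proof -
  show "radius > 0" using \<epsilon> \<rho> by (simp add: radius_def)
  show "radius \<le> \<epsilon>" using \<epsilon> by (simp add: radius_def)
  have "radius \<le> \<epsilon> * \<rho>" using \<epsilon> by (simp add: radius_def)
  then show "radius / \<rho> \<le> \<epsilon>" using \<rho> by (simp add: pos_divide_le_eq)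
qed

text \<open>
  Polar coordinates continued across the cut once, so that every point off the cone point has a
  representative with an angular interval of length \<open>2\<pi>\<close> around it.
\<close>

definition unrolled :: "real \<Rightarrow> real \<Rightarrow> 'a" where
  "unrolled r \<theta> = (if \<theta> \<le> period then q (r, \<theta>) else q (r / \<rho>, \<theta> - period))"

lemma unrolled_W:
  assumes "0 < r" "r < radius" "0 < \<theta>" "\<theta> < 2 * period"
  shows "\<theta> \<le> period \<Longrightarrow> (r, \<theta>) \<in> W" and "\<theta> \<ge> period \<Longrightarrow> (r / \<rho>, \<theta> - period) \<in> W"
proof -
  show "\<theta> \<le> period \<Longrightarrow> (r, \<theta>) \<in> W" using W_tube[of r \<theta>] assms radius by auto
  have "r / \<rho> < radius / \<rho>" using assms \<rho> by (simp add: divide_strict_right_mono)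
  then show "\<theta> \<ge> period \<Longrightarrow> (r / \<rho>, \<theta> - period) \<in> W"
    using W_tube[of "r / \<rho>" "\<theta> - period"] assms radius \<rho> by auto
qed

lemma unrolled_period:
  assumes "0 < r" "r < radius"
  shows "unrolled r period = q (r / \<rho>, 0)"
proof -
  have "(r, period) \<in> W" "(r / \<rho>, 0) \<in> W"
    using unrolled_W[OF assms, of period] period by auto
  moreover have "cone_glue m \<rho> (r / \<rho>, 0) (r, period)" using \<rho> by (simp add: cone_glue_def)
  ultimately have "q (r / \<rho>, 0) = q (r, period)" using q_eq[of "(r / \<rho>, 0)" "(r, period)"] by simp
  then show ?thesis unfolding unrolled_def by simp
qed

lemma unrolled_regular:
  assumes "0 < r" "r < radius" "0 < \<theta>" "\<theta> < 2 * period"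
  shows "unrolled r \<theta> \<in> regular_part X"
  using unrolled_W[OF assms] assms \<rho> by (auto simp: unrolled_def intro!: q_regular)

text \<open>Past the cut the radius is divided by \<open>\<rho>\<close>, so a slope \<open>a\<close>
  in the original sheet becomes \<open>a / \<rho>\<close> in the unrolled radius. On the cut itself
  both affine forms hold along an interval of radii, which forces their coefficients to
  agree.\<close>

lemma unrolled_chart:
  assumes r0: "0 < r0" "r0 < radius" and \<theta>0: "0 < \<theta>0" "\<theta>0 < 2 * period"
    and V: "(V, f) \<in> atlas X" "unrolled r0 \<theta>0 \<in> V"
  obtains a b d where "a > 0" "d > 0"
    "\<And>r \<theta>. \<bar>r - r0\<bar> < d \<Longrightarrow> \<bar>\<theta> - \<theta>0\<bar> < d \<Longrightarrow>
      unrolled r \<theta> \<in> V \<and> f (unrolled r \<theta>) = of_real a * (of_real r * cis \<theta>) + b"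
proof -
  note W0 = unrolled_W[OF r0 \<theta>0]
  define D where "D = min (min r0 (radius - r0)) (min \<theta>0 (2 * period - \<theta>0))"
  have D: "D > 0" using r0 \<theta>0 by (simp add: D_def)
  have range: "0 < r \<and> r < radius \<and> 0 < \<theta> \<and> \<theta> < 2 * period" if "\<bar>r - r0\<bar> < D" "\<bar>\<theta> - \<theta>0\<bar> < D" for r \<theta>
    using that unfolding D_def by linarith
  have dist_less: "dist (r, \<theta>) (r', \<theta>') < d" if "\<bar>r - r'\<bar> < d / 2" "\<bar>\<theta> - \<theta>'\<bar> < d / 2" for r \<theta> r' \<theta>' d :: real
  proof -
    have "dist (r, \<theta>) (r', \<theta>') \<le> \<bar>r - r'\<bar> + \<bar>\<theta> - \<theta>'\<bar>"
      unfolding dist_Pair_Pair dist_real_def by (rule order_trans[OF sqrt_sum_squares_le_sum_abs]) simp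
    then show ?thesis using that by linarith
  qed
  have low: "\<exists>a b d. a > 0 \<and> d > 0 \<and> (\<forall>r \<theta>. \<bar>r - r0\<bar> < d \<longrightarrow> \<bar>\<theta> - \<theta>0\<bar> < d \<longrightarrow> \<theta> \<le> period \<longrightarrow>
      q (r, \<theta>) \<in> V \<and> f (q (r, \<theta>)) = of_real a * (of_real r * cis \<theta>) + b)" if le: "\<theta>0 \<le> period"
  proof -
    have "q (r0, \<theta>0) \<in> V" using V(2) le by (simp add: unrolled_def)
    then obtain a b d where a: "a > 0" "d > 0"
      "\<And>y. y \<in> W \<Longrightarrow> dist y (r0, \<theta>0) < d \<Longrightarrow> q y \<in> V \<and> f (q y) = of_real a * (of_real (fst y) * cis (snd y)) + b"
      using q_chart[OF W0(1)[OF le] _ V(1)] r0(1) by (metis fst_conv)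
    have lo: "q (r, \<theta>) \<in> V \<and> f (q (r, \<theta>)) = of_real a * (of_real r * cis \<theta>) + b"
      if "\<bar>r - r0\<bar> < min D (d / 2)" "\<bar>\<theta> - \<theta>0\<bar> < min D (d / 2)" "\<theta> \<le> period" for r \<theta>
      using a(3)[of "(r, \<theta>)"] unrolled_W(1)[of r \<theta>] range[of r \<theta>] dist_less[of r r0 d \<theta> \<theta>0] that by auto
    have "min D (d / 2) > 0" using a(2) D by auto
    with lo a(1) show ?thesis by blast
  qed
  have high: "\<exists>a b d. a > 0 \<and> d > 0 \<and> (\<forall>r \<theta>. \<bar>r - r0\<bar> < d \<longrightarrow> \<bar>\<theta> - \<theta>0\<bar> < d \<longrightarrow> \<theta> \<ge> period \<longrightarrow>
      q (r / \<rho>, \<theta> - period) \<in> V \<and> f (q (r / \<rho>, \<theta> - period)) = of_real a * (of_real r * cis \<theta>) + b)"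
    if ge: "\<theta>0 \<ge> period"
  proof -
    have "q (r0 / \<rho>, \<theta>0 - period) \<in> V"
      using V(2) ge unrolled_period[OF r0] by (cases "\<theta>0 = period") (auto simp: unrolled_def)
    then obtain a b d where a: "a > 0" "d > 0"
      "\<And>y. y \<in> W \<Longrightarrow> dist y (r0 / \<rho>, \<theta>0 - period) < d \<Longrightarrow> q y \<in> V \<and> f (q y) = of_real a * (of_real (fst y) * cis (snd y)) + b"
      using q_chart[OF W0(2)[OF ge] _ V(1)] r0(1) \<rho> by (metis divide_pos_pos fst_conv)
    have hi: "q (r / \<rho>, \<theta> - period) \<in> V \<and> f (q (r / \<rho>, \<theta> - period)) = of_real (a / \<rho>) * (of_real r * cis \<theta>) + b"
      if *: "\<bar>r - r0\<bar> < min D (min (d / 2) (d / 2 * \<rho>))" "\<bar>\<theta> - \<theta>0\<bar> < min D (min (d / 2) (d / 2 * \<rho>))" "\<theta> \<ge> period" for r \<theta>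
    proof -
      have "\<bar>r / \<rho> - r0 / \<rho>\<bar> = \<bar>r - r0\<bar> / \<rho>" using \<rho> by (simp add: diff_divide_distrib[symmetric])
      also have "\<dots> < d / 2" using * \<rho> by (simp add: pos_divide_less_eq)
      finally have "dist (r / \<rho>, \<theta> - period) (r0 / \<rho>, \<theta>0 - period) < d" using * by (intro dist_less) auto
      moreover have "(r / \<rho>, \<theta> - period) \<in> W"
      proof -
        have "0 < r \<and> r < radius \<and> 0 < \<theta> \<and> \<theta> < 2 * period" using * by (intro range) auto
        then show ?thesis using unrolled_W(2)[of r \<theta>] *(3) by blast
      qed
      ultimately show ?thesis using a(3)[of "(r / \<rho>, \<theta> - period)"] by (simp add: cis_period)
    qed
    have "a / \<rho> > 0" "min D (min (d / 2) (d / 2 * \<rho>)) > 0" using a(1,2) D \<rho> by auto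
    with hi show ?thesis by blast
  qed
  consider "\<theta>0 < period" | "\<theta>0 > period" | "\<theta>0 = period" by linarith
  then show ?thesis
  proof cases
    case 1
    then obtain a b d where a: "a > 0" "d > 0" "\<forall>r \<theta>. \<bar>r - r0\<bar> < d \<longrightarrow> \<bar>\<theta> - \<theta>0\<bar> < d \<longrightarrow> \<theta> \<le> period \<longrightarrow>
      q (r, \<theta>) \<in> V \<and> f (q (r, \<theta>)) = of_real a * (of_real r * cis \<theta>) + b" using low by auto
    show ?thesis
    proof (rule that[of a "min d (period - \<theta>0)" b])
      fix r \<theta> assume "\<bar>r - r0\<bar> < min d (period - \<theta>0)" "\<bar>\<theta> - \<theta>0\<bar> < min d (period - \<theta>0)"
      then show "unrolled r \<theta> \<in> V \<and> f (unrolled r \<theta>) = of_real a * (of_real r * cis \<theta>) + b"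
        using a(3) by (auto simp: unrolled_def)
    qed (use a 1 in auto)
  next
    case 2
    then obtain a b d where a: "a > 0" "d > 0" "\<forall>r \<theta>. \<bar>r - r0\<bar> < d \<longrightarrow> \<bar>\<theta> - \<theta>0\<bar> < d \<longrightarrow> \<theta> \<ge> period \<longrightarrow>
      q (r / \<rho>, \<theta> - period) \<in> V \<and> f (q (r / \<rho>, \<theta> - period)) = of_real a * (of_real r * cis \<theta>) + b" using high by auto
    show ?thesis
    proof (rule that[of a "min d (\<theta>0 - period)" b])
      fix r \<theta> assume "\<bar>r - r0\<bar> < min d (\<theta>0 - period)" "\<bar>\<theta> - \<theta>0\<bar> < min d (\<theta>0 - period)"
      then show "unrolled r \<theta> \<in> V \<and> f (unrolled r \<theta>) = of_real a * (of_real r * cis \<theta>) + b"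
        using a(3) by (auto simp: unrolled_def)
    qed (use a 2 in auto)
  next
    case 3
    obtain a b d where a: "a > 0" "d > 0" "\<forall>r \<theta>. \<bar>r - r0\<bar> < d \<longrightarrow> \<bar>\<theta> - \<theta>0\<bar> < d \<longrightarrow> \<theta> \<le> period \<longrightarrow>
      q (r, \<theta>) \<in> V \<and> f (q (r, \<theta>)) = of_real a * (of_real r * cis \<theta>) + b" using low 3 by auto
    obtain a' b' d' where a': "a' > 0" "d' > 0" "\<forall>r \<theta>. \<bar>r - r0\<bar> < d' \<longrightarrow> \<bar>\<theta> - \<theta>0\<bar> < d' \<longrightarrow> \<theta> \<ge> period \<longrightarrow>
      q (r / \<rho>, \<theta> - period) \<in> V \<and> f (q (r / \<rho>, \<theta> - period)) = of_real a' * (of_real r * cis \<theta>) + b'" using high 3 by auto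
    have on_cut: "of_real a * of_real r + b = of_real a' * of_real r + b'"
      if r: "\<bar>r - r0\<bar> < min D (min d d')" for r
    proof -
      have "0 < r" "r < radius" using range[of r \<theta>0] r D by auto
      then have "q (r, period) = q (r / \<rho>, 0)" using unrolled_period by (simp add: unrolled_def)
      moreover have "f (q (r, period)) = of_real a * of_real r + b"
        using a(3)[rule_format, of r period] r a(2) 3 by (simp add: cis_period)
      moreover have "f (q (r / \<rho>, 0)) = of_real a' * of_real r + b'"
        using a'(3)[rule_format, of r period] r a'(2) 3 by (simp add: cis_period)
      ultimately show ?thesis by simp
    qed
    define h where "h = min D (min d d') / 2"
    have h: "h > 0" "h < min D (min d d')" using D a(2) a'(2) by (auto simp: h_def)
    have "complex_of_real r0 \<noteq> of_real (r0 + h)" using h(1) by (metis add_cancel_left_right less_irrefl of_real_eq_iff)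
    then have eq: "a = a'" "b = b'"
      using dev_at_coefficients[OF on_cut[of r0] on_cut[of "r0 + h"]] h by auto
    show ?thesis
    proof (rule that[of a "min d d'" b])
      fix r \<theta> assume *: "\<bar>r - r0\<bar> < min d d'" "\<bar>\<theta> - \<theta>0\<bar> < min d d'"
      show "unrolled r \<theta> \<in> V \<and> f (unrolled r \<theta>) = of_real a * (of_real r * cis \<theta>) + b"
        using a(3)[rule_format, of r \<theta>] a'(3)[rule_format, of r \<theta>] * eq by (cases "\<theta> \<le> period") (auto simp: unrolled_def)
    qed (use a a' in auto)
  qed
qed

text \<open>The radius opposite to \<open>cis \<theta>\<close> is removed; on what remains the angle
  within \<open>pi\<close> of \<open>\<theta>\<close> is a continuous function, and
  \<open>slit_map\<close> uses that branch.\<close>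

definition slit_disc :: "real \<Rightarrow> complex set" where
  "slit_disc \<theta> = {z. norm z < radius \<and> z / cis \<theta> \<notin> \<real>\<^sub>\<le>\<^sub>0}"

definition slit_map :: "real \<Rightarrow> complex \<Rightarrow> 'a" where
  "slit_map \<theta> z = unrolled (norm z) (\<theta> + Arg (z / cis \<theta>))"

lemma slit_polar:
  assumes "z \<in> slit_disc \<theta>"
  shows "z \<noteq> 0" "\<bar>Arg (z / cis \<theta>)\<bar> < pi" "of_real (norm z) * cis (\<theta> + Arg (z / cis \<theta>)) = z"
proof -
  show z: "z \<noteq> 0" using assms by (auto simp: slit_disc_def)
  have "Arg (z / cis \<theta>) \<noteq> pi"
    using assms z by (auto simp: slit_disc_def Arg_eq_pi complex_nonpos_Reals_iff)
  then show "\<bar>Arg (z / cis \<theta>)\<bar> < pi" using Arg_bounded[of "z / cis \<theta>"] by auto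
  have "z / cis \<theta> = rcis (norm (z / cis \<theta>)) (Arg (z / cis \<theta>))" by (simp add: rcis_cmod_Arg)
  then have "z / cis \<theta> = of_real (norm z) * cis (Arg (z / cis \<theta>))" by (simp add: rcis_def norm_divide)
  then have "z = cis \<theta> * (of_real (norm z) * cis (Arg (z / cis \<theta>)))" by (simp add: field_simps)
  then show "of_real (norm z) * cis (\<theta> + Arg (z / cis \<theta>)) = z" by (simp add: cis_mult[symmetric] mult_ac)
qed

text \<open>The bounds on \<open>\<theta>\<close> keep every angle of the branch strictly between 0
  and \<open>2 * period\<close>, where \<open>unrolled\<close> is controlled.\<close>

lemma slit_developing:
  assumes \<theta>: "pi \<le> \<theta>" "\<theta> \<le> 2 * period - pi"
  shows "developing X (slit_disc \<theta>) (slit_map \<theta>)"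
  unfolding developing_def
proof
  fix z assume z: "z \<in> slit_disc \<theta>"
  note p = slit_polar[OF z]
  define \<phi> where "\<phi> = \<theta> + Arg (z / cis \<theta>)"
  have r0: "0 < norm z" "norm z < radius" using z p by (auto simp: slit_disc_def)
  have \<phi>: "0 < \<phi>" "\<phi> < 2 * period" using p(2) \<theta> by (auto simp: \<phi>_def)
  have "slit_map \<theta> z \<in> regular_part X" unfolding slit_map_def using unrolled_regular[OF r0 \<phi>] by (simp add: \<phi>_def)
  then obtain V f where V: "(V, f) \<in> atlas X" "slit_map \<theta> z \<in> V" using chart_exists by blast
  then have "unrolled (norm z) \<phi> \<in> V" by (simp add: slit_map_def \<phi>_def)
  from unrolled_chart[OF r0 \<phi> V(1) this] obtain a b d where a: "a > 0" "d > 0"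
    "\<And>r \<theta>'. \<bar>r - norm z\<bar> < d \<Longrightarrow> \<bar>\<theta>' - \<phi>\<bar> < d \<Longrightarrow>
      unrolled r \<theta>' \<in> V \<and> f (unrolled r \<theta>') = of_real a * (of_real r * cis \<theta>') + b" by metis
  have "continuous (at z) (\<lambda>w. Arg (w / cis \<theta>))"
  proof (rule isCont_o2[where f = "\<lambda>w. w / cis \<theta>"])
    show "isCont (\<lambda>w. w / cis \<theta>) z" by (intro continuous_intros) auto
    show "isCont Arg (z / cis \<theta>)" using z by (intro continuous_at_Arg) (auto simp: slit_disc_def)
  qed
  then obtain e where e: "e > 0" "\<And>w. dist w z < e \<Longrightarrow> dist (Arg (w / cis \<theta>)) (Arg (z / cis \<theta>)) < d"
    using a(2) unfolding continuous_at_eps_delta by metis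
  have "slit_map \<theta> w \<in> V \<and> f (slit_map \<theta> w) = of_real a * w + b" if w: "w \<in> slit_disc \<theta> \<inter> ball z (min d e)" for w
  proof -
    have "\<bar>norm w - norm z\<bar> < d"
      using w norm_triangle_ineq3[of w z] by (auto simp: dist_norm norm_minus_commute)
    moreover have "\<bar>\<theta> + Arg (w / cis \<theta>) - \<phi>\<bar> < d"
      using w e(2)[of w] by (auto simp: \<phi>_def dist_real_def dist_commute)
    ultimately have "unrolled (norm w) (\<theta> + Arg (w / cis \<theta>)) \<in> V \<and>
        f (unrolled (norm w) (\<theta> + Arg (w / cis \<theta>))) = of_real a * (of_real (norm w) * cis (\<theta> + Arg (w / cis \<theta>))) + b"
      by (rule a(3))
    then show ?thesis using slit_polar(3)[of w \<theta>] w by (simp add: slit_map_def)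
  qed
  then have "dev_at X (slit_disc \<theta>) (slit_map \<theta>) z V f a b"
    unfolding dev_at_def using V(1) a(1,2) e(1) by (intro conjI exI[of _ "min d e"]) auto
  then show "\<exists>U f a b. dev_at X (slit_disc \<theta>) (slit_map \<theta>) z U f a b" by blast
qed

text \<open>
  The linear interpolation of the ratio from \<open>1\<close> to \<open>\<rho>\<close> makes the set \<open>W'\<close> below saturated.
\<close>

lemma small_neighbourhood:
  assumes e: "e > 0"
  obtains N where "openin TX N" "s \<in> N" "\<And>x. x \<in> W \<Longrightarrow> q x \<in> N \<Longrightarrow> fst x < e"
proof -
  define h where "h \<theta> = 1 + (\<rho> - 1) * (\<theta> / period)" for \<theta>
  define e' where "e' = e / max 1 \<rho>"
  have e': "e' > 0" using e by (simp add: e'_def)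
  have h: "0 < h \<theta> \<and> h \<theta> \<le> max 1 \<rho>" if "0 \<le> \<theta>" "\<theta> \<le> period" for \<theta>
  proof -
    define l where "l = \<theta> / period"
    have l: "0 \<le> l" "l \<le> 1" using that period by (auto simp: l_def)
    have hl: "h \<theta> = (1 - l) * 1 + l * \<rho>" unfolding h_def l_def[symmetric] by (simp add: algebra_simps)
    have "(1 - l) * 1 + l * \<rho> \<le> max 1 \<rho>" by (rule convex_bound_le) (use l in auto)
    moreover have "0 < (1 - l) * 1 + l * \<rho>" using l \<rho> by (cases "l = 0") (auto intro: add_nonneg_pos)
    ultimately show ?thesis using hl by simp
  qed
  have h_ends: "h 0 = 1" "h period = \<rho>" using period(2) by (auto simp: h_def)
  define W' where "W' = {x \<in> W. fst x < e' * h (snd x)}"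
  have "openin (top_of_set W) W'"
  proof -
    have "W' = W \<inter> {x. fst x < e' * h (snd x)}" by (auto simp: W'_def)
    moreover have "open {x :: real \<times> real. fst x < e' * h (snd x)}"
      unfolding h_def by (intro open_Collect_less continuous_intros) (use period in auto)
    ultimately show ?thesis by (simp add: openin_open_Int)
  qed
  have sat: "y \<in> W'" if "x \<in> W'" "y \<in> W" "q x = q y" for x y
  proof -
    have x: "x \<in> W" "fst x < e' * h (snd x)" using that(1) by (auto simp: W'_def)
    have "cone_glue m \<rho> x y" using q_eq[OF x(1) that(2)] that(3) by simp
    then consider "x = y" | "fst x = 0" "fst y = 0" | "snd x = 0" "snd y = period" "fst y = \<rho> * fst x"
      | "snd y = 0" "snd x = period" "fst x = \<rho> * fst y" unfolding cone_glue_def by auto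
    then have "fst y < e' * h (snd y)"
    proof cases
      case 2
      then show ?thesis using h[of "snd y"] W_cone[OF that(2)] e' by simp
    next
      case 3
      then have "fst x < e'" using x h_ends by simp
      then show ?thesis using 3 h_ends \<rho> by (simp add: mult.commute)
    next
      case 4
      then have "\<rho> * fst y < \<rho> * e'" using x h_ends by (simp add: mult.commute)
      then show ?thesis using 4 h_ends \<rho> by simp
    qed (use x in auto)
    then show ?thesis using that(2) by (simp add: W'_def)
  qed
  have W'W: "W' \<subseteq> W" by (auto simp: W'_def)
  have "{x \<in> topspace (top_of_set W). q x \<in> q ` W'} = W'" using sat W'W by auto
  then have "openin (top_of_set W) {x \<in> topspace (top_of_set W). q x \<in> q ` W'}"
    using \<open>openin (top_of_set W) W'\<close> by simp
  moreover have "q ` W' \<subseteq> topspace (subtopology TX U)"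
    using W'W q_image openin_subset[OF U_open] by auto
  ultimately have "openin (subtopology TX U) (q ` W')"
    using q_quotient unfolding quotient_map_def by blast
  then have "openin TX (q ` W')" using U_open by (simp add: openin_open_subtopology)
  moreover have "(0, 0) \<in> W'" using apex_W e' h_ends by (simp add: W'_def)
  then have "s \<in> q ` W'" using q_apex by (metis imageI)
  moreover have "fst x < e" if xW: "x \<in> W" "q x \<in> q ` W'" for x
  proof -
    obtain y where "y \<in> W'" "q x = q y" using xW(2) by blast
    then have "x \<in> W'" using sat[of y x] xW(1) by simp
    then have "fst x < e' * h (snd x)" by (simp add: W'_def)
    also have "\<dots> \<le> e' * max 1 \<rho>" using h[of "snd x"] W_cone[OF xW(1)] e' by (intro mult_left_mono) auto
    also have "\<dots> = e" by (simp add: e'_def)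
    finally show ?thesis .
  qed
  ultimately show ?thesis using that by blast
qed

text \<open>Angles below \<open>pi\<close> are moved up by one period, and the radius is then
  multiplied by \<open>\<rho>\<close>. Both possible radii must therefore be small.\<close>

lemma slit_representative:
  assumes x: "x \<in> W" "0 < fst x" "fst x < e" "\<rho> * fst x < e" and e: "e \<le> radius"
  obtains r \<theta> where "0 < r" "r < e" "pi \<le> \<theta>" "\<theta> \<le> 2 * period - pi" "unrolled r \<theta> = q x"
proof (cases "pi \<le> snd x")
  case True
  have "unrolled (fst x) (snd x) = q x" using W_cone[OF x(1)] by (simp add: unrolled_def)
  then show ?thesis using that[of "fst x" "snd x"] x True W_cone[OF x(1)] period pi_gt_zero by auto
next
  case False
  have "unrolled (\<rho> * fst x) (snd x + period) = q x"
  proof (cases "snd x = 0")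
    case True
    then have "unrolled (\<rho> * fst x) (snd x + period) = q (\<rho> * fst x / \<rho>, 0)"
      using unrolled_period[of "\<rho> * fst x"] x \<rho> e by simp
    also have "\<dots> = q x" using True \<rho> by (metis less_irrefl nonzero_mult_div_cancel_left prod.collapse)
    finally show ?thesis .
  next
    case False
    then have "snd x > 0" using W_cone[OF x(1)] by simp
    then show ?thesis using \<rho> by (simp add: unrolled_def)
  qed
  moreover have "pi \<le> snd x + period" "snd x + period \<le> 2 * period - pi"
    using False W_cone[OF x(1)] period pi_gt_zero by linarith+
  ultimately show ?thesis using that[of "\<rho> * fst x" "snd x + period"] x \<rho> by simp
qed

end

section \<open>Rays converging to a cone point\<close>

context dilation_surf
begin

lemma separate_singular:
  assumes "p \<in> regular_part X" "s \<in> sings X"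
  obtains A B where "openin TX A" "openin TX B" "p \<in> A" "s \<in> B" "A \<inter> B = {}"
proof -
  have "p \<in> topspace TX" "s \<in> topspace TX" "p \<noteq> s"
    using assms sings_subset by (auto simp: regular_part_def)
  then show ?thesis using Hausdorff that unfolding Hausdorff_space_def disjnt_def by metis
qed

end

context cone_point
begin

text \<open>Near the apex the ray is a straight line in a slit disc. If it is not aimed at the apex,
  it misses the slit and either leaves the small neighbourhood or stops at a regular point, and both
  contradict convergence to \<open>s\<close>. The condition \<open>v \<noteq> - 1\<close> keeps the
  final angle off the cut, so that one angle strictly inside the original cone describes the end of
  the ray.\<close>

lemma singular_ray_radial:
  assumes v: "norm v = 1" "v \<noteq> - 1"
    and I: "is_interval I" "0 \<in> I" "I \<subseteq> {0..}" "\<And>t. t \<in> I \<Longrightarrow> \<exists>t'\<in>I. t < t'"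
    and g: "developing X ((\<lambda>t. of_real t * v) ` I) g"
    and conv: "\<And>N. openin TX N \<Longrightarrow> s \<in> N \<Longrightarrow> \<exists>t0\<in>I. \<forall>t\<in>I. t0 \<le> t \<longrightarrow> g (of_real t * v) \<in> N"
  obtains T c \<theta> t1 where "T > 0" "I = {0..<T}" "c > 0" "0 < \<theta>" "\<theta> < period" "cis \<theta> = - v"
    "0 \<le> t1" "t1 < T" "c * (T - t1) < \<epsilon>" "\<And>t. t1 \<le> t \<Longrightarrow> t < T \<Longrightarrow> g (of_real t * v) = q (c * (T - t), \<theta>)"
proof -
  \<comment> \<open>A point at unrolled radius \<open>e2\<close> has radius \<open>e2\<close> or
    \<open>e2 / \<rho>\<close> in the cone; neither is below \<open>e\<close>, so such a point is
    outside the neighbourhood \<open>N\<close>.\<close>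
  define e2 where "e2 = radius / 2"
  define e where "e = min e2 (e2 / \<rho>)"
  have e2: "e2 > 0" "e2 < radius" using radius by (auto simp: e2_def)
  have e: "e > 0" "e \<le> e2" "e \<le> e2 / \<rho>" using e2 \<rho> by (auto simp: e_def)
  have regular: "g (of_real t * v) \<in> regular_part X" if "t \<in> I" for t
    using developing_regular[OF g] that by blast
  obtain N where N: "openin TX N" "s \<in> N" "\<And>x. x \<in> W \<Longrightarrow> q x \<in> N \<Longrightarrow> fst x < e"
    using small_neighbourhood[OF e(1)] by metis
  have "openin TX (N \<inter> U)" "s \<in> N \<inter> U" using N U_open U_sings by auto
  from conv[OF this] obtain t1 where t1: "t1 \<in> I" "\<And>t. t \<in> I \<Longrightarrow> t1 \<le> t \<Longrightarrow> g (of_real t * v) \<in> N \<inter> U" by blast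
  have "g (of_real t1 * v) \<in> q ` W" using t1(2)[OF t1(1)] q_image by auto
  then obtain x where x: "x \<in> W" "q x = g (of_real t1 * v)" by auto
  have x_pos: "fst x > 0"
  proof (rule ccontr)
    assume "\<not> ?thesis"
    then have "x = (0, snd x)" using W_cone[OF x(1)] by (simp add: prod_eq_iff)
    then have "q x = s" using q_zero[of "snd x"] W_cone[OF x(1)] by simp
    then show False using x(2) regular[OF t1(1)] s_sing by (simp add: regular_part_def)
  qed
  have x_small: "fst x < e" using N(3)[OF x(1)] t1(2)[OF t1(1)] x(2) by simp
  have "fst x < e2 / \<rho>" using x_small e(3) by linarith
  then have "\<rho> * fst x < e2" using \<rho> by (simp add: pos_less_divide_eq mult.commute)
  then obtain r0 \<theta>0 where r0: "0 < r0" "r0 < e2" and \<theta>0: "pi \<le> \<theta>0" "\<theta>0 \<le> 2 * period - pi"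
    and rep: "unrolled r0 \<theta>0 = q x"
    using slit_representative[OF x(1) x_pos, of e2] x_small e e2 by (metis less_imp_le order_less_le_trans)
  define Q where "Q = slit_map \<theta>0"
  define \<Omega> where "\<Omega> = slit_disc \<theta>0"
  have dev_Q: "developing X \<Omega> Q" unfolding Q_def \<Omega>_def by (rule slit_developing[OF \<theta>0])
  define z0 where "z0 = of_real r0 * cis \<theta>0"
  have z0_div: "z0 / cis \<theta>0 = of_real r0" by (simp add: z0_def)
  have z0: "z0 \<in> \<Omega>" using r0 e2 unfolding \<Omega>_def slit_disc_def
    by (auto simp: z0_div complex_nonpos_Reals_iff) (simp add: z0_def norm_mult)
  have Qz0: "Q z0 = g (of_real t1 * v)"
    using r0(1) rep x(2) by (simp add: Q_def slit_map_def z0_div Arg_of_real) (simp add: z0_def norm_mult)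
  have t1_mem: "of_real t1 * v \<in> (\<lambda>t. of_real t * v) ` I" using t1(1) by blast
  obtain V f a b where at: "dev_at X ((\<lambda>t. of_real t * v) ` I) g (of_real t1 * v) V f a b"
    using g t1_mem unfolding developing_def by blast
  then have V: "(V, f) \<in> atlas X" "a > 0" by (auto simp: dev_at_def)
  have gV: "g (of_real t1 * v) \<in> V" using dev_at_value[OF at t1_mem] by simp
  obtain a' b' where at': "dev_at X \<Omega> Q z0 V f a' b'"
    using developing_chart[OF dev_Q z0 V(1)] gV Qz0 by metis
  then have a': "a' > 0" by (simp add: dev_at_def)
  \<comment> \<open>The ratio of the scales of \<open>g\<close> and \<open>Q\<close>: with it the
    ray \<open>g\<close> becomes the straight line \<open>L\<close> in the slit disc.\<close>
  define c where "c = a / a'"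
  have c: "c > 0" "a' * c = a" using V a' by (auto simp: c_def)
  define L where "L t = z0 + of_real (c * (t - t1)) * v" for t
  define d0 where "d0 = z0 - of_real (c * t1) * v"
  have L_affine: "of_real c * (of_real t * v) + d0 = L t" for t
    by (simp add: L_def d0_def algebra_simps)
  define G where "G w = Q (of_real c * w + d0)" for w
  define Z where "Z = {w. of_real c * w + d0 \<in> \<Omega>}"
  have dev_G: "developing X Z G" unfolding G_def Z_def by (rule developing_affine[OF dev_Q c(1)])
  have GL: "G (of_real t * v) = Q (L t)" "of_real t * v \<in> Z \<longleftrightarrow> L t \<in> \<Omega>" for t
    by (auto simp: G_def Z_def L_affine)
  have L1: "L t1 = z0" by (simp add: L_def)
  have at_G: "dev_at X Z G (of_real t1 * v) V f a (of_real a' * d0 + b')"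
  proof -
    have "dev_at X \<Omega> Q (of_real c * (of_real t1 * v) + d0) V f a' b'" using at' L1 by (simp only: L_affine)
    from dev_at_affine[OF this c(1)] show ?thesis unfolding G_def Z_def c(2) .
  qed
  have b: "b = of_real a' * d0 + b'"
  proof -
    have "f (G (of_real t1 * v)) = of_real a * (of_real t1 * v) + (of_real a' * d0 + b')"
      using dev_at_value[OF at_G] GL(2)[of t1] L1 z0 by auto
    moreover have "f (g (of_real t1 * v)) = of_real a * (of_real t1 * v) + b"
      using dev_at_value[OF at t1_mem] by simp
    moreover have "G (of_real t1 * v) = g (of_real t1 * v)" using GL(1) L1 Qz0 by simp
    ultimately show ?thesis by simp
  qed
  have follow: "g (of_real t * v) = Q (L t)"
    if t: "t \<in> I" "t1 \<le> t" and L: "\<And>t'. t1 \<le> t' \<Longrightarrow> t' \<le> t \<Longrightarrow> L t' \<in> \<Omega>" for t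
  proof -
    let ?S = "(\<lambda>t. of_real t * v) ` {t1..t}"
    have "{t1..t} \<subseteq> I" using mem_is_interval_1_I[OF I(1) t1(1) t(1)] by auto
    then have sub: "?S \<subseteq> (\<lambda>t. of_real t * v) ` I" by (rule image_mono)
    have subZ: "?S \<subseteq> Z" using L GL(2) by auto
    obtain d where d: "d > 0" "\<And>w. w \<in> (\<lambda>t. of_real t * v) ` I \<inter> ball (of_real t1 * v) d \<Longrightarrow> g w \<in> V \<and> f (g w) = of_real a * w + b"
      using at unfolding dev_at_def by auto
    obtain d' where d': "d' > 0" "\<And>w. w \<in> Z \<inter> ball (of_real t1 * v) d' \<Longrightarrow> G w \<in> V \<and> f (G w) = of_real a * w + b"
      using at_G unfolding dev_at_def b by auto
    have "g (of_real t * v) = G (of_real t * v)"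
    proof (rule developing_unique[OF _ developing_mono[OF g sub] developing_mono[OF dev_G subZ], of "of_real t1 * v" "min d d'"])
      show "connected ?S" by (intro connected_continuous_image continuous_intros) auto
      show "of_real t1 * v \<in> ?S" "of_real t * v \<in> ?S" using t(2) by auto
      show "min d d' > 0" using d(1) d'(1) by simp
      fix w assume w: "w \<in> ?S \<inter> ball (of_real t1 * v) (min d d')"
      have "g w \<in> V \<and> f (g w) = of_real a * w + b" by (rule d(2)) (use w sub in auto)
      moreover have "G w \<in> V \<and> f (G w) = of_real a * w + b" by (rule d'(2)) (use w subZ in auto)
      ultimately show "g w = G w" using chart_inj[OF V(1)] by (auto simp: inj_on_def)
    qed
    then show ?thesis using GL(1) by simp
  qed
  \<comment> \<open>If the line were still in the slit disc at the final time, the ray would tend to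
    a regular point there, and not to \<open>s\<close>.\<close>
  have no_limit: False
    if T: "I = {0..<T}" and L: "\<And>t'. t1 \<le> t' \<Longrightarrow> t' \<le> T \<Longrightarrow> L t' \<in> \<Omega>" for T
  proof -
    have t1T: "0 \<le> t1" "t1 < T" using t1(1) T by auto
    have TZ: "of_real T * v \<in> Z" using GL(2) L[of T] t1T by simp
    obtain A B where AB: "openin TX A" "openin TX B" "G (of_real T * v) \<in> A" "s \<in> B" "A \<inter> B = {}"
      using separate_singular[OF developing_regular[OF dev_G TZ] s_sing] by metis
    obtain d where d: "d > 0" "\<And>w. w \<in> Z \<inter> ball (of_real T * v) d \<Longrightarrow> G w \<in> A"
      using developing_continuous[OF dev_G TZ AB(1,3)] by blast
    obtain t2 where t2: "t2 \<in> I" "\<And>t. t \<in> I \<Longrightarrow> t2 \<le> t \<Longrightarrow> g (of_real t * v) \<in> B"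
      using conv[OF AB(2,4)] by blast
    define t where "t = max (max t1 t2) (T - d / 2)"
    have t: "t1 \<le> t" "t2 \<le> t" "t < T" "T - t < d" using t1T t2(1) T d(1) by (auto simp: t_def)
    then have tI: "t \<in> I" using T t1T by simp
    have "L t \<in> \<Omega>" using L[of t] t by simp
    then have "of_real t * v \<in> Z \<inter> ball (of_real T * v) d" using GL(2) t by (simp add: dist_ray[OF v(1)])
    then have "G (of_real t * v) \<in> A" by (rule d(2))
    moreover have "g (of_real t * v) = Q (L t)" using follow[OF tI t(1)] L t by auto
    moreover have "g (of_real t * v) \<in> B" using t2(2)[OF tI t(2)] .
    ultimately show False using AB(5) GL(1) by auto
  qed
  \<comment> \<open>The slit is avoided unless the ray is aimed at the apex.\<close>
  have radial: "cis \<theta>0 = - v"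
  proof (rule ccontr)
    assume not_radial: "cis \<theta>0 \<noteq> - v"
    have avoid: "z0 + of_real h * v \<in> \<Omega>" if h: "0 \<le> h" "norm (z0 + of_real h * v) < radius" for h
    proof (rule ccontr)
      assume "z0 + of_real h * v \<notin> \<Omega>"
      then have "(z0 + of_real h * v) / cis \<theta>0 \<in> \<real>\<^sub>\<le>\<^sub>0" using h(2) by (simp add: \<Omega>_def slit_disc_def)
      then obtain y where y: "y \<le> 0" "(z0 + of_real h * v) / cis \<theta>0 = of_real y" by (auto elim!: nonpos_Reals_cases)
      then have "z0 + of_real h * v = of_real y * cis \<theta>0" by (simp add: field_simps)
      then have hv: "of_real h * v = of_real (y - r0) * cis \<theta>0" by (simp add: z0_def algebra_simps)
      then have "norm (of_real h * v) = norm (of_real (y - r0) * cis \<theta>0)" by simp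
      then have hy: "h = r0 - y" using h(1) y(1) r0(1) v(1) by (simp add: norm_mult del: of_real_diff)
      have "of_real h * (v + cis \<theta>0) = 0" unfolding distrib_left hv by (simp add: hy algebra_simps)
      then have "v + cis \<theta>0 = 0" using hy y(1) r0(1) by simp
      then show False using not_radial by (simp add: add_eq_0_iff)
    qed
    define n where "n h = norm (z0 + of_real h * v)" for h
    have n0: "n 0 = r0" using r0 by (simp add: n_def z0_def norm_mult)
    have "n (e2 + r0) \<ge> e2"
      using norm_triangle_ineq4[of "z0 + of_real (e2 + r0) * v" z0] v(1) e2 r0
      by (simp add: n_def z0_def norm_mult del: of_real_add)
    then obtain h where h: "0 \<le> h" "n h = e2"
      using IVT'[of n 0 e2 "e2 + r0"] n0 r0 e2 unfolding n_def by (force intro!: continuous_intros)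
    have "h \<noteq> 0" using h n0 r0 by auto
    then have hpos: "h > 0" using h by simp
    have below: "n h' \<le> e2" if "0 \<le> h'" "h' \<le> h" for h'
    proof -
      have "z0 + of_real h' * v = (1 - h' / h) *\<^sub>R z0 + (h' / h) *\<^sub>R (z0 + of_real h * v)"
        using hpos by (simp add: scaleR_conv_of_real algebra_simps)
      moreover have "z0 \<in> cball 0 e2" "z0 + of_real h * v \<in> cball 0 e2"
        using h(2) n0 r0(2) by (auto simp: n_def)
      moreover have "0 \<le> h' / h" "h' / h \<le> 1" using that hpos by auto
      ultimately have "z0 + of_real h' * v \<in> cball 0 e2"
        using convexD_alt[OF convex_cball[of 0 e2]] by metis
      then show ?thesis by (simp add: n_def)
    qed
    define ts where "ts = t1 + h / c"
    have ts: "t1 < ts" using hpos c by (simp add: ts_def)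
    have L_in: "L t' \<in> \<Omega>" if "t1 \<le> t'" "t' \<le> ts" for t'
    proof -
      have h': "0 \<le> c * (t' - t1)" "c * (t' - t1) \<le> h" using that c by (auto simp: ts_def field_simps)
      then show ?thesis unfolding L_def using avoid[OF h'(1)] below[OF h'] e2(2) by (simp add: n_def)
    qed
    have "ts \<notin> I"
    proof
      assume tsI: "ts \<in> I"
      have gL: "g (of_real ts * v) = Q (L ts)" using follow[OF tsI] ts L_in by auto
      have "norm (L ts) = e2" using h(2) c by (simp add: L_def ts_def n_def)
      moreover define \<phi> where "\<phi> = \<theta>0 + Arg (L ts / cis \<theta>0)"
      ultimately have Q_un: "Q (L ts) = unrolled e2 \<phi>" by (simp add: Q_def slit_map_def)
      have "\<bar>Arg (L ts / cis \<theta>0)\<bar> < pi" using slit_polar(2) L_in[of ts] ts by (simp add: \<Omega>_def)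
      then have \<phi>: "0 < \<phi>" "\<phi> < 2 * period" using \<theta>0 by (auto simp: \<phi>_def)
      have inN: "unrolled e2 \<phi> \<in> N" using t1(2)[OF tsI] ts gL Q_un by auto
      show False
      proof (cases "\<phi> \<le> period")
        case True
        then show False using N(3)[OF unrolled_W(1)[OF e2 \<phi>]] inN e(2) by (simp add: unrolled_def)
      next
        case False
        then show False using N(3)[OF unrolled_W(2)[OF e2 \<phi>]] inN e(3) by (simp add: unrolled_def)
      qed
    qed
    then have "ts > 0" using t1(1) ts I(3) by force
    show False
    proof (rule ray_interval_cases[OF I])
      assume "I = {0..}"
      then show False using \<open>ts \<notin> I\<close> \<open>ts > 0\<close> by auto
    next
      fix T assume T: "I = {0..<T}"
      then have "T \<le> ts" using \<open>ts \<notin> I\<close> \<open>ts > 0\<close> by auto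
      then show False using no_limit[OF T] L_in by auto
    qed
  qed
  define T' where "T' = t1 + r0 / c"
  have T': "t1 < T'" using r0 c by (simp add: T'_def)
  have L_rad: "L t = of_real (c * (T' - t)) * cis \<theta>0" for t
  proof -
    have "c * (T' - t) = r0 - c * (t - t1)" using c(1) by (simp add: T'_def field_simps)
    moreover have "L t = of_real (r0 - c * (t - t1)) * cis \<theta>0"
      using radial by (simp add: L_def z0_def algebra_simps)
    ultimately show ?thesis by simp
  qed
  have range: "0 < c * (T' - t)" "c * (T' - t) \<le> r0" if "t1 \<le> t" "t < T'" for t
  proof -
    show "0 < c * (T' - t)" using that c(1) by simp
    have "c * (T' - t) \<le> c * (T' - t1)" using that c(1) by simp
    also have "\<dots> = r0" using c(1) by (simp add: T'_def)
    finally show "c * (T' - t) \<le> r0" .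
  qed
  have L_in: "L t \<in> \<Omega>" if "t1 \<le> t" "t < T'" for t
  proof -
    have "L t / cis \<theta>0 = of_real (c * (T' - t))" by (simp add: L_rad)
    moreover have "norm (L t) = c * (T' - t)"
      unfolding L_rad using range[OF that] by (simp only: norm_mult norm_of_real norm_cis abs_of_pos mult_1_right)
    ultimately show ?thesis unfolding \<Omega>_def slit_disc_def
      using range[OF that] r0(2) e2(2) by (simp add: complex_nonpos_Reals_iff del: of_real_mult)
  qed
  have QL: "Q (L t) = unrolled (c * (T' - t)) \<theta>0" if "t1 \<le> t" "t < T'" for t
  proof -
    have "L t / cis \<theta>0 = of_real (c * (T' - t))" by (simp add: L_rad)
    moreover have "norm (L t) = c * (T' - t)"
      unfolding L_rad using range[OF that] by (simp only: norm_mult norm_of_real norm_cis abs_of_pos mult_1_right)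
    ultimately show ?thesis using range[OF that] by (simp add: Q_def slit_map_def Arg_of_real del: of_real_mult)
  qed
  have "\<theta>0 \<noteq> period" using radial v(2) cis_period(3) by (metis minus_minus)
  \<comment> \<open>The radial coordinate in the sheet of the original cone.\<close>
  define c' where "c' = (if \<theta>0 < period then c else c / \<rho>)"
  define \<theta> where "\<theta> = (if \<theta>0 < period then \<theta>0 else \<theta>0 - period)"
  have c': "c' > 0" using c \<rho> by (simp add: c'_def)
  have \<theta>: "0 < \<theta>" "\<theta> < period" "cis \<theta> = - v"
  proof -
    have "0 < \<theta>0" using \<theta>0(1) pi_gt_zero by linarith
    moreover have "\<theta>0 < 2 * period" using \<theta>0(2) pi_gt_zero by linarith
    ultimately show "0 < \<theta>" "\<theta> < period" "cis \<theta> = - v"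
      using \<open>\<theta>0 \<noteq> period\<close> radial cis_period(1) by (auto simp: \<theta>_def)
  qed
  have un: "unrolled (c * (T' - t)) \<theta>0 = q (c' * (T' - t), \<theta>)" for t
    using \<open>\<theta>0 \<noteq> period\<close> by (auto simp: unrolled_def c'_def \<theta>_def)
  have g_eq: "g (of_real t * v) = q (c' * (T' - t), \<theta>)" if "t \<in> I" "t1 \<le> t" "t < T'" for t
    using follow[OF that(1,2)] L_in QL[OF that(2,3)] that un by auto
  have small: "c' * (T' - t1) < \<epsilon>"
  proof -
    have "c * (T' - t1) = r0" using c by (simp add: T'_def)
    moreover have "r0 < \<epsilon>" "r0 / \<rho> < \<epsilon>"
    proof -
      have "r0 < radius" using r0 e2 by simp
      then show "r0 < \<epsilon>" using radius by linarith
      have "r0 / \<rho> < radius / \<rho>" using \<open>r0 < radius\<close> \<rho> by (simp add: divide_strict_right_mono)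
      then show "r0 / \<rho> < \<epsilon>" using radius by linarith
    qed
    ultimately show ?thesis by (simp add: c'_def)
  qed
  \<comment> \<open>The radial description tends to \<open>s\<close> at \<open>T'\<close>, whereas
    \<open>g\<close> takes only regular values on \<open>I\<close>.\<close>
  have "T' \<notin> I"
  proof
    assume T'I: "T' \<in> I"
    have mem: "of_real T' * v \<in> (\<lambda>t. of_real t * v) ` I" using T'I by blast
    obtain A B where AB: "openin TX A" "openin TX B" "g (of_real T' * v) \<in> A" "s \<in> B" "A \<inter> B = {}"
      using separate_singular[OF regular[OF T'I] s_sing] by metis
    obtain d where d: "d > 0" "\<And>w. w \<in> (\<lambda>t. of_real t * v) ` I \<inter> ball (of_real T' * v) d \<Longrightarrow> g w \<in> A"
      using developing_continuous[OF g mem AB(1,3)] by blast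
    have "(0, \<theta>) \<in> W" "q (0, \<theta>) \<in> B" using W_tube[of 0 \<theta>] \<epsilon> \<theta> q_zero[of \<theta>] AB(4) by auto
    from q_continuous[OF this(1) AB(2) this(2)]
    obtain d' where d': "d' > 0" "\<And>y. y \<in> W \<Longrightarrow> dist y (0, \<theta>) < d' \<Longrightarrow> q y \<in> B" by blast
    define t where "t = max t1 (T' - min (d / 2) (d' / (2 * c')))"
    have "min (d / 2) (d' / (2 * c')) > 0" using d(1) d'(1) c' by simp
    then have t: "t1 \<le> t" "t < T'" using T' by (auto simp: t_def)
    have "T' - t \<le> min (d / 2) (d' / (2 * c'))" unfolding t_def by linarith
    then have td: "T' - t \<le> d / 2" "T' - t \<le> d' / (2 * c')" by simp_all
    have tI: "t \<in> I" using mem_is_interval_1_I[OF I(1) t1(1) T'I] t by simp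
    have "g (of_real t * v) \<in> A" using tI td(1) t d(1) by (intro d(2)) (auto simp: dist_ray[OF v(1)])
    moreover have "g (of_real t * v) \<in> B"
    proof -
      have pos: "0 \<le> c' * (T' - t)" using c' t by simp
      have "c' * (T' - t) \<le> c' * (T' - t1)" using c' t by simp
      then have "(c' * (T' - t), \<theta>) \<in> W" using W_tube[OF pos] small \<theta> by simp
      moreover have "c' * (T' - t) \<le> c' * (d' / (2 * c'))" using td(2) c' by (intro mult_left_mono) auto
      then have "c' * (T' - t) < d'" using c' d'(1) by simp
      then have "dist (c' * (T' - t), \<theta>) (0, \<theta>) < d'" using pos by (simp add: dist_Pair_Pair)
      ultimately show ?thesis using d'(2) g_eq[OF tI t] by simp
    qed
    ultimately show False using AB(5) by auto
  qed
  show ?thesis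
  proof (rule ray_interval_cases[OF I])
    assume "I = {0..}"
    then show ?thesis using \<open>T' \<notin> I\<close> T' t1(1) by auto
  next
    fix T assume T: "T > 0" "I = {0..<T}"
    have t1T: "0 \<le> t1" "t1 < T" using t1(1) T by auto
    have "T \<le> T'" using \<open>T' \<notin> I\<close> T T' t1T by auto
    moreover have "\<not> T < T'"
    proof
      assume "T < T'"
      then show False using no_limit[OF T(2)] L_in by auto
    qed
    ultimately have "T' = T" by simp
    then show ?thesis
      using that[OF T c' \<theta> t1T] small g_eq T t1T by auto
  qed
qed

end

section \<open>Rays ending at singularities\<close>

lemma closed_segment_ray:
  fixes v :: complex
  assumes "0 \<le> t0"
  shows "closed_segment 0 (of_real t0 * v) = (\<lambda>t. of_real t * v) ` {0..t0}"
proof (cases "t0 = 0")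
  case False
  then have t0: "t0 > 0" using assms by simp
  show ?thesis
  proof (intro equalityI subsetI)
    fix z assume "z \<in> closed_segment 0 (of_real t0 * v)"
    then obtain l where "0 \<le> l" "l \<le> 1" "z = of_real (l * t0) * v"
      by (auto simp: in_segment scaleR_conv_of_real mult.assoc)
    then show "z \<in> (\<lambda>t. of_real t * v) ` {0..t0}" using t0 by (intro image_eqI[of _ _ "l * t0"]) auto
  next
    fix z assume "z \<in> (\<lambda>t. of_real t * v) ` {0..t0}"
    then obtain t where "t \<in> {0..t0}" "z = of_real t * v" by blast
    then show "z \<in> closed_segment 0 (of_real t0 * v)"
      unfolding in_segment using t0 by (intro exI[of _ "t / t0"]) (auto simp: scaleR_conv_of_real)
  qed
qed simp

text \<open>Angles with equal \<open>cis\<close> differ by multiples of \<open>2 * pi\<close>, so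
  the number of completed turns tells them apart.\<close>

lemma angles_bound:
  "finite {\<theta>. 0 < \<theta> \<and> \<theta> < 2 * pi * real m \<and> cis \<theta> = w}"
  "card {\<theta>. 0 < \<theta> \<and> \<theta> < 2 * pi * real m \<and> cis \<theta> = w} \<le> m"
proof -
  let ?A = "{\<theta>. 0 < \<theta> \<and> \<theta> < 2 * pi * real m \<and> cis \<theta> = w}"
  let ?f = "\<lambda>\<theta>. nat \<lfloor>\<theta> / (2 * pi)\<rfloor>"
  have inj: "inj_on ?f ?A"
  proof (rule inj_onI)
    fix x y assume x: "x \<in> ?A" and y: "y \<in> ?A" and eq: "?f x = ?f y"
    have "cis x = cis y" using x y by simp
    then obtain n :: int where n: "x = y + 2 * pi * n"
      using sin_cos_eq_iff[of x y] by (auto simp: cis.ctr complex_eq_iff)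
    have "0 \<le> x / (2 * pi)" "0 \<le> y / (2 * pi)" using x y by auto
    then have "\<lfloor>x / (2 * pi)\<rfloor> = \<lfloor>y / (2 * pi)\<rfloor>" using eq by (metis floor_mono floor_zero nat_eq_iff2 eq_nat_nat_iff zero_le_floor)
    moreover have "x / (2 * pi) = y / (2 * pi) + of_int n" using n by (simp add: field_simps)
    ultimately have "n = 0" by simp
    then show "x = y" using n by simp
  qed
  have sub: "?f ` ?A \<subseteq> {..<m}"
  proof
    fix i assume "i \<in> ?f ` ?A"
    then obtain \<theta> where \<theta>: "0 < \<theta>" "\<theta> < 2 * pi * real m" "i = ?f \<theta>" by auto
    then have "\<theta> / (2 * pi) < real m" by (simp add: pos_divide_less_eq mult.commute)
    then have "\<lfloor>\<theta> / (2 * pi)\<rfloor> < int m" by (simp add: floor_less_iff)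
    moreover have "0 \<le> \<lfloor>\<theta> / (2 * pi)\<rfloor>" using \<theta>(1) by simp
    ultimately show "i \<in> {..<m}" unfolding \<theta>(3) by (simp add: nat_less_iff)
  qed
  show "finite ?A" using inj_on_finite[OF inj sub] by simp
  show "card ?A \<le> m" using card_inj_on_le[OF inj sub] by simp
qed

context crossing
begin

text \<open>The scale of \<open>g\<close> at its starting point need not be that of
  \<open>E0\<close>. The base disc is recentred at \<open>\<tau> u\<close> and rescaled by the
  quotient \<open>\<alpha>\<close> of the two slopes; then \<open>extend_along\<close> thickens the
  ray.\<close>

lemma extend_segment:
  assumes \<tau>: "\<bar>\<tau>\<bar> < \<delta>" and t0: "t0 \<ge> 0"
    and g: "developing X ((\<lambda>t. of_real t * v) ` {0..t0}) g" and g0: "g 0 = E0 (of_real \<tau> * u)"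
  obtains \<alpha> d D E where "\<alpha> > 0" "star_domain X d (\<lambda>w. E0 (of_real \<alpha> * w + of_real \<tau> * u)) D E"
    "of_real t0 * v \<in> D" "\<And>t. 0 \<le> t \<Longrightarrow> t \<le> t0 \<Longrightarrow> E (of_real t * v) = g (of_real t * v)"
proof -
  let ?R = "(\<lambda>t. of_real t * v) ` {0..t0}"
  have zero: "0 \<in> ?R" using t0 by (intro image_eqI[of _ _ 0]) auto
  have base: "of_real \<tau> * u \<in> ball 0 \<delta>" using \<tau> norm_u by (simp add: norm_mult)
  obtain U f a b where at: "dev_at X ?R g 0 U f a b" using g zero unfolding developing_def by blast
  then have U: "(U, f) \<in> atlas X" "a > 0" by (auto simp: dev_at_def)
  have gU: "g 0 \<in> U" "f (g 0) = b" using dev_at_value[OF at zero] by auto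
  obtain a0 b0 where at0: "dev_at X (ball 0 \<delta>) E0 (of_real \<tau> * u) U f a0 b0"
    using developing_chart[OF base_dev base U(1)] gU(1) g0 by metis
  then have a0: "a0 > 0" by (simp add: dev_at_def)
  define \<alpha> where "\<alpha> = a / a0"
  have \<alpha>: "\<alpha> > 0" "a0 * \<alpha> = a" using U a0 by (auto simp: \<alpha>_def)
  define e where "e = (\<lambda>w. E0 (of_real \<alpha> * w + of_real \<tau> * u))"
  define Z where "Z = {w. of_real \<alpha> * w + of_real \<tau> * u \<in> ball 0 \<delta>}"
  have dev_e: "developing X Z e" unfolding e_def Z_def by (rule developing_affine[OF base_dev \<alpha>(1)])
  have "dev_at X (ball 0 \<delta>) E0 (of_real \<alpha> * 0 + of_real \<tau> * u) U f a0 b0" using at0 by simp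
  from dev_at_affine[OF this \<alpha>(1)]
  have at_e: "dev_at X Z e 0 U f a (of_real a0 * (of_real \<tau> * u) + b0)" unfolding e_def Z_def \<alpha>(2) .
  have "0 \<in> Z" using base by (simp add: Z_def)
  from dev_at_value[OF at_e this] have b: "of_real a0 * (of_real \<tau> * u) + b0 = b"
    using gU g0 by (simp add: e_def)
  define d where "d = (\<delta> - \<bar>\<tau>\<bar>) / \<alpha>"
  have d: "d > 0" using \<tau> \<alpha> by (simp add: d_def)
  have ball: "ball 0 d \<subseteq> Z"
  proof
    fix w :: complex assume "w \<in> ball 0 d"
    then have "\<alpha> * norm w < \<delta> - \<bar>\<tau>\<bar>" using \<alpha> by (simp add: d_def pos_less_divide_eq mult.commute)
    moreover have "norm (of_real \<alpha> * w + of_real \<tau> * u) \<le> \<alpha> * norm w + \<bar>\<tau>\<bar>"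
      using norm_triangle_ineq[of "of_real \<alpha> * w" "of_real \<tau> * u"] \<alpha> norm_u by (simp add: norm_mult)
    ultimately show "w \<in> Z" by (simp add: Z_def)
  qed
  obtain D E where D: "star_domain X d e D E"
    using maximal_domain[OF d developing_mono[OF dev_e ball]] by metis
  obtain r1 where r1: "r1 > 0" "\<And>w. w \<in> ?R \<inter> ball 0 r1 \<Longrightarrow> g w \<in> U \<and> f (g w) = of_real a * w + b"
    using at unfolding dev_at_def by auto
  obtain r2 where r2: "r2 > 0" "\<And>w. w \<in> Z \<inter> ball 0 r2 \<Longrightarrow> e w \<in> U \<and> f (e w) = of_real a * w + b"
    using at_e unfolding dev_at_def b by auto
  note seg = closed_segment_ray[OF t0, of v]
  have g': "developing X (closed_segment 0 (of_real t0 * v)) g" using g by (simp only: seg)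
  have near: "g w = e w" if w: "w \<in> closed_segment 0 (of_real t0 * v) \<inter> ball 0 (min d (min r1 r2))" for w
  proof -
    have "g w \<in> U \<and> f (g w) = of_real a * w + b" by (rule r1(2)) (use w seg in auto)
    moreover have "e w \<in> U \<and> f (e w) = of_real a * w + b" by (rule r2(2)) (use w ball in auto)
    ultimately show ?thesis using chart_inj[OF U(1)] by (auto simp: inj_on_def)
  qed
  have mpos: "min d (min r1 r2) > 0" using d r1 r2 by simp
  note ext = star_domain.extend_along[OF D g' mpos near]
  show ?thesis
  proof (rule that[OF \<alpha>(1) D[unfolded e_def] ext(1)])
    show "E (of_real t * v) = g (of_real t * v)" if "0 \<le> t" "t \<le> t0" for t
      by (rule ext(2)) (use that in \<open>auto simp: seg\<close>)
  qed
qed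

text \<open>Seen backwards from \<open>x\<close> the rays are nested, and each meets
  \<open>B\<close> after chart length \<open>a \<tau> * t \<tau>\<close>.
  \<open>bounded_returns\<close> allows at most \<open>k\<close> such lengths, and equal lengths
  mean equal starting points, hence equal \<open>\<tau>\<close> by injectivity of the base
  disc.\<close>

lemma common_point_bound:
  assumes v: "norm v = 1" "v \<noteq> u" "v \<noteq> - u" and F: "finite F"
    and \<tau>: "\<And>\<tau>. \<tau> \<in> F \<Longrightarrow> \<bar>\<tau>\<bar> < \<delta>"
    and t: "\<And>\<tau>. \<tau> \<in> F \<Longrightarrow> 0 < t \<tau>"
    and g: "\<And>\<tau>. \<tau> \<in> F \<Longrightarrow> developing X ((\<lambda>t. of_real t * v) ` {0..t \<tau>}) (g \<tau>)"
    and g0: "\<And>\<tau>. \<tau> \<in> F \<Longrightarrow> g \<tau> 0 = E0 (of_real \<tau> * u)"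
    and x: "\<And>\<tau>. \<tau> \<in> F \<Longrightarrow> g \<tau> (of_real (t \<tau>) * v) = x"
  shows "card F \<le> k"
proof (cases "F = {}")
  case False
  have mem: "of_real (t \<tau>) * v \<in> (\<lambda>t. of_real t * v) ` {0..t \<tau>}" if "\<tau> \<in> F" for \<tau>
    using t[OF that] by auto
  have "x \<in> regular_part X" using False developing_regular[OF g mem] x by fastforce
  then obtain U f where U: "(U, f) \<in> atlas X" "x \<in> U" using chart_exists by blast
  define P where "P \<tau> h \<sigma> a \<longleftrightarrow> developing X ((\<lambda>t. of_real t * v) ` {-\<sigma>..0}) h \<and>
     dev_at X ((\<lambda>t. of_real t * v) ` {-\<sigma>..0}) h 0 U f a (f x) \<and> t \<tau> < \<sigma> \<and>
     h (of_real (- t \<tau>) * v) = E0 (of_real \<tau> * u)" for \<tau> h \<sigma> a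
  have "\<exists>h \<sigma> a. P \<tau> h \<sigma> a" if F: "\<tau> \<in> F" for \<tau>
  proof -
    obtain \<alpha> d D E where \<alpha>: "\<alpha> > 0" and star: "star_domain X d (\<lambda>w. E0 (of_real \<alpha> * w + of_real \<tau> * u)) D E"
      and tD: "of_real (t \<tau>) * v \<in> D"
      and Eg: "\<And>s. 0 \<le> s \<Longrightarrow> s \<le> t \<tau> \<Longrightarrow> E (of_real s * v) = g \<tau> (of_real s * v)"
      using extend_segment[OF \<tau>[OF F] less_imp_le[OF t[OF F]] g[OF F] g0[OF F]] by metis
    interpret D: star_domain X d "\<lambda>w. E0 (of_real \<alpha> * w + of_real \<tau> * u)" D E by (rule star)
    define h where "h = (\<lambda>w. E (of_real 1 * w + of_real (t \<tau>) * v))"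
    \<comment> \<open>The thickened domain extends the ray a little behind its starting point, so
      that the crossing there is an interior time.\<close>
    define \<sigma> where "\<sigma> = t \<tau> + d / 2"
    let ?R = "(\<lambda>s. of_real s * v) ` {-\<sigma>..0}"
    have sub: "?R \<subseteq> {w. of_real 1 * w + of_real (t \<tau>) * v \<in> D}"
    proof
      fix w assume "w \<in> ?R"
      then obtain s where s: "s \<in> {-\<sigma>..0}" "w = of_real s * v" by blast
      have w: "of_real 1 * w + of_real (t \<tau>) * v = of_real (s + t \<tau>) * v" by (simp add: s(2) algebra_simps)
      have "of_real (s + t \<tau>) * v \<in> D"
      proof (cases "0 \<le> s + t \<tau>")
        case True
        then have "s + t \<tau> \<in> {0..t \<tau>}" using s(1) by simp
        then have "of_real (s + t \<tau>) * v \<in> closed_segment 0 (of_real (t \<tau>) * v)"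
          unfolding closed_segment_ray[OF less_imp_le[OF t[OF F]]] by (rule imageI)
        then show ?thesis using D.star_D[OF tD] by blast
      next
        case False
        then have "norm (of_real (s + t \<tau>) * v) < d"
          using s(1) v(1) D.\<delta> by (simp only: norm_mult norm_of_real) (simp add: \<sigma>_def)
        then show ?thesis using D.ball_D by auto
      qed
      then show "w \<in> {w. of_real 1 * w + of_real (t \<tau>) * v \<in> D}" by (simp only: w mem_Collect_eq)
    qed
    have dev_h: "developing X ?R h" unfolding h_def
      by (rule developing_mono[OF developing_affine[OF D.dev_D] sub]) simp
    have zero: "0 \<in> ?R" using t[OF F] D.\<delta> by (intro image_eqI[of _ _ 0]) (auto simp: \<sigma>_def)
    have h0: "h 0 = x" using Eg[of "t \<tau>"] t[OF F] x[OF F] by (simp add: h_def)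
    obtain a b where at: "dev_at X ?R h 0 U f a b"
      using developing_chart[OF dev_h zero U(1)] U(2) h0 by metis
    have "b = f x" using dev_at_value[OF at zero] h0 by simp
    moreover have "h (of_real (- t \<tau>) * v) = E0 (of_real \<tau> * u)"
      using Eg[of 0] t[OF F] g0[OF F] by (simp add: h_def)
    ultimately have "P \<tau> h \<sigma> a" unfolding P_def using dev_h at D.\<delta> by (auto simp: \<sigma>_def)
    then show ?thesis by blast
  qed
  then obtain h \<sigma> a where P: "\<And>\<tau>. \<tau> \<in> F \<Longrightarrow> P \<tau> (h \<tau>) (\<sigma> \<tau>) (a \<tau>)" by metis
  have card: "card ((\<lambda>\<tau>. a \<tau> * t \<tau>) ` F) \<le> k"
  proof (rule bounded_returns[OF v(1) crossings[OF v(2,3)] F, where \<sigma> = \<sigma> and g = h and U = U and f = f and b = "f x"])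
    show "h \<tau> (of_real (- t \<tau>) * v) \<in> B" if "\<tau> \<in> F" for \<tau>
      using P[OF that] base_cross[OF \<tau>[OF that]] by (simp add: P_def)
  qed (use P t in \<open>auto simp: P_def\<close>)
  have "inj_on (\<lambda>\<tau>. a \<tau> * t \<tau>) F"
  proof (rule inj_onI)
    fix i j assume i: "i \<in> F" and j: "j \<in> F" and eq: "a i * t i = a j * t j"
    have Pi: "developing X ((\<lambda>t. of_real t * v) ` {-\<sigma> i..0}) (h i)"
      "dev_at X ((\<lambda>t. of_real t * v) ` {-\<sigma> i..0}) (h i) 0 U f (a i) (f x)" "t i < \<sigma> i"
      "h i (of_real (- t i) * v) = E0 (of_real i * u)" "a i > 0" if "i \<in> F" for i
      using P[OF that] by (auto simp: P_def dev_at_def)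
    have "h i (of_real (- (a i * t i) / a i) * v) = h j (of_real (- (a i * t i) / a j) * v)"
    proof (rule backward_unique[OF v(1) Pi(1,2)[OF i] Pi(1,2)[OF j]])
      show "0 \<le> a i * t i" using Pi(5)[OF i] t[OF i] by simp
      show "a i * t i \<le> a i * \<sigma> i" using Pi(3,5)[OF i] by simp
      show "a i * t i \<le> a j * \<sigma> j" unfolding eq using Pi(3,5)[OF j] by simp
    qed
    moreover have "- (a i * t i) / a i = - t i" using Pi(5)[OF i] by simp
    moreover have "- (a i * t i) / a j = - t j" using Pi(5)[OF j] by (simp add: eq)
    ultimately have "E0 (of_real i * u) = E0 (of_real j * u)" using Pi(4)[OF i] Pi(4)[OF j] by metis
    moreover have "of_real i * u \<in> ball 0 \<delta>" "of_real j * u \<in> ball 0 \<delta>"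
      using \<tau>[OF i] \<tau>[OF j] norm_u by (auto simp: norm_mult)
    ultimately have "complex_of_real i * u = of_real j * u" by (rule inj_onD[OF base_inj])
    then show "i = j" using norm_u by auto
  qed
  then show ?thesis using card by (simp add: card_image)
qed simp

end

context cone_point
begin

text \<open>A radius of the cone run towards the apex; \<open>Re (z * cnj v)\<close> recovers
  \<open>t\<close> from \<open>z = t v\<close>.\<close>

lemma radial_developing:
  assumes v: "norm v = 1" and \<theta>: "0 < \<theta>" "\<theta> < period" "cis \<theta> = - v" and c: "c > 0"
  shows "developing X ((\<lambda>t. of_real t * v) ` {t. 0 < c * (h - t) \<and> c * (h - t) < \<epsilon>})
    (\<lambda>z. q (c * (h - Re (z * cnj v)), \<theta>))"
  unfolding developing_def
proof
  let ?S = "(\<lambda>t. of_real t * v) ` {t. 0 < c * (h - t) \<and> c * (h - t) < \<epsilon>}"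
  let ?g = "\<lambda>z. q (c * (h - Re (z * cnj v)), \<theta>)"
  have Re_ray: "Re (of_real t * v * cnj v) = t" for t
    using v by (simp add: mult.assoc complex_norm_square[symmetric])
  fix z assume "z \<in> ?S"
  then obtain t where t: "0 < c * (h - t)" "c * (h - t) < \<epsilon>" "z = of_real t * v" by auto
  have W: "(c * (h - t), \<theta>) \<in> W" using W_tube t \<theta> by simp
  obtain V f where V: "(V, f) \<in> atlas X" "q (c * (h - t), \<theta>) \<in> V"
    using chart_exists[OF q_regular[OF W]] t(1) by auto
  obtain a b d where a: "a > 0" "d > 0"
    "\<And>y. y \<in> W \<Longrightarrow> dist y (c * (h - t), \<theta>) < d \<Longrightarrow> q y \<in> V \<and> f (q y) = of_real a * (of_real (fst y) * cis (snd y)) + b"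
    using q_chart[OF W _ V] t(1) by (metis fst_conv)
  have "?g w \<in> V \<and> f (?g w) = of_real (a * c) * w + (b - of_real (a * c * h) * v)" if w: "w \<in> ?S \<inter> ball z (d / c)" for w
  proof -
    obtain t' where t': "0 < c * (h - t')" "c * (h - t') < \<epsilon>" "w = of_real t' * v" using w by auto
    have "\<bar>t - t'\<bar> < d / c" using w by (simp add: t(3) t'(3) dist_ray[OF v])
    then have "c * \<bar>t - t'\<bar> < d" using c by (simp add: pos_less_divide_eq mult.commute)
    moreover have "c * (h - t') - c * (h - t) = c * (t - t')" by (simp add: algebra_simps)
    ultimately have "dist (c * (h - t'), \<theta>) (c * (h - t), \<theta>) < d"
      using c by (simp add: dist_Pair_Pair dist_real_def abs_mult)
    moreover have "(c * (h - t'), \<theta>) \<in> W" using W_tube t' \<theta> by simp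
    ultimately have "q (c * (h - t'), \<theta>) \<in> V \<and>
        f (q (c * (h - t'), \<theta>)) = of_real a * (of_real (c * (h - t')) * (- v)) + b"
      using a(3)[of "(c * (h - t'), \<theta>)"] \<theta>(3) by simp
    then show ?thesis using Re_ray[of t'] by (simp add: t'(3) algebra_simps)
  qed
  then have "dev_at X ?S ?g z V f (a * c) (b - of_real (a * c * h) * v)"
    unfolding dev_at_def using V(1) a(1,2) c by (intro conjI exI[of _ "d / c"]) auto
  then show "\<exists>U f a b. dev_at X ?S ?g z U f a b" by blast
qed

end

section \<open>Counting and perturbing singular rays\<close>

context crossing
begin

text \<open>A singular ray ends along one of finitely many pairs of a cone point and an angle, and
  rays with the same end share a point close to the apex, so \<open>common_point_bound\<close>
  leaves at most \<open>k\<close> for each end. The bound is uniform in \<open>v\<close>, as the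
  later maximisation requires. Rays of direction \<open>- 1\<close> would end on the cut, hence
  their exclusion.\<close>

lemma singular_rays_bounded:
  obtains N :: nat where "\<And>v. norm v = 1 \<Longrightarrow> v \<noteq> u \<Longrightarrow> v \<noteq> - u \<Longrightarrow> v \<noteq> - 1 \<Longrightarrow>
    finite {\<tau>. \<bar>\<tau>\<bar> < \<delta> \<and> singular_ray v (E0 (of_real \<tau> * u))} \<and>
    card {\<tau>. \<bar>\<tau>\<bar> < \<delta> \<and> singular_ray v (E0 (of_real \<tau> * u))} \<le> N"
proof -
  have "\<forall>s\<in>sings X. \<exists>c. cone_point X s (fst c) (fst (snd c)) (fst (snd (snd c)))
      (fst (snd (snd (snd c)))) (fst (snd (snd (snd (snd c))))) (snd (snd (snd (snd (snd c)))))"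
  proof
    fix s assume "s \<in> sings X"
    then obtain m \<rho> W U q \<epsilon> where "cone_point X s m \<rho> W U q \<epsilon>" using cone_point_exists by blast
    then show "\<exists>c. cone_point X s (fst c) (fst (snd c)) (fst (snd (snd c)))
      (fst (snd (snd (snd c)))) (fst (snd (snd (snd (snd c))))) (snd (snd (snd (snd (snd c)))))"
      by (intro exI[of _ "(m, \<rho>, W, U, q, \<epsilon>)"]) simp
  qed
  from bchoice[OF this] obtain c where c: "\<forall>s\<in>sings X. cone_point X s (fst (c s)) (fst (snd (c s)))
      (fst (snd (snd (c s)))) (fst (snd (snd (snd (c s))))) (fst (snd (snd (snd (snd (c s))))))
      (snd (snd (snd (snd (snd (c s))))))" ..
  define M where "M s = fst (c s)" for s
  define q where "q s = fst (snd (snd (snd (snd (c s)))))" for s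
  define ep where "ep s = snd (snd (snd (snd (snd (c s)))))" for s
  define N where "N = (\<Sum>s\<in>sings X. M s) * k"
  show ?thesis
  proof (rule that[of N])
    fix v :: complex assume v: "norm v = 1" "v \<noteq> u" "v \<noteq> - u" "v \<noteq> - 1"
    define A where "A = {\<tau>. \<bar>\<tau>\<bar> < \<delta> \<and> singular_ray v (E0 (of_real \<tau> * u))}"
    define ends where "ends = Sigma (sings X) (\<lambda>s. {\<theta>. 0 < \<theta> \<and> \<theta> < 2 * pi * real (M s) \<and> cis \<theta> = - v})"
    have ends: "finite ends" "card ends \<le> (\<Sum>s\<in>sings X. M s)"
      unfolding ends_def using finite_sings angles_bound
      by (auto simp: card_SigmaI intro!: sum_mono finite_SigmaI)
    have "\<exists>e T c t1 g. e \<in> ends \<and> c > 0 \<and> 0 \<le> t1 \<and> t1 < T \<and> developing X ((\<lambda>t. of_real t * v) ` {0..<T}) g \<and>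
        g 0 = E0 (of_real \<tau> * u) \<and> (\<forall>t. t1 \<le> t \<longrightarrow> t < T \<longrightarrow> g (of_real t * v) = q (fst e) (c * (T - t), snd e))"
      if \<tau>: "\<tau> \<in> A" for \<tau>
    proof -
      obtain I g s where I: "is_interval I" "0 \<in> I" "I \<subseteq> {0..}" "\<forall>t\<in>I. \<exists>t'\<in>I. t < t'"
        and g: "developing X ((\<lambda>t. of_real t * v) ` I) g" "g 0 = E0 (of_real \<tau> * u)" and s: "s \<in> sings X"
        and conv: "\<forall>W. openin TX W \<longrightarrow> s \<in> W \<longrightarrow> (\<exists>t0\<in>I. \<forall>t\<in>I. t0 \<le> t \<longrightarrow> g (of_real t * v) \<in> W)"
      proof -
        have "singular_ray v (E0 (of_real \<tau> * u))" using \<tau> by (simp add: A_def)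
        then show ?thesis by (rule singular_rayE) (rule that)
      qed
      interpret cone_point X s "M s" "fst (snd (c s))" "fst (snd (snd (c s)))" "fst (snd (snd (snd (c s))))"
          "q s" "ep s"
        using c s by (simp add: M_def q_def ep_def)
      obtain T c' \<theta> t1 where T: "T > 0" "I = {0..<T}" "c' > 0" "0 < \<theta>" "\<theta> < period" "cis \<theta> = - v"
        "0 \<le> t1" "t1 < T" "c' * (T - t1) < ep s"
        "\<And>t. t1 \<le> t \<Longrightarrow> t < T \<Longrightarrow> g (of_real t * v) = q s (c' * (T - t), \<theta>)"
      proof (rule singular_ray_radial[OF v(1,4) I(1-3) _ g(1)])
        show "\<exists>t'\<in>I. t < t'" if "t \<in> I" for t using I(4) that by blast
        show "\<exists>t0\<in>I. \<forall>t\<in>I. t0 \<le> t \<longrightarrow> g (of_real t * v) \<in> W" if "openin TX W" "s \<in> W" for W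
          using conv that by blast
      qed (rule that)
      have "(s, \<theta>) \<in> ends" using s T by (simp add: ends_def)
      then show ?thesis
        using T g by (intro exI[of _ "(s, \<theta>)"] exI[of _ T] exI[of _ c'] exI[of _ t1] exI[of _ g]) auto
    qed
    then have "\<forall>\<tau>\<in>A. \<exists>e T c t1 g. e \<in> ends \<and> c > 0 \<and> 0 \<le> t1 \<and> t1 < T \<and> developing X ((\<lambda>t. of_real t * v) ` {0..<T}) g \<and>
        g 0 = E0 (of_real \<tau> * u) \<and> (\<forall>t. t1 \<le> t \<longrightarrow> t < T \<longrightarrow> g (of_real t * v) = q (fst e) (c * (T - t), snd e))" by blast
    then obtain e T c t1 g where data: "\<And>\<tau>. \<tau> \<in> A \<Longrightarrow> e \<tau> \<in> ends \<and> c \<tau> > 0 \<and> 0 \<le> t1 \<tau> \<and> t1 \<tau> < T \<tau> \<and>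
        developing X ((\<lambda>t. of_real t * v) ` {0..<T \<tau>}) (g \<tau>) \<and> g \<tau> 0 = E0 (of_real \<tau> * u) \<and>
        (\<forall>t. t1 \<tau> \<le> t \<longrightarrow> t < T \<tau> \<longrightarrow> g \<tau> (of_real t * v) = q (fst (e \<tau>)) (c \<tau> * (T \<tau> - t), snd (e \<tau>)))"
      by metis
    have fibre: "card F \<le> k" if F: "finite F" "F \<subseteq> A" "\<And>\<tau>. \<tau> \<in> F \<Longrightarrow> e \<tau> = p" for F p
    proof (cases "F = {}")
      case False
      \<comment> \<open>A radius that each of these rays passes on its final radial stretch; at that
        radius they all meet.\<close>
      define r where "r = Min ((\<lambda>\<tau>. c \<tau> * (T \<tau> - t1 \<tau>)) ` F) / 2"
      have pos: "0 < c \<tau> * (T \<tau> - t1 \<tau>)" if "\<tau> \<in> F" for \<tau> using data[of \<tau>] that F by auto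
      then have r: "r > 0" using F(1) False by (simp add: r_def)
      have r_less: "r < c \<tau> * (T \<tau> - t1 \<tau>)" if "\<tau> \<in> F" for \<tau>
      proof -
        have "Min ((\<lambda>\<tau>. c \<tau> * (T \<tau> - t1 \<tau>)) ` F) \<le> c \<tau> * (T \<tau> - t1 \<tau>)" using F(1) that by auto
        then show ?thesis using r by (simp add: r_def)
      qed
      define t where "t \<tau> = T \<tau> - r / c \<tau>" for \<tau>
      have cpos: "c \<tau> > 0" if "\<tau> \<in> F" for \<tau> using data[of \<tau>] that F by auto
      have t: "t1 \<tau> < t \<tau>" "t \<tau> < T \<tau>" "c \<tau> * (T \<tau> - t \<tau>) = r" if "\<tau> \<in> F" for \<tau>
      proof -
        have "r / c \<tau> < T \<tau> - t1 \<tau>" using r_less[OF that] cpos[OF that] by (simp add: pos_divide_less_eq mult.commute)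
        then show "t1 \<tau> < t \<tau>" by (simp add: t_def)
        show "t \<tau> < T \<tau>" "c \<tau> * (T \<tau> - t \<tau>) = r" using r cpos[OF that] by (auto simp: t_def)
      qed
      show ?thesis
      proof (rule common_point_bound[OF v(1-3) F(1), where t = t and g = g and x = "q (fst p) (r, snd p)"])
        fix \<tau> assume \<tau>: "\<tau> \<in> F"
        then have \<tau>A: "\<tau> \<in> A" using F(2) by blast
        show "\<bar>\<tau>\<bar> < \<delta>" using \<tau>A by (simp add: A_def)
        show "0 < t \<tau>" using data[OF \<tau>A] t[OF \<tau>] by linarith
        have "{0..t \<tau>} \<subseteq> {0..<T \<tau>}" using t(2)[OF \<tau>] by auto
        then show "developing X ((\<lambda>t. of_real t * v) ` {0..t \<tau>}) (g \<tau>)"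
          using data[OF \<tau>A] developing_mono image_mono by metis
        show "g \<tau> 0 = E0 (of_real \<tau> * u)" using data[OF \<tau>A] by blast
        have "g \<tau> (of_real (t \<tau>) * v) = q (fst (e \<tau>)) (c \<tau> * (T \<tau> - t \<tau>), snd (e \<tau>))"
          using data[OF \<tau>A] t[OF \<tau>] by (meson less_imp_le)
        then show "g \<tau> (of_real (t \<tau>) * v) = q (fst p) (r, snd p)" using t(3)[OF \<tau>] F(3)[OF \<tau>] by simp
      qed
    qed simp
    \<comment> \<open>Only finite subsets are counted, since finiteness of \<open>A\<close> itself
      is obtained from this bound.\<close>
    have "card F \<le> N" if F: "finite F" "F \<subseteq> A" for F
    proof -
      have "F = (\<Union>p\<in>ends. {\<tau> \<in> F. e \<tau> = p})" using data F(2) by auto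
      then have "card F = card (\<Union>p\<in>ends. {\<tau> \<in> F. e \<tau> = p})" by (rule arg_cong)
      also have "\<dots> \<le> (\<Sum>p\<in>ends. card {\<tau> \<in> F. e \<tau> = p})" by (rule card_UN_le[OF ends(1)])
      also have "\<dots> \<le> of_nat (card ends) * k"
      proof (rule sum_bounded_above)
        show "card {\<tau> \<in> F. e \<tau> = p} \<le> k" for p by (rule fibre) (use F in auto)
      qed
      also have "\<dots> = card ends * k" by simp
      also have "\<dots> \<le> N" unfolding N_def using ends(2) by (rule mult_le_mono1)
      finally show ?thesis .
    qed
    then show "finite A \<and> card A \<le> N" using finite_if_finite_subsets_card_bdd[of A N] by blast
  qed
qed

lemma continuous_near:
  fixes f :: "complex \<Rightarrow> real"
  assumes "isCont f v" "e > 0"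
  shows "\<exists>\<eta>>0. \<forall>v'. norm (v' - v) < \<eta> \<longrightarrow> \<bar>f v' - f v\<bar> < e"
  using assms unfolding continuous_at_eps_delta dist_norm real_norm_def by blast

text \<open>In the plane the ray is aimed at \<open>T v\<close>, the position of the apex. A ray of
  direction \<open>v'\<close> with the same aim starts at \<open>\<kappa> v'\<close> on the line of
  direction \<open>u\<close>, where \<open>T v = \<kappa> v' u + h1 v' v'\<close>. It is developed
  by \<open>E\<close> at first and by radial coordinates of slightly turned angle near the
  apex.\<close>

lemma singular_ray_persists:
  assumes v: "norm v = 1" "v \<noteq> u" "v \<noteq> - u" "v \<noteq> - 1" and \<tau>: "\<bar>\<tau>\<bar> < \<delta>"
    and ray: "singular_ray v (E0 (of_real \<tau> * u))" and e: "e > 0"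
  shows "\<exists>\<eta>>0. \<forall>v'. norm v' = 1 \<longrightarrow> norm (v' - v) < \<eta> \<longrightarrow>
    (\<exists>\<tau>'. \<bar>\<tau>' - \<tau>\<bar> < e \<and> \<bar>\<tau>'\<bar> < \<delta> \<and> singular_ray v' (E0 (of_real \<tau>' * u)))"
proof -
  obtain I g s where I: "is_interval I" "0 \<in> I" "I \<subseteq> {0..}" "\<forall>t\<in>I. \<exists>t'\<in>I. t < t'"
    and g: "developing X ((\<lambda>t. of_real t * v) ` I) g" "g 0 = E0 (of_real \<tau> * u)" and s: "s \<in> sings X"
    and conv: "\<forall>W. openin TX W \<longrightarrow> s \<in> W \<longrightarrow> (\<exists>t0\<in>I. \<forall>t\<in>I. t0 \<le> t \<longrightarrow> g (of_real t * v) \<in> W)"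
    by (rule singular_rayE[OF ray])
  obtain m \<rho> W U q \<epsilon> where "cone_point X s m \<rho> W U q \<epsilon>" using cone_point_exists[OF s] by blast
  then interpret cone_point X s m \<rho> W U q \<epsilon> .
  obtain T c \<theta> t1 where T: "T > 0" "I = {0..<T}" "c > 0" "0 < \<theta>" "\<theta> < period" "cis \<theta> = - v"
    "0 \<le> t1" "t1 < T" "c * (T - t1) < \<epsilon>"
    and gq: "\<And>t. t1 \<le> t \<Longrightarrow> t < T \<Longrightarrow> g (of_real t * v) = q (c * (T - t), \<theta>)"
  proof (rule singular_ray_radial[OF v(1,4) I(1-3) _ g(1)])
    show "\<exists>t'\<in>I. t < t'" if "t \<in> I" for t using I(4) that by blast
    show "\<exists>t0\<in>I. \<forall>t\<in>I. t0 \<le> t \<longrightarrow> g (of_real t * v) \<in> W" if "openin TX W" "s \<in> W" for W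
      using conv that by blast
  qed (rule that)
  \<comment> \<open>A point on the final radial stretch: there the map \<open>E\<close> and the cone
    coordinates describe the same piece of \<open>X\<close>.\<close>
  define t0 where "t0 = (t1 + T) / 2"
  have t0: "t1 < t0" "t0 < T" "0 < t0" using T by (auto simp: t0_def)
  have "{0..t0} \<subseteq> I" using t0 T(2) by auto
  then have g': "developing X ((\<lambda>t. of_real t * v) ` {0..t0}) g"
    using developing_mono[OF g(1)] by (meson image_mono)
  obtain \<alpha> d D E where \<alpha>: "\<alpha> > 0" and star: "star_domain X d (\<lambda>w. E0 (of_real \<alpha> * w + of_real \<tau> * u)) D E"
    and t0D: "of_real t0 * v \<in> D"
    and Eg: "\<And>t. 0 \<le> t \<Longrightarrow> t \<le> t0 \<Longrightarrow> E (of_real t * v) = g (of_real t * v)"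
    using extend_segment[OF \<tau> less_imp_le[OF t0(3)] g' g(2)] by metis
  interpret D: star_domain X d "\<lambda>w. E0 (of_real \<alpha> * w + of_real \<tau> * u)" D E by (rule star)
  obtain S where S: "open S" "convex S" "closed_segment 0 (of_real t0 * v) \<subseteq> S" "S \<subseteq> D"
    using convex_neighbourhood[OF compact_segment convex_closed_segment D.open_D D.star_D[OF t0D]] by metis
  have dev_S: "developing X S E" by (rule developing_mono[OF D.dev_D S(4)])
  have S0: "0 \<in> S" and St0: "of_real t0 * v \<in> S" using S(3) by auto
  obtain rS where rS: "rS > 0" "ball 0 rS \<subseteq> S" using openE[OF S(1) S0] by blast
  define r where "r = c * (T - t0)"
  have r: "0 < r" "r < c * (T - t1)" using T t0 by (auto simp: r_def)
  have rW: "(r, \<theta>) \<in> W" using W_tube[of r \<theta>] r T by auto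
  have Et0: "E (of_real t0 * v) = q (r, \<theta>)" using Eg[of t0] gq[of t0] t0 by (simp add: r_def)
  obtain V f where V: "(V, f) \<in> atlas X" "q (r, \<theta>) \<in> V"
    using chart_exists[OF q_regular[OF rW]] r by auto
  obtain a b where at: "dev_at X S E (of_real t0 * v) V f a b"
    using developing_chart[OF dev_S St0 V(1)] V(2) Et0 by metis
  obtain d0 where d0: "d0 > 0" "\<And>w. w \<in> S \<inter> ball (of_real t0 * v) d0 \<Longrightarrow> E w \<in> V \<and> f (E w) = of_real a * w + b"
    using at unfolding dev_at_def by auto
  obtain d0' where d0': "d0' > 0" "ball (of_real t0 * v) d0' \<subseteq> S" using openE[OF S(1) St0] by blast
  define d1 where "d1 = min d0 d0'"
  have d1: "d1 > 0" "ball (of_real t0 * v) d1 \<subseteq> S"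
    "\<And>w. w \<in> ball (of_real t0 * v) d1 \<Longrightarrow> E w \<in> V \<and> f (E w) = of_real a * w + b"
    using d0 d0' by (auto simp: d1_def)
  obtain a' b' d2 where a': "a' > 0" "d2 > 0"
    "\<And>y. y \<in> W \<Longrightarrow> dist y (r, \<theta>) < d2 \<Longrightarrow> q y \<in> V \<and> f (q y) = of_real a' * (of_real (fst y) * cis (snd y)) + b'"
    using q_chart[OF rW _ V] r by (metis fst_conv)
  have on_ray: "of_real a * (of_real t * v) + b = of_real (a' * c) * (of_real t * v) + (b' - of_real (a' * c * T) * v)"
    if t: "t1 \<le> t" "t \<le> t0" "t0 - t < d1" "c * (t0 - t) < d2" for t
  proof -
    have "of_real t * v \<in> ball (of_real t0 * v) d1" using t by (simp add: dist_ray[OF v(1)])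
    then have "f (E (of_real t * v)) = of_real a * (of_real t * v) + b" using d1(3) by blast
    moreover have "E (of_real t * v) = q (c * (T - t), \<theta>)" using Eg[of t] gq[of t] t t0 T by simp
    moreover have "f (q (c * (T - t), \<theta>)) = of_real a' * (of_real (c * (T - t)) * (- v)) + b'"
    proof -
      have "0 \<le> c * (T - t)" "c * (T - t) \<le> c * (T - t1)" using t t0 T by auto
      then have "(c * (T - t), \<theta>) \<in> W" using W_tube[of "c * (T - t)" \<theta>] T(4,5,9) by linarith
      moreover have "c * (T - t) - r = c * (t0 - t)" by (simp add: r_def algebra_simps)
      then have "dist (c * (T - t), \<theta>) (r, \<theta>) < d2"
        using t T by (simp add: dist_Pair_Pair dist_real_def)
      ultimately show ?thesis using a'(3)[of "(c * (T - t), \<theta>)"] T(6) by simp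
    qed
    ultimately show ?thesis by (simp add: algebra_simps)
  qed
  \<comment> \<open>The two affine forms are compared at two points of the old ray. Equal
    coefficients make them agree off that ray too, which is where the new ray runs.\<close>
  have ab: "a = a' * c" "b = b' - of_real (a' * c * T) * v"
  proof -
    define h where "h = min (t0 - t1) (min (d1 / 2) (d2 / (2 * c)))"
    have "h \<le> min (t0 - t1) (min (d1 / 2) (d2 / (2 * c)))" by (simp only: h_def)
    then have h: "h \<le> t0 - t1" "h \<le> d1 / 2" "h \<le> d2 / (2 * c)" by (simp_all only: min.bounded_iff)
    have "h > 0" using t0 d1 a' T by (simp add: h_def)
    note h = this h
    have "c * h \<le> c * (d2 / (2 * c))" using h(4) T by (intro mult_left_mono) auto
    then have ch: "c * h < d2" using a'(2) T by simp
    have "v \<noteq> 0" using v(1) by auto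
    then have "of_real t0 * v \<noteq> of_real (t0 - h) * v" using h(1) by (simp del: of_real_diff)
    moreover note on_ray[of t0] on_ray[of "t0 - h"]
    ultimately show "a = a' * c" "b = b' - of_real (a' * c * T) * v"
      using dev_at_coefficients[of a "of_real t0 * v" b "a' * c" "b' - of_real (a' * c * T) * v" "of_real (t0 - h) * v"]
        h ch t0 d1(1) a'(2) by auto
  qed
  \<comment> \<open>The width of the overlap on either side. It uses only part of the radii
    \<open>d1\<close> and \<open>d2\<close>; the rest absorbs the change of direction in the plane
    and of the angle in the cone.\<close>
  define \<kappa>0 where "\<kappa>0 = min ((t0 - t1) / 2) (min (d1 / 2) (d2 / (4 * c)))"
  have \<kappa>0: "\<kappa>0 > 0" "\<kappa>0 \<le> t0 - t1" "\<kappa>0 \<le> d1 / 2" "c * \<kappa>0 \<le> d2 / 4" "\<kappa>0 < T - t0"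
  proof -
    show "\<kappa>0 > 0" using t0 d1 a' T by (simp add: \<kappa>0_def)
    have "\<kappa>0 \<le> min ((t0 - t1) / 2) (min (d1 / 2) (d2 / (4 * c)))" by (simp only: \<kappa>0_def)
    then have le: "\<kappa>0 \<le> (t0 - t1) / 2" "\<kappa>0 \<le> d1 / 2" "\<kappa>0 \<le> d2 / (4 * c)" by (simp_all only: min.bounded_iff)
    show "\<kappa>0 \<le> d1 / 2" by (fact le)
    have "T - t0 = t0 - t1" by (simp add: t0_def field_simps)
    moreover have "(t0 - t1) / 2 < t0 - t1" using t0(1) by simp
    then have "\<kappa>0 < t0 - t1" by (rule order_le_less_trans[OF le(1)])
    ultimately show "\<kappa>0 \<le> t0 - t1" "\<kappa>0 < T - t0" by auto
    have "c * \<kappa>0 \<le> c * (d2 / (4 * c))" using T le(3) by (intro mult_left_mono) auto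
    then show "c * \<kappa>0 \<le> d2 / 4" using T by simp
  qed
  \<comment> \<open>Cramer's rule for \<open>T v\<close> in the basis \<open>u\<close>,
    \<open>v'\<close>; both coordinates and the angle of \<open>v'\<close> against \<open>v\<close>
    depend continuously on \<open>v'\<close>.\<close>
  define \<kappa> where "\<kappa> v' = Im (cnj (of_real T * v) * v') / Im (cnj u * v')" for v'
  define h1 where "h1 v' = Im (cnj u * (of_real T * v)) / Im (cnj u * v')" for v'
  define ang where "ang v' = Arg (v' / v)" for v'
  have det: "Im (cnj u * v) \<noteq> 0" by (rule oblique_determinant[OF norm_u v(1-3)])
  have v0: "v \<noteq> 0" using v(1) by auto
  have cont: "isCont \<kappa> v" "isCont h1 v" "isCont ang v" "isCont (\<lambda>v'. Im (cnj u * v')) v"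
  proof -
    show "isCont \<kappa> v" unfolding \<kappa>_def by (intro continuous_intros isCont_Im det)
    show "isCont h1 v" unfolding h1_def by (intro continuous_intros isCont_Im det)
    show "isCont (\<lambda>v'. Im (cnj u * v')) v" by (intro continuous_intros isCont_Im)
    show "isCont ang v" unfolding ang_def
    proof (rule isCont_o2[where f = "\<lambda>w. w / v"])
      show "isCont (\<lambda>w. w / v) v" by (intro continuous_intros v0)
      show "isCont Arg (v / v)" using v0 by (intro continuous_at_Arg) (auto simp: complex_nonpos_Reals_iff)
    qed
  qed
  have at_v: "\<kappa> v = 0" "h1 v = T" "ang v = 0"
  proof -
    have "cnj v * v = 1" using v(1) complex_norm_square[of v] by (simp add: mult.commute)
    then have "Im (cnj (of_real T * v) * v) = 0" by (simp add: mult.assoc)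
    then show "\<kappa> v = 0" by (simp add: \<kappa>_def)
    have num: "Im (cnj u * (of_real T * v)) = T * Im (cnj u * v)" by (simp add: algebra_simps)
    show "h1 v = T" unfolding h1_def num using det by (rule nonzero_mult_div_cancel_right)
    show "ang v = 0" using v0 by (simp add: ang_def)
  qed
  \<comment> \<open>The new start must lie in the convex set \<open>S\<close> and where
    \<open>E\<close> is the rescaled base disc. The shift of \<open>\<tau>\<close> it causes is
    \<open>\<alpha> * \<kappa> v'\<close>, hence the division by \<open>\<alpha>\<close>.\<close>
  define k0 where "k0 = min (min d rS) (min e (\<delta> - \<bar>\<tau>\<bar>) / \<alpha>)"
  have k0: "k0 > 0" using D.\<delta> rS e \<tau> \<alpha> by (simp add: k0_def)
  define g0 where "g0 = min (d2 / 2) (min \<theta> (period - \<theta>))"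
  have g0: "g0 > 0" using a' T by (simp add: g0_def)
  obtain n1 where n1: "n1 > 0" "\<And>v'. norm (v' - v) < n1 \<Longrightarrow> \<bar>\<kappa> v'\<bar> < k0"
    using continuous_near[OF cont(1) k0] at_v by auto
  obtain n2 where n2: "n2 > 0" "\<And>v'. norm (v' - v) < n2 \<Longrightarrow> \<bar>h1 v' - T\<bar> < t0"
    using continuous_near[OF cont(2) t0(3)] at_v by auto
  obtain n3 where n3: "n3 > 0" "\<And>v'. norm (v' - v) < n3 \<Longrightarrow> \<bar>ang v'\<bar> < g0"
    using continuous_near[OF cont(3) g0] at_v by auto
  obtain n4 where n4: "n4 > 0" "\<And>v'. norm (v' - v) < n4 \<Longrightarrow> \<bar>Im (cnj u * v') - Im (cnj u * v)\<bar> < \<bar>Im (cnj u * v)\<bar>"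
    using continuous_near[OF cont(4), of "\<bar>Im (cnj u * v)\<bar>"] det by auto
  define n5 where "n5 = d1 / (2 * (T - t0))"
  have n5: "n5 > 0" using d1 t0 by (simp add: n5_def)
  have "\<exists>\<tau>'. \<bar>\<tau>' - \<tau>\<bar> < e \<and> \<bar>\<tau>'\<bar> < \<delta> \<and> singular_ray v' (E0 (of_real \<tau>' * u))"
    if v': "norm v' = 1" "norm (v' - v) < n1" "norm (v' - v) < n2" "norm (v' - v) < n3" "norm (v' - v) < n4" "norm (v' - v) < n5" for v'
  proof -
    note k1 = n1(2)[OF v'(2)] and h1' = n2(2)[OF v'(3)] and g1 = n3(2)[OF v'(4)]
    have det': "Im (cnj u * v') \<noteq> 0" using n4(2)[OF v'(5)] by auto
    have line: "of_real T * v = of_real (\<kappa> v') * u + of_real (h1 v') * v'"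
      unfolding \<kappa>_def h1_def by (rule oblique_decomposition[OF det'])
    define \<theta>' where "\<theta>' = \<theta> + ang v'"
    have \<theta>': "0 < \<theta>'" "\<theta>' < period" "\<bar>\<theta>' - \<theta>\<bar> < d2 / 2" using g1 by (auto simp: \<theta>'_def g0_def)
    have "cis \<theta>' = - v'"
    proof -
      have "norm (v' / v) = 1" using v' v by (simp add: norm_divide)
      then have "cis (ang v') = v' / v" unfolding ang_def by (metis cis_Arg div_by_1 of_real_1 sgn_eq norm_zero zero_neq_one)
      then show ?thesis using T(6) v0 by (simp add: \<theta>'_def cis_mult[symmetric])
    qed
    note \<theta>' = \<theta>' this
    define h where "h = h1 v'"
    have h: "h > T - t0" using h1' by (auto simp: h_def)
    define p where "p t = of_real (\<kappa> v') * u + of_real t * v'" for t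
    have p_line: "p t = of_real T * v - of_real (h - t) * v'" for t
      unfolding line by (simp add: p_def h_def algebra_simps)
    have dist_p: "dist (of_real t0 * v) (p t) < d1" if "\<bar>(h - t) - (T - t0)\<bar> < \<kappa>0" for t
    proof -
      have "of_real t0 * v - p t = of_real (T - t0) * (v' - v) + of_real ((h - t) - (T - t0)) * v'"
        by (simp add: p_line algebra_simps)
      then have "dist (of_real t0 * v) (p t) \<le> norm (of_real (T - t0) * (v' - v)) + norm (of_real ((h - t) - (T - t0)) * v')"
        unfolding dist_norm using norm_triangle_ineq by metis
      also have "\<dots> = (T - t0) * norm (v' - v) + \<bar>(h - t) - (T - t0)\<bar>"
        using t0 v'(1) by (simp only: norm_mult norm_of_real) simp
      also have "\<dots> < d1 / 2 + d1 / 2"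
      proof (rule add_strict_mono)
        show "(T - t0) * norm (v' - v) < d1 / 2" using v'(6) t0 by (simp add: n5_def field_simps)
        show "\<bar>(h - t) - (T - t0)\<bar> < d1 / 2" using that \<kappa>0(3) by linarith
      qed
      finally show ?thesis by simp
    qed
    have overlap: "E (p t) = q (c * (h - t), \<theta>')" if t: "\<bar>(h - t) - (T - t0)\<bar> < \<kappa>0" for t
    proof -
      have "E (p t) \<in> V" "f (E (p t)) = of_real a * p t + b" using d1(3)[of "p t"] dist_p[OF t] by auto
      moreover have "q (c * (h - t), \<theta>') \<in> V \<and> f (q (c * (h - t), \<theta>')) = of_real a' * (of_real (c * (h - t)) * (- v')) + b'"
      proof -
        have "T - t0 - \<kappa>0 < h - t" "h - t < T - t0 + \<kappa>0" using t by auto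
        then have ht: "0 \<le> h - t" "h - t \<le> T - t1" using \<kappa>0(2,5) by auto
        have "0 \<le> c * (h - t)" using ht(1) T(3) by simp
        moreover have "c * (h - t) \<le> c * (T - t1)" using ht(2) T(3) by (intro mult_left_mono) auto
        ultimately have W: "(c * (h - t), \<theta>') \<in> W" using W_tube \<theta>' T(9) by simp
        have "\<bar>c * (h - t) - r\<bar> = c * \<bar>(h - t) - (T - t0)\<bar>" using T(3) by (simp add: r_def abs_mult flip: right_diff_distrib)
        also have "\<dots> \<le> c * \<kappa>0" using t T(3) by (intro mult_left_mono) auto
        finally have "\<bar>c * (h - t) - r\<bar> \<le> d2 / 4" using \<kappa>0(4) by linarith
        moreover have "dist (c * (h - t), \<theta>') (r, \<theta>) \<le> \<bar>c * (h - t) - r\<bar> + \<bar>\<theta>' - \<theta>\<bar>"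
          unfolding dist_Pair_Pair dist_real_def by (rule order_trans[OF sqrt_sum_squares_le_sum_abs]) simp
        ultimately have "dist (c * (h - t), \<theta>') (r, \<theta>) < d2" using \<theta>'(3) a'(2) by linarith
        from a'(3)[OF W this] show ?thesis by (simp add: \<theta>'(4))
      qed
      moreover have "of_real a * p t + b = of_real a' * (of_real (c * (h - t)) * (- v')) + b'"
        unfolding ab p_line by (simp add: algebra_simps)
      ultimately show ?thesis using chart_inj[OF V(1)] by (auto simp: inj_on_def)
    qed
    have p0S: "p 0 \<in> S"
    proof -
      have "norm (p 0) < rS" using k1 norm_u by (simp add: p_def norm_mult k0_def)
      then show ?thesis using rS(2) by auto
    qed
    have pS: "p t \<in> S" if "0 \<le> t" "T - t0 - \<kappa>0 < h - t" for t
    proof (cases "T - t0 \<le> h - t")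
      case True
      define t' where "t' = h - (T - t0)"
      have t': "t' > 0" "t \<le> t'" using h True by (auto simp: t'_def)
      have "p t' \<in> S" using dist_p[of t'] \<kappa>0(1) d1(2) by (auto simp: t'_def)
      moreover have "p t = (1 - t / t') *\<^sub>R p 0 + (t / t') *\<^sub>R p t'"
        using t' by (simp add: p_def scaleR_conv_of_real algebra_simps)
      moreover have "0 \<le> t / t'" "t / t' \<le> 1" using t' that(1) by auto
      ultimately show ?thesis using convexD_alt[OF S(2) p0S] by metis
    next
      case False
      then show ?thesis using dist_p[of t] that d1(2) by auto
    qed
    \<comment> \<open>The switch from \<open>E\<close> to the radius happens at remaining length
      \<open>T - t0\<close>, inside the window where both descriptions agree by
      \<open>overlap\<close>.\<close>
    define G where "G z = (let t = Re (z * cnj v') in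
      if T - t0 \<le> h - t then E (of_real (\<kappa> v') * u + z) else q (c * (h - t), \<theta>'))" for z
    have Re_ray: "Re (of_real t * v' * cnj v') = t" for t
      using v'(1) by (simp add: mult.assoc complex_norm_square[symmetric])
    have G_ray: "G (of_real t * v') = (if T - t0 \<le> h - t then E (p t) else q (c * (h - t), \<theta>'))" for t
      unfolding G_def Let_def Re_ray p_def ..
    have c_eps: "c * (h - t) < \<epsilon>" if "h - t < T - t0" for t
    proof -
      have "c * (h - t) \<le> c * (T - t1)" using that t0 T(3) by (intro mult_left_mono) auto
      then show ?thesis using T(9) by linarith
    qed
    have hpos: "h > 0" using h t0 by simp
    have "developing X ((\<lambda>t. of_real t * v') ` {0..<h}) G"
    proof (rule developing_local)
      fix z assume "z \<in> (\<lambda>t. of_real t * v') ` {0..<h}"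
      then obtain t where t: "t \<in> {0..<h}" "z = of_real t * v'" by blast
      show "\<exists>r S' E'. 0 < r \<and> developing X S' E' \<and> z \<in> S' \<and>
          (\<forall>w\<in>(\<lambda>t. of_real t * v') ` {0..<h} \<inter> ball z r. w \<in> S' \<and> G w = E' w)"
      proof (cases "T - t0 - \<kappa>0 < h - t")
        case True
        let ?S = "{w. of_real 1 * w + of_real (\<kappa> v') * u \<in> S}"
        let ?E = "\<lambda>w. E (of_real 1 * w + of_real (\<kappa> v') * u)"
        have pz: "of_real 1 * (of_real t' * v') + of_real (\<kappa> v') * u = p t'" for t' by (simp add: p_def)
        show ?thesis
        proof (intro exI conjI ballI)
          show "0 < (h - t) - (T - t0 - \<kappa>0)" using True by simp
          show "developing X ?S ?E" by (rule developing_affine[OF dev_S]) simp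
          show "z \<in> ?S" using pS[of t] True t by (simp only: mem_Collect_eq t(2) pz) auto
          fix w assume w: "w \<in> (\<lambda>t. of_real t * v') ` {0..<h} \<inter> ball z ((h - t) - (T - t0 - \<kappa>0))"
          then obtain t' where t': "t' \<in> {0..<h}" "w = of_real t' * v'" by blast
          have "\<bar>t - t'\<bar> < (h - t) - (T - t0 - \<kappa>0)" using w by (simp add: t(2) t'(2) dist_ray[OF v'(1)])
          then have t'': "T - t0 - \<kappa>0 < h - t'" by linarith
          show "w \<in> ?S" using pS[of t'] t'' t'(1) by (simp only: mem_Collect_eq t'(2) pz) auto
          show "G w = ?E w" unfolding t'(2) pz G_ray using overlap[of t'] t'' by auto
        qed
      next
        case False
        then have less: "h - t < T - t0" using \<kappa>0 by linarith
        let ?S = "(\<lambda>t. of_real t * v') ` {t. 0 < c * (h - t) \<and> c * (h - t) < \<epsilon>}"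
        let ?E = "\<lambda>z. q (c * (h - Re (z * cnj v')), \<theta>')"
        have mem: "of_real t' * v' \<in> ?S" if "t' < h" "h - t' < T - t0" for t'
          using that c_eps[of t'] T(3) by auto
        show ?thesis
        proof (intro exI conjI ballI)
          show "0 < (T - t0) - (h - t)" using less by simp
          show "developing X ?S ?E" by (rule radial_developing[OF v'(1) \<theta>'(1,2,4) T(3)])
          show "z \<in> ?S" using mem[of t] t less by auto
          fix w assume w: "w \<in> (\<lambda>t. of_real t * v') ` {0..<h} \<inter> ball z ((T - t0) - (h - t))"
          then obtain t' where t': "t' \<in> {0..<h}" "w = of_real t' * v'" by blast
          have "\<bar>t - t'\<bar> < (T - t0) - (h - t)" using w by (simp add: t(2) t'(2) dist_ray[OF v'(1)])
          then have t'': "h - t' < T - t0" by linarith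
          show "w \<in> ?S" using mem[of t'] t' t'' by auto
          show "G w = ?E w" unfolding t'(2) G_ray Re_ray using t'' by simp
        qed
      qed
    qed
    moreover have "G 0 = E0 (of_real (\<tau> + \<alpha> * \<kappa> v') * u)"
    proof -
      have "G 0 = E (p 0)" using G_ray[of 0] h by simp
      moreover have "p 0 \<in> ball 0 d" using k1 norm_u by (simp add: p_def norm_mult k0_def)
      ultimately show ?thesis using D.E_eq[of "p 0"] by (simp add: p_def algebra_simps)
    qed
    moreover have "\<exists>t0'\<in>{0..<h}. \<forall>t\<in>{0..<h}. t0' \<le> t \<longrightarrow> G (of_real t * v') \<in> N" if N: "openin TX N" "s \<in> N" for N
    proof -
      have "(0, \<theta>') \<in> W" "q (0, \<theta>') \<in> N" using W_tube[of 0 \<theta>'] \<epsilon> \<theta>' q_zero[of \<theta>'] N by auto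
      from q_continuous[OF this(1) N(1) this(2)]
      obtain d3 where d3: "d3 > 0" "\<And>y. y \<in> W \<Longrightarrow> dist y (0, \<theta>') < d3 \<Longrightarrow> q y \<in> N" by blast
      define l where "l = min ((T - t0) / 2) (d3 / (2 * c))"
      have l: "l > 0" "l < T - t0" "c * l < d3"
      proof -
        show "l > 0" using t0 d3 T by (simp add: l_def)
        have "l \<le> (T - t0) / 2" unfolding l_def by (rule min.cobounded1)
        also have "\<dots> < T - t0" using t0 by simp
        finally show "l < T - t0" .
        have "l \<le> d3 / (2 * c)" unfolding l_def by (rule min.cobounded2)
        then have "c * l \<le> c * (d3 / (2 * c))" using T by (intro mult_left_mono) auto
        then show "c * l < d3" using d3 T by simp
      qed
      have "G (of_real t * v') \<in> N" if t: "h - l \<le> t" "t < h" for t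
      proof -
        have less: "h - t < T - t0" using t l by linarith
        have pos: "0 \<le> c * (h - t)" using t T(3) by simp
        have "(c * (h - t), \<theta>') \<in> W" using W_tube[OF pos] c_eps[OF less] \<theta>' by simp
        moreover have "c * (h - t) \<le> c * l" using t T(3) by (intro mult_left_mono) auto
        then have "dist (c * (h - t), \<theta>') (0, \<theta>') < d3" using l(3) pos by (simp add: dist_Pair_Pair)
        ultimately show ?thesis using d3(2) less G_ray[of t] by simp
      qed
      then show ?thesis using l h by (intro bexI[of _ "h - l"]) auto
    qed
    moreover have "\<exists>t'\<in>{0..<h}. t < t'" if "t \<in> {0..<h}" for t
      using that by (intro bexI[of _ "(t + h) / 2"]) auto
    moreover have "is_interval {0..<h}" "0 \<in> {0..<h}" "{0..<h} \<subseteq> {0..}"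
      using hpos by (auto simp: is_interval_co)
    ultimately have "singular_ray v' (E0 (of_real (\<tau> + \<alpha> * \<kappa> v') * u))"
      unfolding singular_ray_def using s
      by (intro exI[of _ "{0..<h}"] exI[of _ G] exI[of _ s]) blast
    moreover have "\<bar>\<alpha> * \<kappa> v'\<bar> < min e (\<delta> - \<bar>\<tau>\<bar>)"
    proof -
      have "\<bar>\<kappa> v'\<bar> < min e (\<delta> - \<bar>\<tau>\<bar>) / \<alpha>" using k1 by (simp add: k0_def)
      then have "\<alpha> * \<bar>\<kappa> v'\<bar> < min e (\<delta> - \<bar>\<tau>\<bar>)" using \<alpha> by (metis mult.commute pos_less_divide_eq)
      then show ?thesis using \<alpha> by (simp add: abs_mult)
    qed
    ultimately show ?thesis by (intro exI[of _ "\<tau> + \<alpha> * \<kappa> v'"]) auto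
  qed
  then show ?thesis using n1(1) n2(1) n3(1) n4(1) n5
    by (intro exI[of _ "min (min n1 n2) (min (min n3 n4) n5)"]) auto
qed

end

section \<open>Density of the directions\<close>

lemma direction_avoiding:
  fixes w :: complex
  assumes w: "norm w = 1" and e: "e > 0" and F: "finite F"
  shows "\<exists>v. norm v = 1 \<and> norm (v - w) < e \<and> v \<notin> F"
proof -
  have "continuous_on UNIV cis" by (intro continuous_intros)
  then have "isCont cis 0" by (simp add: continuous_on_eq_continuous_at)
  then obtain d where d: "d > 0" "\<And>t. dist t 0 < d \<Longrightarrow> dist (cis t) (cis 0) < e"
    using e unfolding continuous_at_eps_delta by metis
  define J where "J = {0<..<min d 1}"
  have "infinite J" using d(1) by (simp add: J_def infinite_Ioo)
  moreover have "inj_on (\<lambda>t. w * cis t) J"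
  proof (rule inj_onI)
    fix s t assume s: "s \<in> J" and t: "t \<in> J" and "w * cis s = w * cis t"
    then have "cis s = cis t" using w by auto
    then have "sin s = sin t" by (simp add: complex_eq_iff)
    then show "s = t"
      using sin_inj_pi[of s t] s t pi_gt3 by (auto simp: J_def)
  qed
  ultimately have "infinite ((\<lambda>t. w * cis t) ` J)" using finite_imageD by blast
  then have "\<not> (\<lambda>t. w * cis t) ` J \<subseteq> F" using F finite_subset by blast
  then obtain t where t: "t \<in> J" "w * cis t \<notin> F" by auto
  have "norm (w * cis t - w) < e"
  proof -
    have "w * cis t - w = w * (cis t - cis 0)" by (simp add: algebra_simps)
    then have "norm (w * cis t - w) = norm (cis t - cis 0)" using w by (simp add: norm_mult)
    also have "\<dots> < e" using d(2)[of t] t(1) by (auto simp: J_def dist_norm)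
    finally show ?thesis .
  qed
  then show ?thesis using t(2) w by (intro exI[of _ "w * cis t"]) (simp add: norm_mult)
qed

lemma finite_separation:
  fixes A :: "real set"
  assumes "finite A"
  shows "\<exists>d>0. \<forall>x\<in>A. \<forall>y\<in>A. x \<noteq> y \<longrightarrow> d \<le> \<bar>x - y\<bar>"
proof -
  define P where "P = insert 1 ((\<lambda>(x, y). \<bar>x - y\<bar>) ` {(x, y) \<in> A \<times> A. x \<noteq> y})"
  have "finite {(x, y) \<in> A \<times> A. x \<noteq> y}"
    by (rule finite_subset[of _ "A \<times> A"]) (use assms in auto)
  then have P: "finite P" "P \<noteq> {}" by (auto simp: P_def)
  have "Min P > 0" using P by (auto simp: P_def)
  moreover have "Min P \<le> \<bar>x - y\<bar>" if "x \<in> A" "y \<in> A" "x \<noteq> y" for x y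
    by (rule Min_le[OF P(1)]) (use that in \<open>auto simp: P_def\<close>)
  ultimately show ?thesis by blast
qed

context crossing
begin

text \<open>Moves the origin to another point of the base diameter; the set \<open>B\<close> and the
  bound \<open>k\<close> are untouched, and only the disc shrinks.\<close>

lemma rebase:
  assumes \<tau>: "\<bar>\<tau>\<bar> < \<delta>"
  shows "crossing X B u k (\<delta> - \<bar>\<tau>\<bar>) (\<lambda>w. E0 (of_real 1 * w + of_real \<tau> * u))"
proof (unfold_locales)
  have shift: "of_real 1 * w + of_real \<tau> * u \<in> ball 0 \<delta>" if "w \<in> ball 0 (\<delta> - \<bar>\<tau>\<bar>)" for w
    using that norm_triangle_ineq[of w "of_real \<tau> * u"] norm_u by (simp add: norm_mult)
  show "norm u = 1" by (rule norm_u)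
  show "0 < \<delta> - \<bar>\<tau>\<bar>" using \<tau> by simp
  show "developing X (ball 0 (\<delta> - \<bar>\<tau>\<bar>)) (\<lambda>w. E0 (of_real 1 * w + of_real \<tau> * u))"
    by (rule developing_mono[OF developing_affine[OF base_dev]]) (use shift in auto)
  show "inj_on (\<lambda>w. E0 (of_real 1 * w + of_real \<tau> * u)) (ball 0 (\<delta> - \<bar>\<tau>\<bar>))"
  proof (rule inj_onI)
    fix x y assume "x \<in> ball 0 (\<delta> - \<bar>\<tau>\<bar>)" "y \<in> ball 0 (\<delta> - \<bar>\<tau>\<bar>)"
      "E0 (of_real 1 * x + of_real \<tau> * u) = E0 (of_real 1 * y + of_real \<tau> * u)"
    then have "of_real 1 * x + of_real \<tau> * u = of_real 1 * y + of_real \<tau> * u"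
      using inj_onD[OF base_inj] shift by metis
    then show "x = y" by simp
  qed
  show "E0 (of_real 1 * (of_real \<sigma> * u) + of_real \<tau> * u) \<in> B" if "\<bar>\<sigma>\<bar> < \<delta> - \<bar>\<tau>\<bar>" for \<sigma>
  proof -
    have "\<bar>\<sigma> + \<tau>\<bar> < \<delta>" using that by linarith
    from base_cross[OF this] show ?thesis by (simp add: distrib_right)
  qed
  show "finite {t \<in> interior I. \<gamma> t \<in> B} \<and> card {t \<in> interior I. \<gamma> t \<in> B} \<le> k"
    if "v \<noteq> u" "v \<noteq> - u" "trajectory X I \<gamma> v" for v I \<gamma>
    using crossings[OF that] .
qed

text \<open>
  By persistence, the number of singular rays leaving the base segment cannot drop near a
  direction. Where it is maximal, the singular rays therefore stay near finitely many points.
\<close>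

lemma nonsingular_base_point:
  assumes w: "norm w = 1" and e: "e > 0"
  obtains \<tau> v0 \<eta> where "\<bar>\<tau>\<bar> < \<delta>" "norm v0 = 1" "\<eta> > 0"
    "\<And>v. norm v = 1 \<Longrightarrow> norm (v - v0) < \<eta> \<Longrightarrow>
      norm (v - w) < e \<and> v \<noteq> u \<and> v \<noteq> - u \<and> \<not> singular_ray v (E0 (of_real \<tau> * u))"
proof -
  define A where "A v = {\<tau>. \<bar>\<tau>\<bar> < \<delta> \<and> singular_ray v (E0 (of_real \<tau> * u))}" for v
  define dirs where "dirs = {v. norm v = 1 \<and> norm (v - w) < e \<and> v \<notin> {u, - u, - 1}}"
  obtain N where N: "\<And>v. v \<in> dirs \<Longrightarrow> finite (A v) \<and> card (A v) \<le> N"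
  proof (rule singular_rays_bounded)
    fix N assume "\<And>v. norm v = 1 \<Longrightarrow> v \<noteq> u \<Longrightarrow> v \<noteq> - u \<Longrightarrow> v \<noteq> - 1 \<Longrightarrow>
      finite {\<tau>. \<bar>\<tau>\<bar> < \<delta> \<and> singular_ray v (E0 (of_real \<tau> * u))} \<and>
      card {\<tau>. \<bar>\<tau>\<bar> < \<delta> \<and> singular_ray v (E0 (of_real \<tau> * u))} \<le> N"
    then have "finite (A v) \<and> card (A v) \<le> N" if "v \<in> dirs" for v
      using that by (auto simp: dirs_def A_def)
    then show ?thesis by (rule that)
  qed
  obtain v1 where v1: "v1 \<in> dirs"
    using direction_avoiding[OF w e, of "{u, - u, - 1}"] by (auto simp: dirs_def)
  have "\<exists>v. v \<in> dirs \<and> (\<forall>v'. v' \<in> dirs \<longrightarrow> card (A v') \<le> card (A v))"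
    using ex_has_greatest_nat[of "\<lambda>v. v \<in> dirs" v1 "\<lambda>v. card (A v)" "Suc N"] v1 N by (simp add: le_imp_less_Suc less_imp_le)
  then obtain v0 where v0: "v0 \<in> dirs" "\<And>v'. v' \<in> dirs \<Longrightarrow> card (A v') \<le> card (A v0)" by blast
  have v0': "norm v0 = 1" "norm (v0 - w) < e" "v0 \<noteq> u" "v0 \<noteq> - u" "v0 \<noteq> - 1" using v0(1) by (auto simp: dirs_def)
  have fin: "finite (A v0)" using N v0(1) by blast
  have "infinite {-\<delta><..<\<delta>}" using \<delta>_pos by (simp add: infinite_Ioo)
  then have "\<not> {-\<delta><..<\<delta>} \<subseteq> A v0" using fin finite_subset by blast
  then obtain \<tau>0 where "\<tau>0 \<in> {-\<delta><..<\<delta>}" "\<tau>0 \<notin> A v0" by blast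
  then have \<tau>0: "\<bar>\<tau>0\<bar> < \<delta>" "\<tau>0 \<notin> A v0" by auto
  \<comment> \<open>Intervals of radius \<open>d / 2\<close> around the old singular parameters are
    disjoint and miss \<open>\<tau>0\<close>. Each contains a singular parameter for a nearby
    \<open>v\<close>; by maximality there are no others, so \<open>\<tau>0\<close> stays
    nonsingular.\<close>
  obtain d where d: "d > 0" "\<And>x y. x \<in> insert \<tau>0 (A v0) \<Longrightarrow> y \<in> insert \<tau>0 (A v0) \<Longrightarrow> x \<noteq> y \<Longrightarrow> d \<le> \<bar>x - y\<bar>"
    using finite_separation[of "insert \<tau>0 (A v0)"] fin by auto
  have d2: "d / 2 > 0" using d(1) by simp
  have "\<exists>\<eta>>0. \<forall>v. norm v = 1 \<longrightarrow> norm (v - v0) < \<eta> \<longrightarrow> (\<exists>\<tau>'. \<bar>\<tau>' - \<tau>\<bar> < d / 2 \<and> \<tau>' \<in> A v)" if "\<tau> \<in> A v0" for \<tau>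
    using singular_ray_persists[OF v0'(1,3-5) _ _ d2, of \<tau>] that by (auto simp: A_def)
  then obtain \<eta>f where \<eta>f: "\<And>\<tau>. \<tau> \<in> A v0 \<Longrightarrow> \<eta>f \<tau> > 0"
    "\<And>\<tau> v. \<tau> \<in> A v0 \<Longrightarrow> norm v = 1 \<Longrightarrow> norm (v - v0) < \<eta>f \<tau> \<Longrightarrow> \<exists>\<tau>'. \<bar>\<tau>' - \<tau>\<bar> < d / 2 \<and> \<tau>' \<in> A v"
    by metis
  \<comment> \<open>The first four terms keep nearby directions within \<open>e\<close> of
    \<open>w\<close> and away from \<open>u\<close>, \<open>- u\<close> and \<open>- 1\<close>; the
    others ensure persistence of every singular ray.\<close>
  define \<eta> where "\<eta> = Min ({e - norm (v0 - w), norm (v0 - u), norm (v0 + u), norm (v0 + 1)} \<union> \<eta>f ` A v0)"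
  have fin_M: "finite ({e - norm (v0 - w), norm (v0 - u), norm (v0 + u), norm (v0 + 1)} \<union> \<eta>f ` A v0)" using fin by simp
  have "- v0 \<noteq> 1" using v0'(5) by (metis minus_minus)
  then have \<eta>: "\<eta> > 0"
    unfolding \<eta>_def using v0' \<eta>f(1) fin by (subst Min_gr_iff) (auto simp: add_eq_0_iff)
  have \<eta>_le: "\<eta> \<le> x" if "x \<in> {e - norm (v0 - w), norm (v0 - u), norm (v0 + u), norm (v0 + 1)} \<union> \<eta>f ` A v0" for x
    unfolding \<eta>_def by (rule Min_le[OF fin_M that])
  show ?thesis
  proof (rule that[OF \<tau>0(1) v0'(1) \<eta>])
    fix v assume v: "norm v = 1" "norm (v - v0) < \<eta>"
    have vw: "norm (v - w) < e"
      using norm_triangle_ineq[of "v - v0" "v0 - w"] v(2) \<eta>_le[of "e - norm (v0 - w)"] by simp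
    have ne: "v \<noteq> u" "v \<noteq> - u" "v \<noteq> - 1"
    proof -
      show "v \<noteq> u" using v(2) \<eta>_le[of "norm (v0 - u)"] by (auto simp: norm_minus_commute)
      show "v \<noteq> - u"
      proof
        assume "v = - u"
        then have "norm (v - v0) = norm (v0 + u)" by (metis add.commute minus_add norm_minus_cancel uminus_add_conv_diff diff_conv_add_uminus)
        then show False using v(2) \<eta>_le[of "norm (v0 + u)"] by simp
      qed
      show "v \<noteq> - 1"
      proof
        assume "v = - 1"
        then have "norm (v - v0) = norm (v0 + 1)" by (metis add.commute minus_add norm_minus_cancel uminus_add_conv_diff diff_conv_add_uminus)
        then show False using v(2) \<eta>_le[of "norm (v0 + 1)"] by simp
      qed
    qed
    have v_dirs: "v \<in> dirs" using v(1) vw ne by (simp add: dirs_def)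
    have "\<exists>\<tau>'. \<bar>\<tau>' - \<tau>\<bar> < d / 2 \<and> \<tau>' \<in> A v" if "\<tau> \<in> A v0" for \<tau>
      using \<eta>f(2)[OF that v(1)] v(2) \<eta>_le[of "\<eta>f \<tau>"] that by auto
    then obtain \<phi> where \<phi>: "\<And>\<tau>. \<tau> \<in> A v0 \<Longrightarrow> \<bar>\<phi> \<tau> - \<tau>\<bar> < d / 2 \<and> \<phi> \<tau> \<in> A v" by metis
    have "inj_on \<phi> (A v0)"
    proof (rule inj_onI, rule ccontr)
      fix x y assume x: "x \<in> A v0" and y: "y \<in> A v0" and eq: "\<phi> x = \<phi> y" and "x \<noteq> y"
      then have "d \<le> \<bar>x - y\<bar>" using d(2) by blast
      then show False using \<phi>[OF x] \<phi>[OF y] eq by linarith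
    qed
    then have "card (\<phi> ` A v0) = card (A v0)" by (rule card_image)
    moreover have "\<phi> ` A v0 \<subseteq> A v" using \<phi> by blast
    moreover have "card (A v) \<le> card (A v0)" by (rule v0(2)[OF v_dirs])
    moreover have "finite (A v)" using N[OF v_dirs] by blast
    ultimately have "\<phi> ` A v0 = A v" by (metis card_seteq)
    then have "\<tau>0 \<notin> A v"
    proof -
      have "\<phi> \<tau> \<noteq> \<tau>0" if "\<tau> \<in> A v0" for \<tau>
      proof
        assume "\<phi> \<tau> = \<tau>0"
        moreover have "d \<le> \<bar>\<tau>0 - \<tau>\<bar>" using d(2)[of \<tau>0 \<tau>] that \<tau>0(2) by auto
        ultimately show False using \<phi>[OF that] d(1) by linarith
      qed
      then have "\<tau>0 \<notin> \<phi> ` A v0" by blast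
      then show ?thesis using \<open>\<phi> ` A v0 = A v\<close> by simp
    qed
    then show "norm (v - w) < e \<and> v \<noteq> u \<and> v \<noteq> - u \<and> \<not> singular_ray v (E0 (of_real \<tau>0 * u))"
      using vw ne \<tau>0(1) by (simp add: A_def)
  qed
qed

text \<open>Rays are sent out near \<open>- w\<close>, because the contracting closed geodesic runs
  back along its ray.\<close>

lemma hyperbolic_directions_dense:
  assumes w: "norm w = 1" and e: "e > 0"
  shows "\<exists>v \<in> hyperbolic_directions X. norm (v - w) < e"
proof -
  have "norm (- w) = 1" using w by simp
  from nonsingular_base_point[OF this e] obtain \<tau> v0 \<eta> where \<tau>: "\<bar>\<tau>\<bar> < \<delta>" and v0: "norm v0 = 1" and \<eta>: "\<eta> > 0"
    and good: "\<And>v. norm v = 1 \<Longrightarrow> norm (v - v0) < \<eta> \<Longrightarrow>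
      norm (v - - w) < e \<and> v \<noteq> u \<and> v \<noteq> - u \<and> \<not> singular_ray v (E0 (of_real \<tau> * u))" by metis
  interpret R: crossing X B u k "\<delta> - \<bar>\<tau>\<bar>" "\<lambda>w. E0 (of_real 1 * w + of_real \<tau> * u)" by (rule rebase[OF \<tau>])
  obtain D E where "star_domain X (\<delta> - \<bar>\<tau>\<bar>) (\<lambda>w. E0 (of_real 1 * w + of_real \<tau> * u)) D E"
    using maximal_domain[OF R.\<delta>_pos R.base_dev] by metis
  then interpret S: star_domain X "\<delta> - \<bar>\<tau>\<bar>" "\<lambda>w. E0 (of_real 1 * w + of_real \<tau> * u)" D E .
  interpret S: crossing_domain X B u k "\<delta> - \<bar>\<tau>\<bar>" "\<lambda>w. E0 (of_real 1 * w + of_real \<tau> * u)" D E ..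
  have good0: "norm (v - - w) < e \<and> v \<noteq> u \<and> v \<noteq> - u \<and> \<not> singular_ray v (E0 (of_real 1 * 0 + of_real \<tau> * u))"
    if "norm v = 1" "norm (v - v0) < \<eta>" for v
    using good[OF that] by simp
  have g0: "v0 \<noteq> u" "v0 \<noteq> - u" "\<not> singular_ray v0 (E0 (of_real 1 * 0 + of_real \<tau> * u))"
    using good0[OF v0] \<eta> by auto
  \<comment> \<open>\<open>ray_in_domain\<close> consumes a neighbourhood of each direction, so one
    half of \<open>\<eta>\<close> is spent on it and the other half is left for the sector.\<close>
  have rays: "of_real r * v \<in> D" if v: "norm v = 1" "norm (v - v0) < \<eta> / 2" "0 \<le> r" for v r
  proof (rule S.ray_in_domain[OF v(1) _ _ v(3)])
    show "\<eta> / 2 > 0" using \<eta> by simp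
    fix v' assume v': "norm v' = 1" "norm (v' - v) < \<eta> / 2"
    have "norm (v' - v0) < \<eta>" using norm_triangle_ineq[of "v' - v" "v - v0"] v'(2) v(2) by simp
    then show "v' \<noteq> u \<and> v' \<noteq> - u \<and> \<not> singular_ray v' (E0 (of_real 1 * 0 + of_real \<tau> * u))"
      using good0[OF v'(1)] by blast
  qed
  have \<eta>2: "\<eta> / 2 > 0" using \<eta> by simp
  obtain v where v: "norm v = 1" "norm (v - v0) < \<eta> / 2" "- v \<in> hyperbolic_directions X"
    by (rule S.hyperbolic_direction_near[OF v0 g0(1,2) \<eta>2 rays g0(3)]; (assumption | rule that))
  have "norm (v - - w) < e" using good0[OF v(1)] v(2) \<eta> by simp
  then have "norm (- v - w) < e" using norm_minus_cancel[of "v - - w"] by (simp add: algebra_simps)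
  then show ?thesis using v(3) by blast
qed

end

section \<open>A base disc on the saddle connection\<close>

context dilation_surf
begin

text \<open>A chart at an interior point of \<open>L\<close> provides the disc. The parametrization
  of \<open>L\<close> is arbitrary, so it is the intermediate value theorem for the coordinate
  \<open>\<phi>\<close> along \<open>u\<close> that shows \<open>L\<close> to sweep out a whole
  diameter.\<close>

lemma crossing_base_exists:
  assumes sc: "saddle_connection X L u"
    and bound: "\<And>I \<gamma> v. trajectory X I \<gamma> v \<Longrightarrow>
      finite (crossing_times L u I \<gamma> v) \<and> card (crossing_times L u I \<gamma> v) \<le> k"
  obtains \<delta> E0 where "crossing X (L ` {0<..<1}) u k \<delta> E0"
proof -
  have traj: "trajectory X {0<..<1} L u" and L_cont: "continuous_map (top_of_set {0..1}) TX L"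
    using sc by (auto simp: saddle_connection_def)
  have u: "norm u = 1" using traj by (simp add: trajectory_def)
  define h :: real where "h = 1 / 2"
  have reg: "L h \<in> regular_part X"
    using traj unfolding trajectory_def continuous_map_in_subtopology by (auto simp: h_def image_subset_iff)
  obtain U f where U: "(U, f) \<in> atlas X" "L h \<in> U" using chart_exists[OF reg] by blast
  obtain e where e: "e > 0" "\<And>s s'. s \<in> {0<..<1} \<inter> ball h e \<Longrightarrow> s' \<in> {0<..<1} \<inter> ball h e \<Longrightarrow> s < s' \<Longrightarrow>
      \<exists>c>0. f (L s') - f (L s) = of_real c * u"
  proof -
    have "h \<in> {0<..<1}" by (simp add: h_def)
    then have "\<exists>\<epsilon>>0. \<forall>s\<in>{0<..<1} \<inter> ball h \<epsilon>. \<forall>s'\<in>{0<..<1} \<inter> ball h \<epsilon>. s < s' \<longrightarrow> (\<exists>c>0. f (L s') - f (L s) = of_real c * u)"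
      using traj U unfolding trajectory_def by blast
    then show ?thesis using that by blast
  qed
  have "openin (top_of_set {0..1}) {x \<in> topspace (top_of_set {0..1}). L x \<in> U}"
    by (rule openin_continuous_map_preimage[OF L_cont chart_open[OF U(1)]])
  from bspec[OF conjunct2[OF this[unfolded openin_euclidean_subtopology_iff]], of h]
  obtain e' where e': "e' > 0" "\<And>s. s \<in> {0..1} \<Longrightarrow> dist s h < e' \<Longrightarrow> L s \<in> U"
    using U(2) by (auto simp: h_def)
  define m where "m = min (1 / 4) (min (e / 2) (e' / 2))"
  have m: "m > 0" "m < 1 / 2" "m < e" "m < e'" using e(1) e'(1) by (auto simp: m_def min_def)
  define J where "J = {h - m..h + m}"
  have J01: "s \<in> {0<..<1}" "s \<in> ball h e" "L s \<in> U" if "s \<in> J" for s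
  proof -
    show "s \<in> {0<..<1}" "s \<in> ball h e" using that m by (auto simp: J_def h_def dist_real_def)
    then show "L s \<in> U" using e'(2)[of s] that m by (auto simp: J_def dist_real_def)
  qed
  have "continuous_on J (f \<circ> L)"
  proof -
    have "J \<subseteq> {0..1}" using J01(1) by force
    then have "continuous_map (top_of_set J) TX L"
      using continuous_map_from_subtopology[OF L_cont, of J] by (simp add: subtopology_subtopology Int_absorb1)
    then have "continuous_map (top_of_set J) (subtopology TX U) L"
      using J01(3) by (auto simp: continuous_map_in_subtopology)
    moreover have "continuous_map (subtopology TX U) euclidean f"
      using homeomorphic_imp_continuous_map[OF chart_homeo[OF U(1)]] continuous_map_in_subtopology by blast
    ultimately have "continuous_map (top_of_set J) euclidean (f \<circ> L)" by (rule continuous_map_compose)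
    then show ?thesis by simp
  qed
  define \<phi> where "\<phi> s = Re ((f (L s) - f (L h)) * cnj u)" for s
  have "continuous_on J \<phi>"
  proof -
    have "continuous_on J (\<lambda>s. f (L s))" using \<open>continuous_on J (f \<circ> L)\<close> by (simp add: o_def)
    then show ?thesis unfolding \<phi>_def by (intro continuous_intros)
  qed
  have uu: "u * cnj u = 1" using u by (simp add: complex_norm_square[symmetric])
  have \<phi>: "f (L s) = f (L h) + of_real (\<phi> s) * u" "s < h \<Longrightarrow> \<phi> s < 0" "h < s \<Longrightarrow> \<phi> s > 0" if s: "s \<in> J" for s
  proof -
    have hJ: "h \<in> J" using m by (simp add: J_def)
    have "\<exists>c. f (L s) - f (L h) = of_real c * u \<and> (s < h \<longrightarrow> c < 0) \<and> (h < s \<longrightarrow> c > 0)"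
    proof -
      consider "s = h" | "s < h" | "h < s" by linarith
      then show ?thesis
      proof cases
        case 2
        then obtain c where "c > 0" "f (L h) - f (L s) = of_real c * u"
          using e(2)[of s h] J01[OF s] J01[OF hJ] by auto
        then have "f (L s) - f (L h) = of_real (- c) * u" by (simp add: algebra_simps)
        then show ?thesis using \<open>c > 0\<close> 2 by (intro exI[of _ "- c"]) auto
      next
        case 3
        then show ?thesis using e(2)[of h s] J01[OF s] J01[OF hJ] by auto
      qed (auto intro!: exI[of _ 0])
    qed
    then obtain c where c: "f (L s) - f (L h) = of_real c * u" "s < h \<longrightarrow> c < 0" "h < s \<longrightarrow> c > 0" by blast
    have "\<phi> s = c" unfolding \<phi>_def c(1) by (simp add: mult.assoc uu)
    then show "f (L s) = f (L h) + of_real (\<phi> s) * u" "s < h \<Longrightarrow> \<phi> s < 0" "h < s \<Longrightarrow> \<phi> s > 0"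
      using c by (auto simp: algebra_simps)
  qed
  have ends: "h - m \<in> J" "h + m \<in> J" using m by (auto simp: J_def)
  have ends_sign: "\<phi> (h - m) < 0" "\<phi> (h + m) > 0" using \<phi>(2)[OF ends(1)] \<phi>(3)[OF ends(2)] m by auto
  have "f (L h) \<in> f ` U" using U(2) by blast
  then obtain r where r: "r > 0" "ball (f (L h)) r \<subseteq> f ` U" using openE[OF chart_image_open[OF U(1)]] by blast
  \<comment> \<open>The disc has to fit into the chart, and its diameter into the interval of values
    that \<open>\<phi>\<close> is sure to take.\<close>
  define \<delta> where "\<delta> = min r (min (- \<phi> (h - m)) (\<phi> (h + m)))"
  have \<delta>: "\<delta> > 0" "\<delta> \<le> r" "\<delta> \<le> - \<phi> (h - m)" "\<delta> \<le> \<phi> (h + m)" using r ends_sign by (auto simp: \<delta>_def)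
  define E0 where "E0 = (\<lambda>w. inv_into U f (of_real 1 * w + f (L h)))"
  have sub: "(\<lambda>w. of_real 1 * w + f (L h)) ` ball 0 \<delta> \<subseteq> f ` U"
  proof (intro subset_trans[OF _ r(2)] image_subsetI)
    fix w :: complex assume "w \<in> ball 0 \<delta>"
    then show "of_real 1 * w + f (L h) \<in> ball (f (L h)) r" using \<delta>(2) by (simp add: dist_norm)
  qed
  have "crossing X (L ` {0<..<1}) u k \<delta> E0"
  proof (unfold_locales)
    show "norm u = 1" "\<delta> > 0" by (fact u \<delta>)+
    show "developing X (ball 0 \<delta>) E0" unfolding E0_def by (rule chart_inverse(1)[OF U(1) _ sub]) simp
    show "inj_on E0 (ball 0 \<delta>)"
    proof (rule inj_onI)
      fix x y assume xy: "x \<in> ball 0 \<delta>" "y \<in> ball 0 \<delta>" "E0 x = E0 y"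
      have "of_real 1 * x + f (L h) = of_real 1 * y + f (L h)"
        by (rule inv_into_injective[OF xy(3)[unfolded E0_def]]) (use sub xy in auto)
      then show "x = y" by simp
    qed
    show "E0 (of_real \<tau> * u) \<in> L ` {0<..<1}" if \<tau>: "\<bar>\<tau>\<bar> < \<delta>" for \<tau>
    proof -
      have "\<phi> (h - m) \<le> \<tau>" "\<tau> \<le> \<phi> (h + m)" "h - m \<le> h + m" using \<tau> \<delta> m by auto
      then obtain s where s: "s \<in> J" "\<phi> s = \<tau>"
        using IVT'[of \<phi> "h - m" \<tau> "h + m"] \<open>continuous_on J \<phi>\<close> by (auto simp: J_def)
      have "E0 (of_real \<tau> * u) = inv_into U f (f (L s))" using \<phi>(1)[OF s(1)] s(2) by (simp add: E0_def add.commute)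
      also have "\<dots> = L s" by (rule inv_into_f_f[OF chart_inj[OF U(1)] J01(3)[OF s(1)]])
      finally show ?thesis using J01(1)[OF s(1)] by blast
    qed
    show "finite {t \<in> interior I. \<gamma> t \<in> L ` {0<..<1}} \<and> card {t \<in> interior I. \<gamma> t \<in> L ` {0<..<1}} \<le> k"
      if "v \<noteq> u" "v \<noteq> - u" "trajectory X I \<gamma> v" for v I \<gamma>
      using bound[OF that(3)] that(1,2) by (simp add: crossing_times_def)
  qed
  then show ?thesis using that by blast
qed

end

theorem corollary4p7:
  fixes X :: "'a dilation_surface" and L :: "real \<Rightarrow> 'a"
  assumes "closed_dilation_surface X"
    and "horizon_saddle_connection X L"
  shows "hyperbolic_directions X \<subseteq> sphere 0 1 \<and>
         top_of_set (sphere 0 1) closure_of hyperbolic_directions X = sphere 0 1"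
proof -
  interpret dilation_surf X by unfold_locales (rule assms(1))
  obtain u k where "saddle_connection X L u" and "\<And>I \<gamma> v. trajectory X I \<gamma> v \<Longrightarrow>
      finite (crossing_times L u I \<gamma> v) \<and> card (crossing_times L u I \<gamma> v) \<le> k"
    using assms(2) unfolding horizon_saddle_connection_def by blast
  from crossing_base_exists[OF this] obtain \<delta> E0 where "crossing X (L ` {0<..<1}) u k \<delta> E0" by metis
  then interpret crossing X "L ` {0<..<1}" u k \<delta> E0 .
  have sphere: "hyperbolic_directions X \<subseteq> sphere 0 1"
    by (auto simp: hyperbolic_directions_def closed_geodesic_def trajectory_def)
  moreover have "sphere 0 1 \<subseteq> closure (hyperbolic_directions X)"
  proof
    fix w :: complex assume "w \<in> sphere 0 1"
    then show "w \<in> closure (hyperbolic_directions X)"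
      using hyperbolic_directions_dense[of w] by (auto simp: closure_approachable dist_norm)
  qed
  ultimately show ?thesis
    by (auto simp: closure_of_subtopology Int_absorb1)
qed

end
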